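(* Let the link function $f$ satisfy the standing assumption stated in the context (monotone and bounded, locally linear near $x=1$ with constants $\gamma_0,\gamma_1,\gamma_2$), and suppose in addition that at least one of the following holds: (a) there is an absolute constant $c_0>0$ with $f'(x)\ge c_0$ for all $x\in[0,1]$; or (b) $f$ is convex on $[0,1]$. Then the interactive SGD described in the context, run with proper schedules $(\eta_t,\sigma_t)_{t\ge1}$ and preceded by the hypothesis testing subroutine for initialization described in the context, satisfies the following, where $m_t=\langle\theta^\star,\theta_t\rangle$. 1. (Pure exploration) For $\varepsilon,\delta>0$, with proper schedules, $m_T\ge 1-\varepsilon$ with probability at least $1-\delta T$, where $$T=\widetilde{O}\left(d^2\int_{1/(2\sqrt d)}^{1-\gamma_0/4}\frac{m}{f'(m)^2}\,\mathrm{d}m+\frac{d^2}{\varepsilon}\right).$$ 2. (Regret minimization) For $\delta>0$, with proper schedules, with probability at least $1-\delta T$ the regret satisfies $$\sum_{t=1}^T\big(f(1)-f(m_t)\big)=\widetilde{O}\left(\min\left\{T,\ d^2\int_{1/(2\sqrt d)}^{1-\gamma_0/2}\frac{m}{f'(m)^2}\,\mathrm{d}m+d\sqrt T\right\}\right).$$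
   Context: Setting. Let $d\ge 2$, $\mathbb{S}^{d-1}$ the unit sphere of $\mathbb{R}^d$, $\theta^\star\in\mathbb{S}^{d-1}$ unknown, and $f:[-1,1]\to\mathbb{R}$ a known differentiable link function. At each round $t\ge1$ the learner plays an action $a_t\in\mathbb{S}^{d-1}$ and observes $r_t=f(\langle\theta^\star,a_t\rangle)+\varepsilon_t$, where the noise $\varepsilon_t$ is, conditionally on the past and on $a_t$, zero-mean and 1-subGaussian. Interactive SGD with schedules $(\eta_t,\sigma_t)_{t\ge1}$, $\eta_t>0$, $\sigma_t\in[0,1]$: given $\theta_t\in\mathbb{S}^{d-1}$, draw (with fresh randomness) $Z_t$ uniformly from $\{a\in\mathbb{S}^{d-1}:\langle a,\theta_t\rangle=0\}$, play $$a_t=\sqrt{1-\sigma_t^2}\,\theta_t+\sigma_tZ_t,$$ and update $$\theta_{t+1/2}=\theta_t-\eta_t\big(f(\langle\theta_t,a_t\rangle)-r_t\big)f'(\langle\theta_t,a_t\rangle)\,(I-\theta_t\theta_t^\top)a_t,\qquad \theta_{t+1}=\frac{\theta_{t+1/2}}{\|\theta_{t+1/2}\|}.$$ Standing assumption on $f$: (i) $f:[-1,1]\to[-1,1]$ is non-decreasing; (ii) $0<\gamma_1\le f'(x)\le\gamma_2$ for all $x\in[1-\gamma_0,1]$, where $\gamma_0,\gamma_1,\gamma_2>0$ are absolute constants with $\gamma_0\le 0.1$. Initialization subroutine: a uniform random $\theta\sim\mathrm{Unif}(\mathbb{S}^{d-1})$ satisfies $\langle\theta^\star,\theta\rangle\ge1/\sqrt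 d$ with constant probability; a known hypothesis testing subroutine (available as a black box) draws such candidates and, using $\widetilde{O}\big((f(1/\sqrt d)-f(0))^{-2}\big)$ rounds of interaction, certifies with high probability an initial point with $\langle\theta^\star,\theta_1\rangle\ge1/\sqrt d$, from which SGD is then started. These rounds are counted in $T$ (and, in the regret, each round contributes at most $f(1)-f(-1)\le 2$). Asymptotic notation: $\widetilde{O}$ hides constants depending only on $\gamma_0,\gamma_1,\gamma_2$ (and $c_0$ in case (a)) and factors polynomial in the logarithms of $d$, $1/\varepsilon$, $1/\delta$ and, for the regret bound, $T$. Integrals are allowed to equal $+\infty$, in which case part 1 is vacuous and the minimum in part 2 equals $T$. *)

theory Defs
  imports "HOL-Probability.Probability"
begin

text \<open>
  The hidden constants must not depend on the dimension, so the dimension cannot be a type: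
  a vector of \<open>\<real>\<^sup>d\<close> is a function \<open>nat \<Rightarrow> real\<close> that vanishes from index \<open>d\<close> on.
\<close>

type_synonym rvec = "nat \<Rightarrow> real"

definition inner_d :: "nat \<Rightarrow> rvec \<Rightarrow> rvec \<Rightarrow> real" where
  "inner_d d x y = (\<Sum>i<d. x i * y i)"

definition usphere :: "nat \<Rightarrow> rvec set" where
  "usphere d = {x. (\<forall>i\<ge>d. x i = 0) \<and> L2_set x {..<d} = 1}"

definition normalize_d :: "nat \<Rightarrow> rvec \<Rightarrow> rvec" where
  "normalize_d d x = (\<lambda>i. x i / L2_set x {..<d})"

text \<open>The matrix \<open>I - \<theta> \<theta>\<^sup>T\<close> applied to \<open>x\<close>.\<close>

definition proj_orth :: "nat \<Rightarrow> rvec \<Rightarrow> rvec \<Rightarrow> rvec" where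
  "proj_orth d \<theta> x = (\<lambda>i. x i - inner_d d \<theta> x * \<theta> i)"

definition std_gaussian :: "nat \<Rightarrow> rvec measure" where
  "std_gaussian d =
     distr (Pi\<^sub>M {..<d} (\<lambda>_. density lborel (\<lambda>x. ennreal (std_normal_density x)))) borel
       (\<lambda>g i. if i < d then g i else 0)"

text \<open>
  The uniform distribution on \<open>{a \<in> S\<^bsup>d-1\<^esup>. \<langle>a, \<theta>\<rangle> = 0}\<close>. The projection of a standard Gaussian vector
  to the hyperplane orthogonal to \<open>\<theta>\<close> has a rotation invariant law, so its direction is uniform.
  For \<open>d \<ge> 2\<close> the projection is almost surely nonzero; for \<open>d = 2\<close> the law is uniform on two
  antipodal points.
\<close>

definition unif_orth_sphere :: "nat \<Rightarrow> rvec \<Rightarrow> rvec measure" where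
  "unif_orth_sphere d \<theta> =
     distr (std_gaussian d) borel (\<lambda>g. normalize_d d (proj_orth d \<theta> g))"

definition action_law :: "nat \<Rightarrow> real \<Rightarrow> rvec \<Rightarrow> rvec measure" where
  "action_law d s \<theta> =
     distr (unif_orth_sphere d \<theta>) borel (\<lambda>z i. sqrt (1 - s\<^sup>2) * \<theta> i + s * z i)"

definition sgd_step :: "nat \<Rightarrow> (real \<Rightarrow> real) \<Rightarrow> (real \<Rightarrow> real) \<Rightarrow> real \<Rightarrow> rvec \<Rightarrow> rvec \<Rightarrow> real \<Rightarrow> rvec"
  where
  "sgd_step d f f' h \<theta> a r =
     normalize_d d
       (\<lambda>i. \<theta> i - h * (f (inner_d d \<theta> a) - r) * f' (inner_d d \<theta> a) * proj_orth d \<theta> a i)"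

text \<open>
  Canonical model: a sample point is the whole trajectory, and its entry at \<open>t \<ge> 1\<close> is the triple
  \<open>(\<theta>\<^sub>t, a\<^sub>t, \<epsilon>\<^sub>t)\<close>; entry \<open>0\<close> is unused. Given the actions, recording the noise or the reward
  generates the same information.
\<close>

type_synonym trajectory = "nat \<Rightarrow> rvec \<times> rvec \<times> real"

definition iterate :: "nat \<Rightarrow> trajectory \<Rightarrow> rvec" where
  "iterate t \<omega> = fst (\<omega> t)"

definition action :: "nat \<Rightarrow> trajectory \<Rightarrow> rvec" where
  "action t \<omega> = fst (snd (\<omega> t))"

definition noise :: "nat \<Rightarrow> trajectory \<Rightarrow> real" where
  "noise t \<omega> = snd (snd (\<omega> t))"

definition sphere_space :: "nat \<Rightarrow> rvec measure" where
  "sphere_space d = restrict_space borel (usphere d)"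

definition round_space :: "nat \<Rightarrow> (rvec \<times> rvec \<times> real) measure" where
  "round_space d = sphere_space d \<Otimes>\<^sub>M sphere_space d \<Otimes>\<^sub>M borel"

definition trajectory_space :: "nat \<Rightarrow> trajectory measure" where
  "trajectory_space d = Pi\<^sub>M UNIV (\<lambda>_. round_space d)"

text \<open>The information before \<open>a\<^sub>t\<close> is drawn: the earlier rounds and \<open>\<theta>\<^sub>t\<close>.\<close>

definition past :: "nat \<Rightarrow> nat \<Rightarrow> trajectory measure" where
  "past d t =
     vimage_algebra (space (trajectory_space d)) (\<lambda>\<omega>. (restrict \<omega> {1..<t}, iterate t \<omega>))
       (Pi\<^sub>M {1..<t} (\<lambda>_. round_space d) \<Otimes>\<^sub>M sphere_space d)"

definition past_and_action :: "nat \<Rightarrow> nat \<Rightarrow> trajectory measure" where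
  "past_and_action d t =
     vimage_algebra (space (trajectory_space d))
       (\<lambda>\<omega>. (restrict \<omega> {1..<t}, iterate t \<omega>, action t \<omega>))
       (Pi\<^sub>M {1..<t} (\<lambda>_. round_space d) \<Otimes>\<^sub>M sphere_space d \<Otimes>\<^sub>M sphere_space d)"

definition reward :: "nat \<Rightarrow> (real \<Rightarrow> real) \<Rightarrow> rvec \<Rightarrow> nat \<Rightarrow> trajectory \<Rightarrow> real" where
  "reward d f \<theta>s t \<omega> = f (inner_d d \<theta>s (action t \<omega>)) + noise t \<omega>"

definition alignment :: "nat \<Rightarrow> rvec \<Rightarrow> nat \<Rightarrow> trajectory \<Rightarrow> real" where
  "alignment d \<theta>s t \<omega> = inner_d d \<theta>s (iterate t \<omega>)"

definition regret :: "nat \<Rightarrow> (real \<Rightarrow> real) \<Rightarrow> rvec \<Rightarrow> nat \<Rightarrow> trajectory \<Rightarrow> real" where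
  "regret d f \<theta>s T \<omega> = (\<Sum>t=1..T. f 1 - f (alignment d \<theta>s t \<omega>))"

text \<open>\<open>M\<close> is the law of a trajectory.\<close>

locale bandit_interaction = prob_space M for M :: "trajectory measure" +
  fixes d :: nat
  assumes sets_M: "sets M = sets (trajectory_space d)"
    and noise_integrable: "\<And>t. 1 \<le> t \<Longrightarrow> integrable M (noise t)"
    and noise_centred:
      "\<And>t. 1 \<le> t \<Longrightarrow> AE \<omega> in M. real_cond_exp M (past_and_action d t) (noise t) \<omega> = 0"
    and noise_subgaussian:
      "\<And>t l::real. 1 \<le> t \<Longrightarrow>
         AE \<omega> in M. nn_cond_exp M (past_and_action d t) (\<lambda>\<omega>. ennreal (exp (l * noise t \<omega>))) \<omega>
           \<le> ennreal (exp (l\<^sup>2 / 2))"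

text \<open>
  Rounds \<open>1, \<dots>, n0\<close> belong to the initialization subroutine, a black box of which only the outcome
  is specified: the starting point \<open>\<theta>\<close> at time \<open>n0 + 1\<close> is certified with probability at least
  \<open>1 - \<delta>\<close>. In these rounds \<open>\<theta>\<^sub>t\<close> is any unit vector (for instance the action played), so that each of
  them contributes at most \<open>f 1 - f (-1)\<close> to the regret. Step \<open>s \<ge> 1\<close> of SGD, with
  parameters \<open>\<eta> s\<close> and \<open>\<sigma> s\<close>, is round \<open>n0 + s\<close>.
\<close>

locale interactive_sgd = bandit_interaction M d for M :: "trajectory measure" and d :: nat +
  fixes f f' :: "real \<Rightarrow> real" and \<theta>s :: rvec and n0 :: nat and \<delta> :: real
    and \<eta> \<sigma> :: "nat \<Rightarrow> real"
  assumes init_certified: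
      "1 - \<delta> \<le> prob {\<omega> \<in> space M. 1 / sqrt (real d) \<le> alignment d \<theta>s (n0 + 1) \<omega>}"
    and action_distribution:
      "\<And>s B. 1 \<le> s \<Longrightarrow> B \<in> sets (sphere_space d) \<Longrightarrow>
         AE \<omega> in M. real_cond_exp M (past d (n0 + s)) (\<lambda>\<omega>. indicator B (action (n0 + s) \<omega>)) \<omega>
           = measure (action_law d (\<sigma> s) (iterate (n0 + s) \<omega>)) B"
    and update:
      "\<And>s. 1 \<le> s \<Longrightarrow>
         AE \<omega> in M. iterate (n0 + s + 1) \<omega> =
           sgd_step d f f' (\<eta> s) (iterate (n0 + s) \<omega>) (action (n0 + s) \<omega>)
             (reward d f \<theta>s (n0 + s) \<omega>)"

definition schedules :: "(nat \<Rightarrow> real) \<Rightarrow> (nat \<Rightarrow> real) \<Rightarrow> bool" where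
  "schedules \<eta> \<sigma> \<longleftrightarrow> (\<forall>s\<ge>1. 0 < \<eta> s \<and> 0 \<le> \<sigma> s \<and> \<sigma> s \<le> 1)"

text \<open>Only the values of \<open>f\<close> and its derivative \<open>f'\<close> on \<open>[-1, 1]\<close> matter.\<close>

definition link_function ::
    "real \<Rightarrow> real \<Rightarrow> real \<Rightarrow> (real \<Rightarrow> real) \<Rightarrow> (real \<Rightarrow> real) \<Rightarrow> bool" where
  "link_function \<gamma>0 \<gamma>1 \<gamma>2 f f' \<longleftrightarrow>
     (\<forall>x\<in>{-1..1}. (f has_real_derivative f' x) (at x within {-1..1})) \<and>
     f ` {-1..1} \<subseteq> {-1..1} \<and> mono_on {-1..1} f \<and>
     (\<forall>x\<in>{1 - \<gamma>0..1}. \<gamma>1 \<le> f' x \<and> f' x \<le> \<gamma>2)"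

text \<open>
  \<open>\<integral> m / f'(m)\<^sup>2 dm\<close> from \<open>1 / (2 \<surd>d)\<close> to \<open>b\<close>, with value \<open>\<infinity>\<close> allowed;
  the integrand is \<open>\<infinity>\<close> at positive zeros of \<open>f'\<close>.
\<close>

definition burn_in :: "nat \<Rightarrow> (real \<Rightarrow> real) \<Rightarrow> real \<Rightarrow> ennreal" where
  "burn_in d f' b =
     (\<integral>\<^sup>+m\<in>{1 / (2 * sqrt (real d))..b}. ennreal m / ennreal ((f' m)\<^sup>2) \<partial>lborel)"

text \<open>
  A logarithm that is at least \<open>1\<close> on the positive reals. A factor that is polynomial in logarithms
  is written as a constant times a power of a product of such terms.
\<close>

definition lg :: "real \<Rightarrow> real" where
  "lg x = ln (exp 1 + x)"

text \<open>
  The number of rounds of the initialization is of order \<open>(f (1 / \<surd>d) - f 0)\<^sup>-\<^sup>2\<close> up to logarithms.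
  There is no constraint if the gap vanishes; \<open>burn_in\<close> is then infinite.
\<close>

definition init_budget :: "real \<Rightarrow> nat \<Rightarrow> nat \<Rightarrow> (real \<Rightarrow> real) \<Rightarrow> real \<Rightarrow> nat \<Rightarrow> bool" where
  "init_budget C0 k0 d f \<delta> n0 \<longleftrightarrow>
     (f 0 < f (1 / sqrt (real d)) \<longrightarrow>
        real n0 \<le> C0 * (lg (real d) * lg (1 / \<delta>)) ^ k0 / (f (1 / sqrt (real d)) - f 0)\<^sup>2)"

end

theory Submission
  imports Defs
begin

text \<open>
  A constant exploration radius suffices: the regret is measured at \<open>\<theta>\<^sub>t\<close>, so pure exploration already
  yields the regret bound. Let \<open>U\<close> be the component of the exploration direction along \<open>\<theta>\<^sup>*\<close>.
  Symmetry of \<open>U\<close> and monotonicity of \<open>f\<close> give the alignment a drift proportional to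
  \<open>\<eta> \<phi>(m) E U\<^sup>2\<close>, where \<open>\<phi>\<close> is a monotone lower bound of \<open>f'\<close>, and the exponential moments of the
  fluctuation are also controlled by \<open>E U\<^sup>2\<close>, which is at least of order \<open>(1 - m\<^sup>2) / d\<close>.

  Time is cut into epochs in which the level \<open>a\<close> grows by \<open>g = a (1 - a) / 16\<close> with step size of order
  \<open>\<phi> g / (d a\<^sup>2)\<close>. Within an epoch \<open>exp ((L / g) (b - m))\<close>, with a barrier \<open>b\<close> that rises linearly, is
  almost a supermartingale on the event that the barrier has been respected so far, so that each step
  fails with probability at most \<open>\<delta>\<close>. An epoch takes about \<open>d\<^sup>2 a\<^sup>2 / (\<phi>\<^sup>2 (1 - a))\<close> steps; summed over
  the epochs this is the integral of \<open>m / \<phi>\<^sup>2\<close> up to a constant level and a geometric series from there.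
  Horizons beyond \<open>1 / \<delta>\<close> are trivial, which keeps the logarithm of the horizon out of the schedule.
\<close>

section \<open>Vectors and Gaussian moments\<close>

text \<open>Three obstacles shape the estimates. The slope of the link is bounded from below only to
  the right of the current point; to the left there is just monotonicity, and the symmetry of
  \<open>U\<close> turns this one-sided information into half of its second moment. Normalization
  costs a term quadratic in the step, and balancing it against the drift fixes the step size: with
  \<open>1 - a\<close> of order \<open>g / a\<close>, the drift
  \<open>\<eta> * \<phi> * (1 - a) / d\<close> dominates the loss
  \<open>a * \<eta>\<^sup>2 * L\<close> once \<eta> is of order
  \<open>\<phi> * g / (L * d * a\<^sup>2)\<close>. Finally, the hypotheses on noise and actions are
  stated for one exponent and one event at a time, whereas the update couples both with the random
  iterate; they are extended to random exponents and to the joint law of iterate and action before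
  any moment is taken. For the regret, \<open>1 - m\<close> is of order \<open>d\<^sup>2 / s\<close>
  at a step \<open>s\<close> past the burn-in, up to logarithms, so the sum is harmonic. The
  resulting \<open>d\<^sup>2\<close> is absorbed because the burn-in integral is bounded from below
  by a constant.\<close>

lemma inner_d_self: "inner_d d x x = (L2_set x {..<d})\<^sup>2"
  by (simp add: inner_d_def L2_set_def power2_eq_square[symmetric] sum_nonneg)

lemma inner_d_commute: "inner_d d x y = inner_d d y x"
  by (simp add: inner_d_def mult.commute)

lemma inner_d_add_right: "inner_d d x (\<lambda>i. y i + z i) = inner_d d x y + inner_d d x z"
  by (simp add: inner_d_def distrib_left sum.distrib)

lemma inner_d_diff_right: "inner_d d x (\<lambda>i. y i - z i) = inner_d d x y - inner_d d x z"
  by (simp add: inner_d_def right_diff_distrib sum_subtractf)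

lemma inner_d_scale_right: "inner_d d x (\<lambda>i. c * y i) = c * inner_d d x y"
  by (simp add: inner_d_def sum_distrib_left ac_simps)

lemma inner_d_divide_right: "inner_d d x (\<lambda>i. y i / c) = inner_d d x y / c"
  by (simp add: inner_d_def sum_divide_distrib)

lemma inner_d_Cauchy_Schwarz: "\<bar>inner_d d x y\<bar> \<le> L2_set x {..<d} * L2_set y {..<d}"
proof -
  have "\<bar>inner_d d x y\<bar> \<le> (\<Sum>i<d. \<bar>x i\<bar> * \<bar>y i\<bar>)"
    unfolding inner_d_def by (rule order_trans[OF sum_abs]) (simp add: abs_mult)
  also have "\<dots> \<le> L2_set x {..<d} * L2_set y {..<d}"
    by (rule L2_set_mult_ineq)
  finally show ?thesis .
qed

lemma usphereD: "x \<in> usphere d \<Longrightarrow> L2_set x {..<d} = 1" "x \<in> usphere d \<Longrightarrow> inner_d d x x = 1"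
  by (auto simp: usphere_def inner_d_self)

lemma usphere_inner_le: "x \<in> usphere d \<Longrightarrow> y \<in> usphere d \<Longrightarrow> \<bar>inner_d d x y\<bar> \<le> 1"
  using inner_d_Cauchy_Schwarz[of d x y] by (simp add: usphereD)

lemma inner_d_proj_orth:
  "inner_d d x (proj_orth d \<theta> y) = inner_d d x y - inner_d d \<theta> y * inner_d d x \<theta>"
  by (simp add: proj_orth_def inner_d_diff_right inner_d_scale_right)

lemma inner_d_proj_orth_self:
  assumes "\<theta> \<in> usphere d"
  shows "inner_d d (proj_orth d \<theta> x) (proj_orth d \<theta> x) = inner_d d x x - (inner_d d \<theta> x)\<^sup>2"
    and "inner_d d \<theta> (proj_orth d \<theta> x) = 0"
    and "inner_d d (proj_orth d \<theta> x) y = inner_d d x (proj_orth d \<theta> y)"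
proof -
  have 1: "inner_d d (proj_orth d \<theta> x) y = inner_d d x y - inner_d d \<theta> x * inner_d d \<theta> y" for x y
    by (subst inner_d_commute) (simp add: inner_d_proj_orth inner_d_commute)
  show "inner_d d \<theta> (proj_orth d \<theta> x) = 0" for x
    by (simp add: inner_d_proj_orth usphereD[OF assms])
  then show "inner_d d (proj_orth d \<theta> x) (proj_orth d \<theta> x) = inner_d d x x - (inner_d d \<theta> x)\<^sup>2"
    by (simp add: 1) (simp add: inner_d_proj_orth inner_d_commute power2_eq_square)
  show "inner_d d (proj_orth d \<theta> x) y = inner_d d x (proj_orth d \<theta> y)"
    by (simp add: 1 inner_d_proj_orth inner_d_commute)
qed

lemma inner_d_normalize: "inner_d d x (normalize_d d y) = inner_d d x y / L2_set y {..<d}"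
  by (simp add: normalize_d_def inner_d_divide_right)

lemma measurable_inner_d [measurable (raw)]:
  assumes [measurable]: "f \<in> borel_measurable M" "g \<in> borel_measurable M"
  shows "(\<lambda>x. inner_d d (f x) (g x)) \<in> borel_measurable M"
proof -
  have [measurable]: "(\<lambda>x. f x i) \<in> borel_measurable M" "(\<lambda>x. g x i) \<in> borel_measurable M" for i
    using assms by (auto intro: measurable_product_then_coordinatewise)
  show ?thesis unfolding inner_d_def by measurable
qed

lemma measurable_rvec_iff:
  "(f :: 'a \<Rightarrow> rvec) \<in> borel_measurable M \<longleftrightarrow> (\<forall>i. (\<lambda>x. f x i) \<in> borel_measurable M)"
  by (auto intro: measurable_coordinatewise_then_product measurable_product_then_coordinatewise)

lemma L2_set_inner_d: "L2_set x {..<d} = sqrt (inner_d d x x)"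
  by (simp add: inner_d_self L2_set_nonneg)

text \<open>The increment is orthogonal to the unit vector \<theta> and has length
  \<open>\<bar>w\<bar> * sqrt (1 - c\<^sup>2)\<close>, so Pythagoras makes the normalizing factor
  explicit. The reward enters only through the scalar \<open>w\<close>.\<close>

lemma inner_d_sgd_step:
  fixes f f' :: "real \<Rightarrow> real" and h r :: real
  assumes "\<theta> \<in> usphere d" "a \<in> usphere d" and c: "inner_d d \<theta> a = c"
  defines "w \<equiv> h * (r - f c) * f' c"
  shows "inner_d d \<theta>s (sgd_step d f f' h \<theta> a r) =
    (inner_d d \<theta>s \<theta> + w * inner_d d \<theta>s (proj_orth d \<theta> a)) / sqrt (1 + w\<^sup>2 * (1 - c\<^sup>2))"
proof -
  define v where "v = proj_orth d \<theta> a"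
  have eq: "(\<lambda>i. \<theta> i - h * (f c - r) * f' c * v i) = (\<lambda>i. \<theta> i + w * v i)"
    by (auto simp: w_def algebra_simps)
  have vv: "inner_d d v v = 1 - c\<^sup>2" "inner_d d \<theta> v = 0"
    using assms inner_d_proj_orth_self(1,2)[OF assms(1), of a] by (auto simp: v_def usphereD)
  let ?y = "\<lambda>i. \<theta> i + w * v i"
  have "inner_d d ?y ?y = inner_d d ?y \<theta> + w * inner_d d ?y v"
    by (simp add: inner_d_add_right inner_d_scale_right)
  also have "\<dots> = inner_d d \<theta> ?y + w * inner_d d v ?y" by (simp add: inner_d_commute)
  also have "\<dots> = 1 + w\<^sup>2 * (1 - c\<^sup>2)"
    using vv inner_d_commute[of d v \<theta>] usphereD[OF assms(1)]
    by (simp add: inner_d_add_right inner_d_scale_right power2_eq_square)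
  finally have "L2_set ?y {..<d} = sqrt (1 + w\<^sup>2 * (1 - c\<^sup>2))" by (simp add: L2_set_inner_d)
  then show ?thesis unfolding sgd_step_def c v_def[symmetric] eq inner_d_normalize
    by (simp add: inner_d_add_right inner_d_scale_right)
qed

section \<open>Standard Gaussian vectors: symmetry and moments of linear forms\<close>

definition std_normal :: "real measure" where
  "std_normal = density lborel (\<lambda>x. ennreal (std_normal_density x))"

lemma prob_space_std_normal: "prob_space std_normal"
  unfolding std_normal_def by (rule prob_space_normal_density) simp

lemma sets_std_normal [simp, measurable_cong]: "sets std_normal = sets borel"
  by (simp add: std_normal_def)

definition gauss_prod :: "nat \<Rightarrow> rvec measure" where
  "gauss_prod d = Pi\<^sub>M {..<d} (\<lambda>_. std_normal)"

text \<open>Points of the product measure are \<open>undefined\<close> from index \<open>d\<close>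
  on, whereas vectors have to vanish there.\<close>

definition pad0 :: "nat \<Rightarrow> rvec \<Rightarrow> rvec" where
  "pad0 d g = (\<lambda>i. if i < d then g i else 0)"

lemma std_gaussian_eq: "std_gaussian d = distr (gauss_prod d) borel (pad0 d)"
  by (simp add: std_gaussian_def gauss_prod_def std_normal_def pad0_def [abs_def])

lemma prob_space_gauss_prod: "prob_space (gauss_prod d)"
  unfolding gauss_prod_def by (intro prob_space_PiM prob_space_std_normal)

lemma pad0_measurable [measurable]: "pad0 d \<in> gauss_prod d \<rightarrow>\<^sub>M borel"
  unfolding measurable_rvec_iff
proof
  fix i
  show "(\<lambda>x. pad0 d x i) \<in> borel_measurable (gauss_prod d)"
    by (cases "i < d") (simp_all add: pad0_def gauss_prod_def)
qed

lemma prob_space_std_gaussian: "prob_space (std_gaussian d)"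
  unfolding std_gaussian_eq by (intro prob_space.prob_space_distr prob_space_gauss_prod) simp

lemma sets_std_gaussian [simp, measurable_cong]: "sets (std_gaussian d) = sets borel"
  by (simp add: std_gaussian_def)

lemma space_std_gaussian [simp]: "space (std_gaussian d) = UNIV"
  by (simp add: std_gaussian_def)

lemma std_normal_uminus: "distr std_normal std_normal uminus = std_normal"
proof -
  have "std_normal = density (distr lborel borel uminus) (\<lambda>x. ennreal (std_normal_density x))"
    by (simp add: std_normal_def lborel_distr_uminus)
  also have "\<dots> = distr (density lborel (\<lambda>x. ennreal (std_normal_density (- x)))) borel uminus"
    by (subst density_distr) auto
  also have "\<dots> = distr std_normal borel uminus"
    by (simp add: std_normal_def normal_density_def)
  also have "\<dots> = distr std_normal std_normal uminus"
    by (intro distr_cong) auto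
  finally show ?thesis by simp
qed

lemma gauss_prod_uminus:
  "distr (gauss_prod d) (gauss_prod d) (compose {..<d} uminus) = gauss_prod d"
  unfolding gauss_prod_def
  by (subst distr_PiM_finite_prob_space') (auto simp: prob_space_std_normal std_normal_uminus)

lemma measurable_compose_uminus [measurable]:
  "compose {..<d} uminus \<in> gauss_prod d \<rightarrow>\<^sub>M gauss_prod d"
  unfolding gauss_prod_def compose_def by measurable

lemma rvec_uminus_measurable [measurable]: "(\<lambda>g::rvec. (\<lambda>i. - g i)) \<in> borel_measurable borel"
  unfolding measurable_rvec_iff by (simp add: measurable_product_then_coordinatewise)

lemma std_gaussian_uminus: "distr (std_gaussian d) borel (\<lambda>g i. - g i) = std_gaussian d"
proof -
  have "std_gaussian d = distr (distr (gauss_prod d) (gauss_prod d) (compose {..<d} uminus)) borel (pad0 d)"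
    by (simp add: std_gaussian_eq gauss_prod_uminus)
  also have "\<dots> = distr (gauss_prod d) borel (pad0 d \<circ> compose {..<d} uminus)"
    by (subst distr_distr) auto
  also have "pad0 d \<circ> compose {..<d} uminus = (\<lambda>g i. - g i) \<circ> pad0 d"
    by (auto simp: fun_eq_iff pad0_def compose_def)
  also have "distr (gauss_prod d) borel \<dots> = distr (std_gaussian d) borel (\<lambda>g i. - g i)"
    unfolding std_gaussian_eq by (subst distr_distr) auto
  finally show ?thesis by simp
qed

lemma gauss_prod_component:
  "i < d \<Longrightarrow> distr (gauss_prod d) borel (\<lambda>g. g i) = std_normal"
  using distr_PiM_component[of "{..<d}" "\<lambda>_. std_normal" i] prob_space_std_normal
  by (simp add: gauss_prod_def cong: distr_cong)

lemma distributed_inner_d_gauss: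
  fixes v :: rvec
  assumes "0 < inner_d d v v"
  shows "distributed (gauss_prod d) lborel (inner_d d v) (normal_density 0 (sqrt (inner_d d v v)))"
proof -
  interpret G: prob_space "gauss_prod d" by (rule prob_space_gauss_prod)
  interpret P: product_prob_space "\<lambda>_::nat. std_normal" "{..<d}"
    by (intro product_prob_spaceI prob_space_std_normal)
  \<comment> \<open>The sum rule for independent normals asks for positive standard deviations, so
    coordinates of weight zero are left out; \<open>I\<close> is nonempty because the variance is
    positive.\<close>
  define I where "I = {i. i < d \<and> v i \<noteq> 0}"
  have I: "finite I" "I \<subseteq> {..<d}" by (auto simp: I_def)
  have sumI: "(\<Sum>i\<in>I. v i * g i) = inner_d d v g" for g
    unfolding inner_d_def using I by (intro sum.mono_neutral_left) (auto simp: I_def)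
  have ne: "I \<noteq> {}"
    using assms sumI[of v] by auto
  have meas: "(\<lambda>g. g i) \<in> borel_measurable (gauss_prod d)" if "i \<in> I" for i
    using that I unfolding gauss_prod_def by auto
  have "G.indep_vars (\<lambda>_. borel) (\<lambda>i g. g i) I"
  proof (subst G.indep_vars_iff_distr_eq_PiM')
    have "distr (gauss_prod d) (Pi\<^sub>M I (\<lambda>_. borel)) (\<lambda>x. \<lambda>i\<in>I. x i)
        = distr (gauss_prod d) (Pi\<^sub>M I (\<lambda>_. std_normal)) (\<lambda>x. restrict x I)"
      by (intro distr_cong sets_PiM_cong) auto
    also have "\<dots> = Pi\<^sub>M I (\<lambda>_. std_normal)"
      unfolding gauss_prod_def using I by (intro P.distr_PiM_restrict_finite) auto
    also have "\<dots> = (\<Pi>\<^sub>M i\<in>I. distr (gauss_prod d) borel (\<lambda>x. x i))"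
      using I by (intro PiM_cong) (auto simp: gauss_prod_component)
    finally show "distr (gauss_prod d) (Pi\<^sub>M I (\<lambda>_. borel)) (\<lambda>x. \<lambda>i\<in>I. x i)
      = (\<Pi>\<^sub>M i\<in>I. distr (gauss_prod d) borel (\<lambda>x. x i))" .
  qed (use ne meas in auto)
  then have ind: "G.indep_vars (\<lambda>_. borel) (\<lambda>i g. v i * g i) I"
    by (rule G.indep_vars_compose2[where Y = "\<lambda>i x. v i * x"]) auto
  have "distributed (gauss_prod d) lborel (\<lambda>g. \<Sum>i\<in>I. v i * g i)
     (normal_density (\<Sum>i\<in>I. 0) (sqrt (\<Sum>i\<in>I. \<bar>v i\<bar>\<^sup>2)))"
  proof (rule G.sum_indep_normal[OF I(1) ne ind])
    fix i assume i: "i \<in> I"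
    then show "0 < \<bar>v i\<bar>" by (auto simp: I_def)
    have "distributed (gauss_prod d) lborel (\<lambda>g. g i) std_normal_density"
      using i I meas[OF i] unfolding distributed_def
      by (auto simp: gauss_prod_component std_normal_def[symmetric] cong: distr_cong)
    from G.normal_density_affine[OF this, of "v i" 0] i
    show "distributed (gauss_prod d) lborel (\<lambda>g. v i * g i) (normal_density 0 \<bar>v i\<bar>)"
      by (auto simp: I_def)
  qed
  also have "(\<Sum>i\<in>I. \<bar>v i\<bar>\<^sup>2) = inner_d d v v"
    using sumI[of v] by (simp add: power2_eq_square)
  finally show ?thesis by (simp add: sumI[abs_def])
qed

lemma inner_d_pad0: "inner_d d v (pad0 d g) = inner_d d v g"
  by (simp add: inner_d_def pad0_def)

text \<open>These are the even moments of a centred normal law of variance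
  \<open>inner_d d v v\<close>. Variance zero has no normal density; there the form vanishes
  identically by Cauchy-Schwarz.\<close>

lemma gaussian_moments:
  fixes v :: rvec
  shows "has_bochner_integral (std_gaussian d) (\<lambda>g. (inner_d d v g) ^ 2) (inner_d d v v)"
    and "has_bochner_integral (std_gaussian d) (\<lambda>g. (inner_d d v g) ^ 4) (3 * (inner_d d v v)\<^sup>2)"
proof -
  let ?s = "inner_d d v v"
  have "0 \<le> ?s" by (simp add: inner_d_self)
  have *: "has_bochner_integral (gauss_prod d) (\<lambda>g. (inner_d d v g) ^ (2 * k))
      (fact (2 * k) / ((2 / (sqrt ?s)\<^sup>2) ^ k * fact k))" if "0 < ?s" for k
  proof -
    note D = distributed_inner_d_gauss[OF that]
    have m: "has_bochner_integral lborel (\<lambda>x. normal_density 0 (sqrt ?s) x * (x - 0) ^ (2 * k))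
        (fact (2 * k) / ((2 / (sqrt ?s)\<^sup>2) ^ k * fact k))"
      using that by (intro normal_moment_even) auto
    show ?thesis
      unfolding has_bochner_integral_iff
    proof
      show "integrable (gauss_prod d) (\<lambda>g. inner_d d v g ^ (2 * k))"
        using has_bochner_integral_iff[THEN iffD1, OF m]
        by (subst distributed_integrable[OF D, symmetric, where g="\<lambda>x. x ^ (2 * k)"]) auto
      show "(LINT g|gauss_prod d. inner_d d v g ^ (2 * k)) =
          fact (2 * k) / ((2 / (sqrt ?s)\<^sup>2) ^ k * fact k)"
        using has_bochner_integral_iff[THEN iffD1, OF m]
        by (subst distributed_integral[OF D, symmetric, where g="\<lambda>x. x ^ (2 * k)"]) auto
    qed
  qed
  have z: "inner_d d v g = 0" if "?s = 0" for g
    using inner_d_Cauchy_Schwarz[of d v g] that by (simp add: inner_d_self)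
  have 2: "has_bochner_integral (gauss_prod d) (\<lambda>g. (inner_d d v g) ^ 2) ?s"
  proof (cases "?s = 0")
    case False
    then have "0 < ?s" using \<open>0 \<le> ?s\<close> by simp
    then show ?thesis using *[of 1] by (simp add: power2_eq_square mult.commute)
  qed (simp add: z has_bochner_integral_zero)
  have 4: "has_bochner_integral (gauss_prod d) (\<lambda>g. (inner_d d v g) ^ 4) (3 * ?s\<^sup>2)"
  proof (cases "?s = 0")
    case False
    then have "0 < ?s" using \<open>0 \<le> ?s\<close> by simp
    then show ?thesis using *[of 2] by (simp add: fact_numeral power2_eq_square field_simps)
  qed (simp add: z has_bochner_integral_zero)
  show "has_bochner_integral (std_gaussian d) (\<lambda>g. (inner_d d v g) ^ 2) (inner_d d v v)"
    "has_bochner_integral (std_gaussian d) (\<lambda>g. (inner_d d v g) ^ 4) (3 * (inner_d d v v)\<^sup>2)"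
    using 2 4 unfolding std_gaussian_eq
    by (auto simp: has_bochner_integral_iff integrable_distr_eq integral_distr inner_d_pad0)
qed

section \<open>The exploration direction as a function of a Gaussian sample\<close>

definition orth_dir :: "nat \<Rightarrow> rvec \<Rightarrow> rvec \<Rightarrow> rvec" where
  "orth_dir d \<theta> g = normalize_d d (proj_orth d \<theta> g)"

text \<open>The action as a deterministic function of a Gaussian sample. As
  \<open>action_law\<close> is the image of \<open>std_gaussian\<close> under it, integrals over
  actions become Gaussian integrals.\<close>

definition play :: "nat \<Rightarrow> real \<Rightarrow> rvec \<Rightarrow> rvec \<Rightarrow> rvec" where
  "play d s \<theta> g = (\<lambda>i. sqrt (1 - s\<^sup>2) * \<theta> i + s * orth_dir d \<theta> g i)"

lemma orth_dir_measurable [measurable (raw)]: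
  assumes [measurable]: "f \<in> borel_measurable M" "g \<in> borel_measurable M"
  shows "(\<lambda>x. orth_dir d (f x) (g x)) \<in> borel_measurable M"
proof -
  have [measurable]: "(\<lambda>x. f x i) \<in> borel_measurable M" "(\<lambda>x. g x i) \<in> borel_measurable M" for i
    using assms by (auto intro: measurable_product_then_coordinatewise)
  show ?thesis unfolding orth_dir_def normalize_d_def L2_set_def proj_orth_def measurable_rvec_iff
    by measurable
qed

lemma play_measurable [measurable (raw)]:
  assumes [measurable]: "f \<in> borel_measurable M" "g \<in> borel_measurable M"
  shows "(\<lambda>x. play d s (f x) (g x)) \<in> borel_measurable M"
proof -
  have "(\<lambda>x. orth_dir d (f x) (g x)) \<in> borel_measurable M" by measurable
  then have [measurable]: "(\<lambda>x. f x i) \<in> borel_measurable M" "(\<lambda>x. orth_dir d (f x) (g x) i) \<in> borel_measurable M" for i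
    using assms by (auto intro: measurable_product_then_coordinatewise)
  show ?thesis unfolding play_def measurable_rvec_iff by measurable
qed

lemma action_law_eq: "action_law d s \<theta> = distr (std_gaussian d) borel (play d s \<theta>)"
proof -
  have 1: "(\<lambda>z i. sqrt (1 - s\<^sup>2) * \<theta> i + s * z i) \<in> borel \<rightarrow>\<^sub>M (borel :: rvec measure)"
    unfolding measurable_rvec_iff by (simp add: measurable_product_then_coordinatewise)
  show ?thesis
    unfolding action_law_def unif_orth_sphere_def orth_dir_def[symmetric]
    by (subst distr_distr[OF 1]) (auto simp: comp_def play_def [abs_def])
qed

text \<open>Equality can fail: where the projected Gaussian vanishes, division by zero yields the
  zero vector. The inequality holds for every sample, so the later bounds are pointwise.\<close>

lemma orth_dir_norm: "L2_set (orth_dir d \<theta> g) {..<d} \<le> 1"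
proof -
  let ?v = "proj_orth d \<theta> g"
  have "L2_set (orth_dir d \<theta> g) {..<d} = L2_set ?v {..<d} / L2_set ?v {..<d}"
    unfolding orth_dir_def normalize_d_def
    using L2_set_left_distrib[of "inverse (L2_set ?v {..<d})" ?v "{..<d}"]
    by (simp only: divide_inverse L2_set_nonneg inverse_nonnegative_iff_nonnegative)
  then show ?thesis by simp
qed

lemma inner_d_orth_dir:
  "inner_d d x (orth_dir d \<theta> g) = inner_d d x (proj_orth d \<theta> g) / L2_set (proj_orth d \<theta> g) {..<d}"
  by (simp add: orth_dir_def inner_d_normalize)

lemma inner_d_orth_dir_self: "\<theta> \<in> usphere d \<Longrightarrow> inner_d d \<theta> (orth_dir d \<theta> g) = 0"
  by (simp add: inner_d_orth_dir inner_d_proj_orth_self)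

lemma inner_d_orth_dir_le:
  assumes "x \<in> usphere d" shows "\<bar>inner_d d x (orth_dir d \<theta> g)\<bar> \<le> 1"
  using inner_d_Cauchy_Schwarz[of d x "orth_dir d \<theta> g"] orth_dir_norm[of d \<theta> g] usphereD[OF assms]
  by simp

lemma inner_d_orth_dir_uminus:
  "inner_d d x (orth_dir d \<theta> (\<lambda>i. - g i)) = - inner_d d x (orth_dir d \<theta> g)"
proof -
  have "proj_orth d \<theta> (\<lambda>i. - g i) = (\<lambda>i. - proj_orth d \<theta> g i)"
    by (simp add: proj_orth_def inner_d_def sum_negf)
  moreover have "L2_set (\<lambda>i. - v i) {..<d} = L2_set v {..<d}" for v by (simp add: L2_set_def)
  ultimately show ?thesis
    by (simp add: inner_d_orth_dir) (simp add: inner_d_def sum_negf)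
qed

lemma inner_d_play:
  "inner_d d x (play d s \<theta> g) = sqrt (1 - s\<^sup>2) * inner_d d x \<theta> + s * inner_d d x (orth_dir d \<theta> g)"
  by (simp add: play_def inner_d_add_right inner_d_scale_right)

lemma inner_d_play_self:
  "\<theta> \<in> usphere d \<Longrightarrow> inner_d d \<theta> (play d s \<theta> g) = sqrt (1 - s\<^sup>2)"
  by (simp add: inner_d_play inner_d_orth_dir_self usphereD)

lemma inner_d_proj_orth_play:
  assumes "\<theta> \<in> usphere d"
  shows "inner_d d x (proj_orth d \<theta> (play d s \<theta> g)) = s * inner_d d x (orth_dir d \<theta> g)"
  using assms
  by (simp add: inner_d_proj_orth inner_d_play inner_d_orth_dir_self usphereD)

lemma inner_d_play_le:
  assumes x: "x \<in> usphere d" "\<theta> \<in> usphere d" and s: "0 \<le> s" "s \<le> 1"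
  shows "\<bar>inner_d d x (play d s \<theta> g)\<bar> \<le> 1"
proof -
  have s2: "s\<^sup>2 \<le> 1" using s by (simp add: power_le_one)
  let ?z = "orth_dir d \<theta> g" and ?y = "play d s \<theta> g"
  have "inner_d d ?y ?y = sqrt (1 - s\<^sup>2) * inner_d d ?y \<theta> + s * inner_d d ?y ?z"
    by (rule inner_d_play)
  also have "inner_d d ?y \<theta> = sqrt (1 - s\<^sup>2)"
    using x(2) by (subst inner_d_commute) (rule inner_d_play_self)
  also have "inner_d d ?y ?z = s * inner_d d ?z ?z"
    using inner_d_orth_dir_self[OF x(2), of g]
    by (subst inner_d_commute) (simp add: inner_d_play inner_d_commute)
  also have "sqrt (1 - s\<^sup>2) * sqrt (1 - s\<^sup>2) + s * (s * inner_d d ?z ?z) = 1 - s\<^sup>2 + s\<^sup>2 * inner_d d ?z ?z"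
    using s2 by (simp add: power2_eq_square)
  also have "\<dots> \<le> 1 - s\<^sup>2 + s\<^sup>2 * 1"
    using orth_dir_norm[of d \<theta> g]
    by (intro add_left_mono mult_left_mono) (auto simp: inner_d_self L2_set_nonneg power_le_one)
  finally have "L2_set ?y {..<d} \<le> 1" by (simp add: L2_set_inner_d)
  then show ?thesis using inner_d_Cauchy_Schwarz[of d x ?y] usphereD[OF x(1)] by simp
qed

text \<open>
  With \<open>G = \<langle>x, Pg\<rangle>\<close> and \<open>P\<close> the projection orthogonal to \<open>\<theta>\<close>, the tangent of \<open>1 / y\<close> at \<open>y = 3 d\<close>
  bounds \<open>G\<^sup>2 / |Pg|\<^sup>2\<close> from below by a polynomial in Gaussian variables.
\<close>

lemma second_moment_orth_dir:
  assumes x: "x \<in> usphere d" "\<theta> \<in> usphere d" and d: "0 < d"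
  shows "(1 - (inner_d d x \<theta>)\<^sup>2) / (3 * real d) \<le>
    (\<integral>g. (inner_d d x (orth_dir d \<theta> g))\<^sup>2 \<partial>std_gaussian d)"
proof -
  interpret G: prob_space "std_gaussian d" by (rule prob_space_std_gaussian)
  define v where "v = proj_orth d \<theta> x"
  define S where "S = inner_d d v v"
  define U where "U g = inner_d d x (orth_dir d \<theta> g)" for g
  define n where "n g = inner_d d (proj_orth d \<theta> g) (proj_orth d \<theta> g)" for g
  have S: "S = 1 - (inner_d d x \<theta>)\<^sup>2"
    using inner_d_proj_orth_self(1)[OF x(2), of x] x inner_d_commute[of d x \<theta>]
    by (simp add: S_def v_def usphereD)
  have [measurable]: "U \<in> borel_measurable borel" unfolding U_def by measurable
  have U_le: "\<bar>U g\<bar> \<le> 1" for g unfolding U_def by (rule inner_d_orth_dir_le[OF x(1)])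
  have U2_le: "(U g)\<^sup>2 \<le> 1" for g using U_le[of g] by (simp add: abs_square_le_1)
  have intU: "integrable (std_gaussian d) (\<lambda>g. (U g)\<^sup>2)"
    using U2_le by (intro G.integrable_const_bound[where B=1]) auto
  show ?thesis
  proof (cases "S = 0")
    case True
    then show ?thesis using S by (auto intro!: integral_nonneg_AE)
  next
    case False
    moreover have "0 \<le> S" by (simp add: S_def inner_d_self)
    ultimately have S0: "0 < S" by simp
    \<comment> \<open>The lower bound \<open>?L\<close> below has mean
      \<open>2 * S / a - 3 * real d * S / a\<^sup>2\<close>; \<open>a = 3 * real d\<close> maximizes
      it, with value \<open>S / a\<close>.\<close>
    define a where "a = 3 * real d"
    have a0: "0 < a" using d by (simp add: a_def)
    \<comment> \<open>Coordinates are written as linear forms so that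
      \<open>gaussian_moments\<close> applies to them.\<close>
    define e :: "nat \<Rightarrow> rvec" where "e i = (\<lambda>j. if j = i then 1 else 0)" for i
    have e: "inner_d d (e i) g = g i" "inner_d d (e i) (e i) = 1" if "i < d" for i g
      using that by (auto simp: e_def inner_d_def if_distrib if_distribR sum.delta cong: if_cong)
    \<comment> \<open>Mixed terms, products of the squares of \<open>inner_d d v g\<close> and of a
      coordinate, are split by the weighted AM-GM inequality. The weight \<open>S\<close>, the
      variance of the form, equalizes the two fourth moments.\<close>
    let ?L = "\<lambda>g. (2 / a) * (inner_d d v g) ^ 2
      - (1 / a\<^sup>2) * (\<Sum>i<d. (inner_d d v g) ^ 4 / (2 * S) + (S / 2) * (inner_d d (e i) g) ^ 4)"
    have le: "?L g \<le> (U g)\<^sup>2" for g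
    proof -
      let ?G = "inner_d d v g"
      have G: "U g = ?G / sqrt (n g)"
        unfolding U_def inner_d_orth_dir n_def v_def inner_d_proj_orth_self(3)[OF x(2)] L2_set_inner_d ..
      have n0: "0 \<le> n g" by (simp add: n_def inner_d_self)
      have "n g \<le> inner_d d g g" unfolding n_def
        by (subst inner_d_proj_orth_self(1)[OF x(2)]) simp
      also have "inner_d d g g = (\<Sum>i<d. (inner_d d (e i) g)\<^sup>2)"
        unfolding inner_d_def[of d g g] by (intro sum.cong) (auto simp: e power2_eq_square)
      finally have "?G\<^sup>2 * n g \<le> ?G\<^sup>2 * (\<Sum>i<d. (inner_d d (e i) g)\<^sup>2)"
        by (intro mult_left_mono) auto
      also have "\<dots> = (\<Sum>i<d. ?G\<^sup>2 * (inner_d d (e i) g)\<^sup>2)" by (simp add: sum_distrib_left)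
      also have "\<dots> \<le> (\<Sum>i<d. ?G ^ 4 / (2 * S) + (S / 2) * (inner_d d (e i) g) ^ 4)"
      proof (rule sum_mono)
        fix i
        have "0 \<le> (?G\<^sup>2 - S * (inner_d d (e i) g)\<^sup>2)\<^sup>2 / (2 * S)" using S0 by simp
        also have "\<dots> = ?G ^ 4 / (2 * S) + (S / 2) * (inner_d d (e i) g) ^ 4 - ?G\<^sup>2 * (inner_d d (e i) g)\<^sup>2"
          using S0 by (simp add: field_simps power2_eq_square power4_eq_xxxx)
        finally show "?G\<^sup>2 * (inner_d d (e i) g)\<^sup>2 \<le> ?G ^ 4 / (2 * S) + (S / 2) * (inner_d d (e i) g) ^ 4"
          by simp
      qed
      finally have *: "?G\<^sup>2 * n g \<le> (\<Sum>i<d. ?G ^ 4 / (2 * S) + (S / 2) * (inner_d d (e i) g) ^ 4)" .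
      have "?L g \<le> (2 / a) * ?G\<^sup>2 - (1 / a\<^sup>2) * (?G\<^sup>2 * n g)"
        using * by (intro diff_left_mono mult_left_mono) auto
      also have "\<dots> \<le> (U g)\<^sup>2"
      proof (cases "n g = 0")
        case True
        then have "?G = 0"
          using inner_d_Cauchy_Schwarz[of d x "proj_orth d \<theta> g"]
          by (simp add: v_def inner_d_proj_orth_self(3)[OF x(2)] n_def inner_d_self)
        then show ?thesis by simp
      next
        case False
        then have n: "0 < n g" using n0 by simp
        have "0 \<le> (?G * (n g - a))\<^sup>2 / (a\<^sup>2 * n g)" using n by simp
        also have "\<dots> = ?G\<^sup>2 / n g - ((2 / a) * ?G\<^sup>2 - (1 / a\<^sup>2) * (?G\<^sup>2 * n g))"
          using n a0 by (simp add: field_simps power2_eq_square)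
        finally show ?thesis using n by (simp add: G power_divide)
      qed
      finally show ?thesis .
    qed
    have "has_bochner_integral (std_gaussian d) ?L
      ((2 / a) * S - (1 / a\<^sup>2) * (\<Sum>i<d. (3 * S\<^sup>2) / (2 * S) + (S / 2) * (3 * 1\<^sup>2)))"
    proof (intro has_bochner_integral_diff has_bochner_integral_mult_right has_bochner_integral_sum
        has_bochner_integral_add has_bochner_integral_divide_zero)
      show "has_bochner_integral (std_gaussian d) (\<lambda>x. inner_d d (e i) x ^ 4) (3 * 1\<^sup>2)" if "i \<in> {..<d}" for i
        using gaussian_moments(2)[of d "e i"] e(2)[of i] that by simp
    qed (auto simp: S_def intro!: gaussian_moments)
    moreover have "(2 / a) * S - (1 / a\<^sup>2) * (\<Sum>i<d. (3 * S\<^sup>2) / (2 * S) + (S / 2) * (3 * 1\<^sup>2)) = S / (3 * real d)"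
      using S0 d by (simp add: a_def field_simps power2_eq_square)
    ultimately have L: "has_bochner_integral (std_gaussian d) ?L (S / (3 * real d))" by simp
    have "S / (3 * real d) = (\<integral>g. ?L g \<partial>std_gaussian d)"
      using L by (simp add: has_bochner_integral_iff)
    also have "\<dots> \<le> (\<integral>g. (U g)\<^sup>2 \<partial>std_gaussian d)"
      using L le intU by (intro integral_mono) (auto simp: has_bochner_integral_iff)
    finally show ?thesis by (simp add: S U_def)
  qed
qed

text \<open>Reflecting the Gaussian sample preserves its law and reverses the direction, also at
  samples where the projection vanishes.\<close>

lemma integral_orth_dir_symmetric:
  assumes [measurable]: "h \<in> borel_measurable borel"
  shows "(\<integral>g. h (- inner_d d x (orth_dir d \<theta> g)) \<partial>std_gaussian d) =
    (\<integral>g. (h (inner_d d x (orth_dir d \<theta> g)) :: real) \<partial>std_gaussian d)"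
proof -
  have "(\<integral>g. h (inner_d d x (orth_dir d \<theta> g)) \<partial>std_gaussian d) =
    (\<integral>g. h (inner_d d x (orth_dir d \<theta> g)) \<partial>distr (std_gaussian d) borel (\<lambda>g i. - g i))"
    by (simp add: std_gaussian_uminus)
  also have "\<dots> = (\<integral>g. h (- inner_d d x (orth_dir d \<theta> g)) \<partial>std_gaussian d)"
    by (subst integral_distr) (auto simp: inner_d_orth_dir_uminus)
  finally show ?thesis ..
qed

text \<open>For \<open>y = - x\<close> with \<open>x > 0\<close> the claim is inverted: it follows
  from \<open>exp x \<ge> 1 + x + x\<^sup>2 / 2\<close>, since
  \<open>(1 - x + x\<^sup>2) * (1 + x + x\<^sup>2 / 2)\<close> exceeds 1 by terms of positive
  sign.\<close>

lemma exp_le_quadratic: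
  fixes y :: real
  assumes "\<bar>y\<bar> \<le> 1"
  shows "exp y \<le> 1 + y + y\<^sup>2"
proof (cases "0 \<le> y")
  case True
  then show ?thesis using assms exp_bound[of y] by simp
next
  case False
  define x where "x = - y"
  have x: "0 \<le> x" "x \<le> 1" using False assms by (auto simp: x_def)
  have pos: "0 < 1 - x + x\<^sup>2" using sum_squares_ge_zero[of "x - 1/2" 0]
    by (simp add: power2_eq_square algebra_simps)
  have "1 \<le> (1 - x + x\<^sup>2) * (1 + x + x\<^sup>2 / 2)"
  proof -
    have "(1 - x + x\<^sup>2) * (1 + x + x\<^sup>2 / 2) = 1 + x\<^sup>2 / 2 + x ^ 3 / 2 + x ^ 4 / 2"
      by (simp add: field_simps power2_eq_square power3_eq_cube power4_eq_xxxx)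
    then show ?thesis using x by simp
  qed
  also have "\<dots> \<le> (1 - x + x\<^sup>2) * exp x"
    using exp_lower_Taylor_quadratic[OF x(1)] pos by (intro mult_left_mono) auto
  finally show ?thesis unfolding x_def by (simp add: exp_minus field_simps)
qed

text \<open>Here \<open>f0\<close> is the learner's prediction and the quadratic term is what the
  noise leaves behind after integration. With \<open>y0\<close> the contracted alignment, the
  product of prediction error and \<open>U\<close> splits into \<open>(F y0 - f0) * U\<close>, which
  has mean zero by symmetry whatever the mismatch, and \<open>(F (y0 + s * U) - F y0) * U\<close>,
  which is nonnegative by monotonicity and at least \<open>s * q * U\<^sup>2\<close> where
  \<open>U\<close> is positive. The fluctuation is of order \<open>p\<^sup>2 * U\<^sup>2\<close>, so
  a small \<open>p\<close> leaves half of the drift, and the dimension enters only through the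
  second moment of \<open>U\<close>.\<close>

lemma exp_moment_orth_dir:
  fixes F :: "real \<Rightarrow> real"
  assumes x: "x \<in> usphere d" "\<theta> \<in> usphere d" and d: "0 < d"
    and s: "0 \<le> s" "s \<le> 1"
    and [measurable]: "F \<in> borel_measurable borel"
    and F: "mono_on {-1..1} F" "\<And>y. y \<in> {-1..1} \<Longrightarrow> \<bar>F y\<bar> \<le> 1" and f0: "\<bar>f0\<bar> \<le> 1"
    and q: "0 \<le> q" "\<And>u. 0 \<le> u \<Longrightarrow> sqrt (1 - s\<^sup>2) * inner_d d x \<theta> + u \<le> 1 \<Longrightarrow>
        F (sqrt (1 - s\<^sup>2) * inner_d d x \<theta>) + q * u \<le> F (sqrt (1 - s\<^sup>2) * inner_d d x \<theta> + u)"
    and p: "0 \<le> p" "p \<le> 1 / 4" "24 * p \<le> s * q"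
  shows "(\<integral>\<^sup>+ g. ennreal (exp (- (p * (F (inner_d d x (play d s \<theta> g)) - f0) * inner_d d x (orth_dir d \<theta> g))
      + (p * inner_d d x (orth_dir d \<theta> g))\<^sup>2 / 2)) \<partial>std_gaussian d)
    \<le> ennreal (exp (- (p * s * q * (1 - (inner_d d x \<theta>)\<^sup>2) / (12 * real d))))"
proof -
  interpret G: prob_space "std_gaussian d" by (rule prob_space_std_gaussian)
  define y0 where "y0 = sqrt (1 - s\<^sup>2) * inner_d d x \<theta>"
  define U where "U g = inner_d d x (orth_dir d \<theta> g)" for g
  define D where "D g = F (inner_d d x (play d s \<theta> g)) - f0" for g
  define D0 where "D0 = F y0 - f0"
  have s2: "s\<^sup>2 \<le> 1" using s by (simp add: power_le_one)
  have play: "inner_d d x (play d s \<theta> g) = y0 + s * U g" for g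
    by (simp add: inner_d_play y0_def U_def)
  have play_le: "y0 + s * U g \<in> {-1..1}" for g
    using inner_d_play_le[OF x s, of g] by (auto simp: play)
  have "\<bar>y0\<bar> \<le> 1 * 1"
    unfolding y0_def abs_mult using s2 usphere_inner_le[OF x]
    by (intro mult_mono) auto
  then have y0: "y0 \<in> {-1..1}" by auto
  have [measurable]: "U \<in> borel_measurable borel" unfolding U_def by measurable
  have [measurable]: "D \<in> borel_measurable borel" unfolding D_def by measurable
  have U_le: "\<bar>U g\<bar> \<le> 1" for g unfolding U_def by (rule inner_d_orth_dir_le[OF x(1)])
  have U2_le: "(U g)\<^sup>2 \<le> 1" for g using U_le[of g] by (simp add: abs_square_le_1)
  have D_le: "\<bar>D g\<bar> \<le> 2" for g
    using F(2)[OF play_le[of g]] f0 unfolding D_def play by linarith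
  define E2 where "E2 = (\<integral>g. (U g)\<^sup>2 \<partial>std_gaussian d)"
  have intU: "integrable (std_gaussian d) U"
    using U_le by (intro G.integrable_const_bound[where B=1]) auto
  have intU2: "integrable (std_gaussian d) (\<lambda>g. (U g)\<^sup>2)"
    using U2_le by (intro G.integrable_const_bound[where B=1]) auto
  have intDU: "integrable (std_gaussian d) (\<lambda>g. D g * U g)"
  proof (intro G.integrable_const_bound[where B=2] AE_I2)
    fix g show "norm (D g * U g) \<le> 2"
      using mult_mono[OF D_le U_le, of g g] by (simp add: abs_mult)
  qed simp
  have EU: "(\<integral>g. U g \<partial>std_gaussian d) = 0"
    using integral_orth_dir_symmetric[of "\<lambda>u. u" d x \<theta>] by (simp add: U_def)
  \<comment> \<open>The half line on which the slope bound applies; by symmetry it carries half of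
    the second moment.\<close>
  define pos where "pos u = u\<^sup>2 * indicat_real {0<..} u" for u :: real
  have [measurable]: "pos \<in> borel_measurable borel" unfolding pos_def by measurable
  have int_pos: "integrable (std_gaussian d) (\<lambda>g. pos (U g))" "integrable (std_gaussian d) (\<lambda>g. pos (- U g))"
    using U2_le by (auto intro!: G.integrable_const_bound[where B=1] simp: pos_def indicator_def)
  have "E2 = (\<integral>g. pos (U g) + pos (- U g) \<partial>std_gaussian d)"
    unfolding E2_def by (intro Bochner_Integration.integral_cong) (auto simp: pos_def indicator_def)
  also have "\<dots> = (\<integral>g. pos (U g) \<partial>std_gaussian d) + (\<integral>g. pos (- U g) \<partial>std_gaussian d)"
    using int_pos by (rule Bochner_Integration.integral_add)
  also have "(\<integral>g. pos (- U g) \<partial>std_gaussian d) = (\<integral>g. pos (U g) \<partial>std_gaussian d)"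
    unfolding U_def by (rule integral_orth_dir_symmetric) simp
  finally have Epos: "(\<integral>g. pos (U g) \<partial>std_gaussian d) = E2 / 2" by simp
  have DU: "s * q * pos (U g) + D0 * U g \<le> D g * U g" for g
  proof -
    have "s * q * pos (U g) \<le> (D g - D0) * U g"
    proof (cases "0 < U g")
      case True
      have "F y0 + q * (s * U g) \<le> F (y0 + s * U g)"
        using True s play_le[of g] unfolding y0_def[symmetric]
        by (intro q(2)[folded y0_def]) auto
      then have "s * q * U g \<le> D g - D0" by (simp add: D_def D0_def play ac_simps)
      then have "s * q * U g * U g \<le> (D g - D0) * U g" using True by (intro mult_right_mono) auto
      then show ?thesis using True by (simp add: pos_def power2_eq_square ac_simps)
    next
      case False
      then have "F (y0 + s * U g) \<le> F y0"
        using s by (intro mono_onD[OF F(1)] play_le y0) (auto intro: mult_nonneg_nonpos)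
      then have "0 \<le> (D g - D0) * U g" using False
        by (intro mult_nonpos_nonpos) (auto simp: D_def D0_def play)
      then show ?thesis using False by (simp add: pos_def)
    qed
    then show ?thesis by (simp add: algebra_simps)
  qed
  have "s * q * (E2 / 2) = (\<integral>g. s * q * pos (U g) + D0 * U g \<partial>std_gaussian d)"
    using int_pos intU by (simp add: Epos EU)
  also have "\<dots> \<le> (\<integral>g. D g * U g \<partial>std_gaussian d)"
    using int_pos intU intDU DU by (intro integral_mono) auto
  finally have EDU: "s * q * (E2 / 2) \<le> (\<integral>g. D g * U g \<partial>std_gaussian d)" .
  have E2_0: "0 \<le> E2" unfolding E2_def by (intro integral_nonneg_AE) auto
  \<comment> \<open>The exponent is at most \<open>17 / 8 * \<bar>p * U g\<bar>\<close> in modulus,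
    so its square is at most \<open>5 * (p * U g)\<^sup>2\<close>; the sixth unit absorbs the noise
    term \<open>(p * U g)\<^sup>2 / 2\<close>.\<close>
  let ?R = "\<lambda>g. 1 - p * (D g * U g) + 6 * p\<^sup>2 * (U g)\<^sup>2"
  have exp_le: "exp (- (p * D g * U g) + (p * U g)\<^sup>2 / 2) \<le> ?R g" for g
  proof -
    let ?y = "- (p * D g * U g) + (p * U g)\<^sup>2 / 2"
    have y: "?y = (p * U g) * (- D g + p * U g / 2)" by (simp add: power2_eq_square algebra_simps)
    have pU: "\<bar>p * U g\<bar> \<le> 1 / 4 * 1" unfolding abs_mult using p U_le by (intro mult_mono) auto
    then have z: "\<bar>- D g + p * U g / 2\<bar> \<le> 17 / 8" using D_le[of g] by linarith
    have "\<bar>?y\<bar> \<le> 1 / 4 * (17 / 8)" unfolding y abs_mult using pU z by (intro mult_mono) auto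
    then have "exp ?y \<le> 1 + ?y + ?y\<^sup>2" by (intro exp_le_quadratic) simp
    moreover have "?y\<^sup>2 \<le> 5 * (p * U g)\<^sup>2"
    proof -
      have "?y\<^sup>2 = (p * U g)\<^sup>2 * (- D g + p * U g / 2)\<^sup>2"
        by (simp only: y power_mult_distrib[of "p * U g"])
      also have "\<dots> \<le> (p * U g)\<^sup>2 * (17 / 8)\<^sup>2"
        using z by (intro mult_left_mono) (auto simp: abs_le_square_iff[symmetric])
      also have "\<dots> \<le> (p * U g)\<^sup>2 * 5"
        by (intro mult_left_mono) (auto simp: power2_eq_square)
      finally show ?thesis by simp
    qed
    ultimately have "exp ?y \<le> 1 + ?y + 5 * (p * U g)\<^sup>2" by linarith
    also have "\<dots> \<le> ?R g" by (simp add: power_mult_distrib algebra_simps)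
    finally show ?thesis .
  qed
  have R0: "0 \<le> ?R g" for g using exp_le[of g] by (meson exp_ge_zero order_trans)
  have intR: "integrable (std_gaussian d) ?R" using intDU intU2 by simp
  have "(\<integral>\<^sup>+ g. ennreal (exp (- (p * D g * U g) + (p * U g)\<^sup>2 / 2)) \<partial>std_gaussian d)
      \<le> (\<integral>\<^sup>+ g. ennreal (?R g) \<partial>std_gaussian d)"
    using exp_le by (intro nn_integral_mono ennreal_leI) auto
  also have "\<dots> = ennreal (\<integral>g. ?R g \<partial>std_gaussian d)"
    using R0 intR by (intro nn_integral_eq_integral) auto
  also have "(\<integral>g. ?R g \<partial>std_gaussian d) = 1 - p * (\<integral>g. D g * U g \<partial>std_gaussian d) + 6 * p\<^sup>2 * E2"
    using intDU intU2 G.prob_space by (simp add: E2_def)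
  also have "\<dots> \<le> 1 - p * (s * q * (E2 / 2)) + p * (s * q / 4) * E2"
  proof -
    have "p * (s * q * (E2 / 2)) \<le> p * (\<integral>g. D g * U g \<partial>std_gaussian d)"
      using EDU p by (intro mult_left_mono) auto
    \<comment> \<open>The assumption \<open>24 * p \<le> s * q\<close>, multiplied by
      \<open>p / 4\<close>, makes the fluctuation at most half of the drift.\<close>
    moreover have "6 * p\<^sup>2 * E2 \<le> p * (s * q / 4) * E2"
      using mult_left_mono[OF p(3) p(1)] E2_0
      by (intro mult_right_mono) (auto simp: power2_eq_square algebra_simps)
    ultimately show ?thesis by linarith
  qed
  also have "\<dots> = 1 + (- (p * s * q * E2 / 4))" by (simp add: field_simps)
  also have "\<dots> \<le> exp (- (p * s * q * E2 / 4))" by (rule exp_ge_add_one_self)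
  also have "\<dots> \<le> exp (- (p * s * q * (1 - (inner_d d x \<theta>)\<^sup>2) / (12 * real d)))"
  proof -
    have "p * s * q / 4 * ((1 - (inner_d d x \<theta>)\<^sup>2) / (3 * real d)) \<le> p * s * q / 4 * E2"
      unfolding E2_def U_def
      using p s q second_moment_orth_dir[OF x d] by (intro mult_left_mono) auto
    then show ?thesis by simp
  qed
  finally show ?thesis unfolding D_def U_def by (simp add: ennreal_leI)
qed

section \<open>The interaction\<close>

context bandit_interaction
begin

lemma space_M: "space M = space (trajectory_space d)"
  using sets_M by (rule sets_eq_imp_space_eq)

lemma round_measurable: "(\<lambda>\<omega>. \<omega> t) \<in> M \<rightarrow>\<^sub>M round_space d"
  unfolding measurable_cong_sets[OF sets_M refl] trajectory_space_def by simp

lemma sphere_space_measurable: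
  "h \<in> N \<rightarrow>\<^sub>M sphere_space d \<Longrightarrow> h \<in> borel_measurable N"
  unfolding sphere_space_def by (rule measurable_restrict_space2_iff[THEN iffD1, THEN conjunct1])

lemma space_sphere_space: "space (sphere_space d) = usphere d"
  by (simp add: sphere_space_def space_restrict_space)

lemma iterate_sphere: "iterate t \<in> M \<rightarrow>\<^sub>M sphere_space d"
  using round_measurable[of t] unfolding iterate_def round_space_def by simp

lemma action_sphere: "action t \<in> M \<rightarrow>\<^sub>M sphere_space d"
  using round_measurable[of t] unfolding action_def round_space_def by simp

lemma noise_measurable [measurable]: "noise t \<in> borel_measurable M"
  using round_measurable[of t] unfolding noise_def round_space_def by simp

lemma iterate_measurable [measurable]: "iterate t \<in> borel_measurable M"
  by (rule sphere_space_measurable[OF iterate_sphere])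

lemma action_measurable [measurable]: "action t \<in> borel_measurable M"
  by (rule sphere_space_measurable[OF action_sphere])

lemma iterate_in: "\<omega> \<in> space M \<Longrightarrow> iterate t \<omega> \<in> usphere d"
  using measurable_space[OF iterate_sphere] by (simp add: space_sphere_space)

lemma action_in: "\<omega> \<in> space M \<Longrightarrow> action t \<omega> \<in> usphere d"
  using measurable_space[OF action_sphere] by (simp add: space_sphere_space)

lemma alignment_measurable [measurable]: "alignment d x t \<in> borel_measurable M"
  unfolding alignment_def by measurable

lemma restrict_measurable: "(\<lambda>\<omega>. restrict \<omega> J) \<in> M \<rightarrow>\<^sub>M Pi\<^sub>M J (\<lambda>_. round_space d)"
  unfolding measurable_cong_sets[OF sets_M refl] trajectory_space_def
  by (rule measurable_restrict_subset) simp

lemma space_past: "space (past d t) = space M" "space (past_and_action d t) = space M"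
  by (simp_all add: past_def past_and_action_def space_M)

lemma past_measurable:
  "(\<lambda>\<omega>. (restrict \<omega> {1..<t}, iterate t \<omega>)) \<in> past d t \<rightarrow>\<^sub>M Pi\<^sub>M {1..<t} (\<lambda>_. round_space d) \<Otimes>\<^sub>M sphere_space d"
proof -
  have "(\<lambda>\<omega>. (restrict \<omega> {1..<t}, iterate t \<omega>)) \<in> M \<rightarrow>\<^sub>M Pi\<^sub>M {1..<t} (\<lambda>_. round_space d) \<Otimes>\<^sub>M sphere_space d"
    by (intro measurable_Pair restrict_measurable iterate_sphere)
  then show ?thesis
    unfolding past_def space_M[symmetric]
    by (intro measurable_vimage_algebra1) (auto dest: measurable_space)
qed

lemma past_and_action_measurable:
  "(\<lambda>\<omega>. (restrict \<omega> {1..<t}, iterate t \<omega>, action t \<omega>)) \<in>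
    past_and_action d t \<rightarrow>\<^sub>M Pi\<^sub>M {1..<t} (\<lambda>_. round_space d) \<Otimes>\<^sub>M sphere_space d \<Otimes>\<^sub>M sphere_space d"
proof -
  have "(\<lambda>\<omega>. (restrict \<omega> {1..<t}, iterate t \<omega>, action t \<omega>)) \<in>
      M \<rightarrow>\<^sub>M Pi\<^sub>M {1..<t} (\<lambda>_. round_space d) \<Otimes>\<^sub>M sphere_space d \<Otimes>\<^sub>M sphere_space d"
    by (intro measurable_Pair restrict_measurable iterate_sphere action_sphere)
  then show ?thesis
    unfolding past_and_action_def space_M[symmetric]
    by (intro measurable_vimage_algebra1) (auto dest: measurable_space)
qed

lemma subalgebra_past: "subalgebra M (past d t)"
  unfolding subalgebra_def past_def space_M[symmetric]
  by (auto intro!: sets_image_in_sets measurable_Pair restrict_measurable iterate_sphere del: subsetI)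

lemma subalgebra_past_and_action: "subalgebra M (past_and_action d t)"
  unfolding subalgebra_def past_and_action_def space_M[symmetric]
  by (auto intro!: sets_image_in_sets measurable_Pair restrict_measurable iterate_sphere action_sphere
      del: subsetI)

lemma iterate_past [measurable]: "iterate t \<in> borel_measurable (past d t)"
  using sphere_space_measurable[OF measurable_compose[OF past_measurable measurable_snd]] by simp

lemma iterate_past_and_action [measurable]: "iterate t \<in> borel_measurable (past_and_action d t)"
  using sphere_space_measurable[OF measurable_compose[OF past_and_action_measurable
      measurable_compose[OF measurable_snd measurable_fst]]] by simp

lemma action_past_and_action [measurable]: "action t \<in> borel_measurable (past_and_action d t)"
  using sphere_space_measurable[OF measurable_compose[OF past_and_action_measurable
      measurable_compose[OF measurable_snd measurable_snd]]] by simp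

lemma round_past:
  assumes "1 \<le> j" "j < t"
  shows "(\<lambda>\<omega>. \<omega> j) \<in> past d t \<rightarrow>\<^sub>M round_space d"
proof -
  have "(\<lambda>x. x j) \<in> Pi\<^sub>M {1..<t} (\<lambda>_. round_space d) \<rightarrow>\<^sub>M round_space d"
    using assms by simp
  from measurable_compose[OF measurable_compose[OF past_measurable measurable_fst] this]
  show ?thesis using assms by simp
qed

lemma noise_past: "1 \<le> j \<Longrightarrow> j < t \<Longrightarrow> noise j \<in> borel_measurable (past d t)"
  using round_past[of j t] unfolding noise_def round_space_def by simp

lemma iterate_past_le: "1 \<le> j \<Longrightarrow> j \<le> t \<Longrightarrow> iterate j \<in> borel_measurable (past d t)"
proof (cases "j = t")
  case False
  assume "1 \<le> j" "j \<le> t"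
  with False have "(\<lambda>\<omega>. \<omega> j) \<in> past d t \<rightarrow>\<^sub>M round_space d" by (intro round_past) auto
  then show ?thesis unfolding iterate_def round_space_def
    by (intro sphere_space_measurable) simp
qed simp

lemma alignment_past_le: "1 \<le> j \<Longrightarrow> j \<le> t \<Longrightarrow> alignment d x j \<in> borel_measurable (past d t)"
  unfolding alignment_def using iterate_past_le by measurable

lemma past_sets_past_and_action: "sets (past d t) \<subseteq> sets (past_and_action d t)"
proof -
  have "(\<lambda>(x, y, z). (x, y)) \<in> Pi\<^sub>M {1..<t} (\<lambda>_. round_space d) \<Otimes>\<^sub>M sphere_space d \<Otimes>\<^sub>M sphere_space d
     \<rightarrow>\<^sub>M Pi\<^sub>M {1..<t} (\<lambda>_. round_space d) \<Otimes>\<^sub>M sphere_space d" by simp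
  from measurable_compose[OF past_and_action_measurable this]
  have "(\<lambda>\<omega>. (restrict \<omega> {1..<t}, iterate t \<omega>)) \<in> past_and_action d t \<rightarrow>\<^sub>M
      Pi\<^sub>M {1..<t} (\<lambda>_. round_space d) \<Otimes>\<^sub>M sphere_space d" by simp
  then show ?thesis
    unfolding past_def space_M[symmetric] by (intro sets_image_in_sets) (auto simp: space_past)
qed

lemma noise_mgf_const:
  assumes t: "1 \<le> t" and [measurable]: "Y \<in> borel_measurable (past_and_action d t)"
  shows "(\<integral>\<^sup>+\<omega>. Y \<omega> * ennreal (exp (l * noise t \<omega>)) \<partial>M) \<le> (\<integral>\<^sup>+\<omega>. Y \<omega> * ennreal (exp (l\<^sup>2 / 2)) \<partial>M)"
proof -
  interpret F: finite_measure_subalgebra M "past_and_action d t"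
    by standard (rule subalgebra_past_and_action)
  have "(\<integral>\<^sup>+\<omega>. Y \<omega> * ennreal (exp (l * noise t \<omega>)) \<partial>M) =
    (\<integral>\<^sup>+\<omega>. Y \<omega> * nn_cond_exp M (past_and_action d t) (\<lambda>\<omega>. ennreal (exp (l * noise t \<omega>))) \<omega> \<partial>M)"
    by (rule F.nn_cond_exp_intg[symmetric]) auto
  also have "\<dots> \<le> (\<integral>\<^sup>+\<omega>. Y \<omega> * ennreal (exp (l\<^sup>2 / 2)) \<partial>M)"
    using noise_subgaussian[OF t, of l]
    by (intro nn_integral_mono_AE, eventually_elim) (auto intro: mult_left_mono)
  finally show ?thesis .
qed

text \<open>The sub-Gaussian hypothesis concerns one fixed exponent at a time, with a null set that
  depends on it, while the update multiplies the noise by a quantity that is known only given the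
  past and the action. Rounding this quantity to a grid leaves finitely many values, each a fixed
  exponent on the event where it occurs; Fatou's lemma passes to the limit.\<close>

lemma noise_mgf:
  assumes t: "1 \<le> t" and Y [measurable]: "Y \<in> borel_measurable (past_and_action d t)"
    and l [measurable]: "l \<in> borel_measurable (past_and_action d t)"
    and bound: "\<And>\<omega>. \<omega> \<in> space M \<Longrightarrow> \<bar>l \<omega>\<bar> \<le> B"
  shows "(\<integral>\<^sup>+\<omega>. Y \<omega> * ennreal (exp (l \<omega> * noise t \<omega>)) \<partial>M) \<le>
    (\<integral>\<^sup>+\<omega>. Y \<omega> * ennreal (exp ((l \<omega>)\<^sup>2 / 2)) \<partial>M)" (is "_ \<le> ?I")
proof -
  let ?F = "past_and_action d t"
  have sub: "h \<in> borel_measurable M" if "h \<in> borel_measurable ?F" for h :: "_ \<Rightarrow> 'z::topological_space"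
    using measurable_from_subalg[OF subalgebra_past_and_action that] .
  have [measurable]: "Y \<in> borel_measurable M" "l \<in> borel_measurable M"
    using sub[OF Y] sub[OF l] by auto
  \<comment> \<open>Rounding towards zero never increases the modulus, so every bound on the grid is
    dominated by the one for \<open>l\<close> itself.\<close>
  define r where "r n x = sgn x * (of_int \<lfloor>real (Suc n) * \<bar>x\<bar>\<rfloor> / real (Suc n))" for n and x :: real
  have [measurable]: "r n \<in> borel_measurable borel" for n unfolding r_def by measurable
  have r_dist: "\<bar>r n x\<bar> \<le> \<bar>x\<bar>" "\<bar>r n x - x\<bar> \<le> 1 / real (Suc n)" for n x
  proof -
    let ?k = "of_int \<lfloor>real (Suc n) * \<bar>x\<bar>\<rfloor> :: real"
    have k: "?k \<le> real (Suc n) * \<bar>x\<bar>" "real (Suc n) * \<bar>x\<bar> \<le> ?k + 1" by linarith+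
    have k0: "0 \<le> ?k" by simp
    have div: "k / N \<le> y" "y - 1 / N \<le> k / N" if "k \<le> N * y" "N * y \<le> k + 1" "0 < N" for k N y :: real
    proof -
      show "k / N \<le> y" using that by (simp add: field_simps)
      have "y \<le> (k + 1) / N" using that by (simp add: field_simps)
      then show "y - 1 / N \<le> k / N" by (simp add: add_divide_distrib)
    qed
    have a: "?k / real (Suc n) \<le> \<bar>x\<bar>" "\<bar>x\<bar> - 1 / real (Suc n) \<le> ?k / real (Suc n)"
      by (rule div[OF k], simp)+
    have b: "0 \<le> ?k / real (Suc n)" using k0 by simp
    have sgn: "\<bar>sgn x * y\<bar> \<le> \<bar>x\<bar>" "\<bar>sgn x * y - x\<bar> \<le> e" if "0 \<le> y" "y \<le> \<bar>x\<bar>" "\<bar>x\<bar> - e \<le> y" for y e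
      using that by (auto simp: sgn_if abs_if split: if_splits)
    show "\<bar>r n x\<bar> \<le> \<bar>x\<bar>" "\<bar>r n x - x\<bar> \<le> 1 / real (Suc n)"
      unfolding r_def by (rule sgn[OF b a])+
  qed
  have le: "(\<integral>\<^sup>+\<omega>. Y \<omega> * ennreal (exp (r n (l \<omega>) * noise t \<omega>)) \<partial>M) \<le> ?I" for n
  proof -
    define V where "V = (\<lambda>\<omega>. r n (l \<omega>)) ` space M"
    have "V \<subseteq> (\<lambda>(j, k). j * (of_int k / real (Suc n))) ` ({-1, 0, 1} \<times> {0..\<lfloor>real (Suc n) * B\<rfloor>})"
    proof
      fix v assume "v \<in> V"
      then obtain \<omega> where w: "\<omega> \<in> space M" "v = r n (l \<omega>)" by (auto simp: V_def)
      have "\<lfloor>real (Suc n) * \<bar>l \<omega>\<bar>\<rfloor> \<in> {0..\<lfloor>real (Suc n) * B\<rfloor>}"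
        using bound[OF w(1)] by (auto intro!: floor_mono mult_left_mono)
      moreover have "sgn (l \<omega>) \<in> {-1, 0, 1}" by (auto simp: sgn_if)
      ultimately show "v \<in> (\<lambda>(j, k). j * (of_int k / real (Suc n))) ` ({-1, 0, 1} \<times> {0..\<lfloor>real (Suc n) * B\<rfloor>})"
        unfolding w(2) r_def
        by (intro image_eqI[where x="(sgn (l \<omega>), \<lfloor>real (Suc n) * \<bar>l \<omega>\<bar>\<rfloor>)"]) auto
    qed
    then have fin: "finite V" by (rule finite_subset) auto
    define W where "W v \<omega> = Y \<omega> * indicator {\<omega> \<in> space M. r n (l \<omega>) = v} \<omega>" for v \<omega>
    have "{\<omega> \<in> space ?F. r n (l \<omega>) = v} \<in> sets ?F" for v by measurable
    then have W [measurable]: "W v \<in> borel_measurable ?F" for v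
      unfolding W_def by (simp add: space_past)
    have [measurable]: "W v \<in> borel_measurable M" for v by (rule sub[OF W])
    have split: "(\<Sum>v\<in>V. W v \<omega> * h v) = Y \<omega> * h (r n (l \<omega>))" if "\<omega> \<in> space M" for \<omega> and h :: "real \<Rightarrow> ennreal"
    proof -
      have "(\<Sum>v\<in>V. W v \<omega> * h v) = (\<Sum>v\<in>V. if v = r n (l \<omega>) then Y \<omega> * h (r n (l \<omega>)) else 0)"
        using that by (intro sum.cong) (auto simp: W_def indicator_def)
      also have "\<dots> = Y \<omega> * h (r n (l \<omega>))" using fin that by (simp add: V_def)
      finally show ?thesis .
    qed
    have "(\<integral>\<^sup>+\<omega>. Y \<omega> * ennreal (exp (r n (l \<omega>) * noise t \<omega>)) \<partial>M) =
      (\<integral>\<^sup>+\<omega>. (\<Sum>v\<in>V. W v \<omega> * ennreal (exp (v * noise t \<omega>))) \<partial>M)"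
      using split[of _ "\<lambda>v. ennreal (exp (v * noise t _))"] by (intro nn_integral_cong) simp
    also have "\<dots> = (\<Sum>v\<in>V. \<integral>\<^sup>+\<omega>. W v \<omega> * ennreal (exp (v * noise t \<omega>)) \<partial>M)"
      by (intro nn_integral_sum) auto
    also have "\<dots> \<le> (\<Sum>v\<in>V. \<integral>\<^sup>+\<omega>. W v \<omega> * ennreal (exp (v\<^sup>2 / 2)) \<partial>M)"
      by (intro sum_mono noise_mgf_const t W)
    also have "\<dots> = (\<integral>\<^sup>+\<omega>. (\<Sum>v\<in>V. W v \<omega> * ennreal (exp (v\<^sup>2 / 2))) \<partial>M)"
      by (intro nn_integral_sum[symmetric]) auto
    also have "\<dots> = (\<integral>\<^sup>+\<omega>. Y \<omega> * ennreal (exp ((r n (l \<omega>))\<^sup>2 / 2)) \<partial>M)"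
      using split[of _ "\<lambda>v. ennreal (exp (v\<^sup>2 / 2))"] by (intro nn_integral_cong) simp
    also have "\<dots> \<le> ?I"
      using r_dist(1) by (intro nn_integral_mono mult_left_mono ennreal_leI) (auto simp: abs_le_square_iff)
    finally show ?thesis .
  qed
  have lim: "(\<lambda>n. r n x) \<longlonglongrightarrow> x" for x
  proof (rule LIMSEQ_I)
    fix e :: real assume "0 < e"
    then obtain n0 where n0: "1 / real (Suc n0) < e" using nat_approx_posE by blast
    show "\<exists>n0. \<forall>n\<ge>n0. norm (r n x - x) < e"
    proof (intro exI allI impI)
      fix n assume "n0 \<le> n"
      then have "1 / real (Suc n) \<le> 1 / real (Suc n0)" by (simp add: frac_le)
      then show "norm (r n x - x) < e" using r_dist(2)[of n x] n0 by simp
    qed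
  qed
  have "(\<integral>\<^sup>+\<omega>. Y \<omega> * ennreal (exp (l \<omega> * noise t \<omega>)) \<partial>M) =
    (\<integral>\<^sup>+\<omega>. liminf (\<lambda>n. Y \<omega> * ennreal (exp (r n (l \<omega>) * noise t \<omega>))) \<partial>M)"
  proof (intro nn_integral_cong)
    fix \<omega>
    have "(\<lambda>n. ennreal (exp (r n (l \<omega>) * noise t \<omega>))) \<longlonglongrightarrow> ennreal (exp (l \<omega> * noise t \<omega>))"
      by (intro tendsto_ennrealI tendsto_exp tendsto_mult lim tendsto_const)
    then have "(\<lambda>n. Y \<omega> * ennreal (exp (r n (l \<omega>) * noise t \<omega>))) \<longlonglongrightarrow> Y \<omega> * ennreal (exp (l \<omega> * noise t \<omega>))"
      by (intro tendsto_mult_ennreal tendsto_const) auto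
    then show "Y \<omega> * ennreal (exp (l \<omega> * noise t \<omega>)) =
        liminf (\<lambda>n. Y \<omega> * ennreal (exp (r n (l \<omega>) * noise t \<omega>)))"
      by (intro lim_imp_Liminf[symmetric]) auto
  qed
  also have "\<dots> \<le> liminf (\<lambda>n. \<integral>\<^sup>+\<omega>. Y \<omega> * ennreal (exp (r n (l \<omega>) * noise t \<omega>)) \<partial>M)"
    by (intro nn_integral_liminf) auto
  also have "\<dots> \<le> ?I" using le by (intro Liminf_le) auto
  finally show ?thesis .
qed

text \<open>Chernoff bound with exponent \<open>K\<close> for the noise and for its negative;
  \<open>j\<close> is the sign.\<close>

lemma noise_tail:
  assumes t: "1 \<le> t" and K: "0 \<le> K"
  shows "prob {\<omega> \<in> space M. K < \<bar>noise t \<omega>\<bar>} \<le> 2 * exp (- K\<^sup>2 / 2)"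
proof -
  have one: "prob {\<omega> \<in> space M. K < j * noise t \<omega>} \<le> exp (- K\<^sup>2 / 2)" if j: "j\<^sup>2 = 1" for j
  proof -
    have "emeasure M {\<omega> \<in> space M. K < j * noise t \<omega>} = (\<integral>\<^sup>+\<omega>. indicator {\<omega> \<in> space M. K < j * noise t \<omega>} \<omega> \<partial>M)"
      by (rule nn_integral_indicator[symmetric]) measurable
    also have "\<dots> \<le> (\<integral>\<^sup>+\<omega>. ennreal (exp (- K\<^sup>2)) * ennreal (exp (K * j * noise t \<omega>)) \<partial>M)"
    proof (intro nn_integral_mono)
      fix \<omega>
      have "K * K \<le> K * (j * noise t \<omega>)" if "K < j * noise t \<omega>"
        using that K by (intro mult_left_mono) auto
      then have "1 \<le> exp (- K\<^sup>2) * exp (K * j * noise t \<omega>)" if "K < j * noise t \<omega>"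
        unfolding exp_add[symmetric] using that by (simp add: power2_eq_square ac_simps)
      then show "indicator {\<omega> \<in> space M. K < j * noise t \<omega>} \<omega> \<le>
          ennreal (exp (- K\<^sup>2)) * ennreal (exp (K * j * noise t \<omega>))"
        by (auto simp: indicator_def ennreal_mult[symmetric] ennreal_1[symmetric] simp del: ennreal_1 intro!: ennreal_leI)
    qed
    also have "\<dots> \<le> (\<integral>\<^sup>+\<omega>. ennreal (exp (- K\<^sup>2)) * ennreal (exp ((K * j)\<^sup>2 / 2)) \<partial>M)"
      by (rule noise_mgf_const[OF t]) simp
    also have "\<dots> = ennreal (exp (- K\<^sup>2 / 2))"
      using j by (simp add: emeasure_space_1 ennreal_mult[symmetric] exp_add[symmetric] power_mult_distrib)
    finally show ?thesis by (simp add: emeasure_eq_measure)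
  qed
  have "{\<omega> \<in> space M. K < \<bar>noise t \<omega>\<bar>} = {\<omega> \<in> space M. K < 1 * noise t \<omega>} \<union> {\<omega> \<in> space M. K < (-1) * noise t \<omega>}"
    by auto
  also have "prob \<dots> \<le> prob {\<omega> \<in> space M. K < 1 * noise t \<omega>} + prob {\<omega> \<in> space M. K < (-1) * noise t \<omega>}"
    by (intro measure_Un_le) auto
  also have "\<dots> \<le> 2 * exp (- K\<^sup>2 / 2)"
    using one[of 1] one[of "-1"] by (simp only: power2_minus) simp
  finally show ?thesis .
qed

end

lemma usphere_sets [measurable]: "usphere d \<in> sets borel"
proof -
  have "usphere d = {x. (\<forall>i\<in>{d..}. x i = 0) \<and> inner_d d x x = 1}"
    by (auto simp: usphere_def L2_set_inner_d)
  also have "\<dots> \<in> sets borel"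
  proof -
    have [measurable]: "(\<lambda>x::rvec. x i) \<in> borel_measurable borel" for i
      by (simp add: measurable_product_then_coordinatewise)
    show ?thesis by measurable
  qed
  finally show ?thesis .
qed

lemma prob_space_action_law: "prob_space (action_law d s \<theta>)"
  unfolding action_law_eq by (intro prob_space.prob_space_distr prob_space_std_gaussian) measurable

text \<open>In the update, \<open>\<bar>w\<bar> * S\<close> is the length of the tangential
  increment. Since \<open>(1 - x / 2) * sqrt (1 + x) \<le> 1\<close>, normalization multiplies a
  nonnegative numerator by at least \<open>1 - x0\<^sup>2 / 2\<close>. If \<open>x0 \<le> m\<close>,
  the numerator lies between 0 and \<open>2 * m\<close>, so the loss is proportional to
  \<open>m\<close>; this factor is what permits longer steps at small alignment.\<close>

lemma sgd_alignment_lower: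
  fixes m w U x0 S :: real
  assumes m: "0 \<le> m" "m \<le> 1" and w: "\<bar>w\<bar> * S \<le> x0" "\<bar>U\<bar> \<le> S" and x0: "x0 \<le> 1"
  defines "m' \<equiv> (m + w * U) / sqrt (1 + w\<^sup>2 * S\<^sup>2)"
  shows "m - 2 * x0 \<le> m'" and "x0 \<le> m \<Longrightarrow> m + w * U - m * x0\<^sup>2 \<le> m'"
proof -
  have S: "0 \<le> S" using w(2) by linarith
  have x00: "0 \<le> x0" using w(1) S by (meson abs_ge_zero mult_nonneg_nonneg order_trans)
  define x where "x = w\<^sup>2 * S\<^sup>2"
  have x: "0 \<le> x" "x \<le> x0\<^sup>2"
  proof -
    have "(\<bar>w\<bar> * S)\<^sup>2 \<le> x0\<^sup>2" using w S by (intro power_mono) auto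
    then show "x \<le> x0\<^sup>2" by (simp add: x_def power_mult_distrib)
  qed (simp add: x_def)
  have wU: "\<bar>w * U\<bar> \<le> x0"
    using mult_left_mono[OF w(2), of "\<bar>w\<bar>"] w(1) by (simp add: abs_mult)
  have r: "1 \<le> sqrt (1 + x)" "sqrt (1 + x) \<le> 1 + x / 2"
  proof -
    show "1 \<le> sqrt (1 + x)" using x by simp
    have "1 + x \<le> (1 + x / 2)\<^sup>2" by (simp add: power2_eq_square field_simps)
    then show "sqrt (1 + x) \<le> 1 + x / 2" using x by (intro real_le_lsqrt) auto
  qed
  let ?y = "m + w * U"
  have lower: "?y - ?y * x / 2 \<le> m'" if "0 \<le> ?y"
  proof -
    have "(1 - x / 2) * sqrt (1 + x) \<le> 1"
    proof (cases "x \<le> 2")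
      case True
      then have "(1 - x / 2) * sqrt (1 + x) \<le> (1 - x / 2) * (1 + x / 2)"
        using r by (intro mult_left_mono) auto
      also have "\<dots> \<le> 1" by (simp add: algebra_simps)
      finally show ?thesis .
    next
      case False
      then have "(1 - x / 2) * sqrt (1 + x) \<le> 0" using r by (intro mult_nonpos_nonneg) auto
      then show ?thesis by simp
    qed
    then have "?y * ((1 - x / 2) * sqrt (1 + x)) \<le> ?y * 1" using that by (intro mult_left_mono) auto
    then have "?y * (1 - x / 2) \<le> ?y / sqrt (1 + x)" using r by (simp add: field_simps)
    then show ?thesis by (simp add: m'_def x_def algebra_simps)
  qed
  have x02: "x0\<^sup>2 \<le> x0" using x0 x00 by (simp add: power2_eq_square mult_left_le)
  show "m - 2 * x0 \<le> m'"
  proof (cases "0 \<le> ?y")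
    case True
    have "?y * x \<le> 2 * x0\<^sup>2" using True wU m x0 x by (intro mult_mono) auto
    then show ?thesis using lower[OF True] wU x02 by linarith
  next
    case False
    have "?y * sqrt (1 + x) \<le> ?y" using False r mult_left_mono_neg[of 1 "sqrt (1 + x)" ?y] by simp
    then have "?y \<le> ?y / sqrt (1 + x)" using r by (simp add: field_simps)
    then have "?y \<le> m'" by (simp add: m'_def x_def)
    then show ?thesis using wU by linarith
  qed
  assume "x0 \<le> m"
  then have y: "0 \<le> ?y" "?y \<le> 2 * m" using wU by linarith+
  then have "?y * x \<le> (2 * m) * x0\<^sup>2" using x m by (intro mult_mono) auto
  then show "?y - m * x0\<^sup>2 \<le> m'" using lower[OF y(1)] by linarith
qed

section \<open>The joint law of iterate and action\<close>

context interactive_sgd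
begin

text \<open>
  The locale assumption on the actions, taken at the whole sphere, already shows that the projected
  Gaussian vanishes with probability \<open>0\<close>.
\<close>

lemma action_law_usphere:
  assumes s: "1 \<le> s"
  shows "AE \<omega> in M. measure (action_law d (\<sigma> s) (iterate (n0 + s) \<omega>)) (usphere d) = 1"
proof -
  interpret F: finite_measure_subalgebra M "past d (n0 + s)"
    by standard (rule subalgebra_past)
  have u: "usphere d \<in> sets (sphere_space d)"
    by (simp add: sphere_space_def sets_restrict_space_iff)
  have "AE \<omega> in M. real_cond_exp M (past d (n0 + s)) (\<lambda>\<omega>. indicat_real (usphere d) (action (n0 + s) \<omega>)) \<omega> =
      real_cond_exp M (past d (n0 + s)) (\<lambda>\<omega>. 1) \<omega>"
    by (rule F.real_cond_exp_cong) (auto simp: action_in)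
  moreover have "AE \<omega> in M. real_cond_exp M (past d (n0 + s)) (\<lambda>\<omega>. 1) \<omega> = 1"
    by (rule F.real_cond_exp_F_meas) auto
  ultimately show ?thesis using action_distribution[OF s u] by eventually_elim simp
qed

text \<open>The locale assumption covers events inside the sphere. For a general Borel set the part
  off the sphere is null both for the action and, by \<open>action_law_usphere\<close>, for its
  conditional law; testing the conditional expectation against \<open>C\<close> gives the
  identity.\<close>

lemma joint_law_rect:
  assumes s: "1 \<le> s" and C: "C \<in> sets (past d (n0 + s))" and B [measurable]: "B \<in> sets borel"
  shows "emeasure M {\<omega> \<in> C. action (n0 + s) \<omega> \<in> B} =
    (\<integral>\<^sup>+\<omega>. indicator C \<omega> * emeasure (action_law d (\<sigma> s) (iterate (n0 + s) \<omega>)) B \<partial>M)"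
proof -
  interpret F: finite_measure_subalgebra M "past d (n0 + s)"
    by standard (rule subalgebra_past)
  have CM [measurable]: "C \<in> sets M" using C subalgebra_past[of "n0 + s"] by (auto simp: subalgebra_def)
  define B' where "B' = B \<inter> usphere d"
  have B' [measurable]: "B' \<in> sets borel" unfolding B'_def by measurable
  have B's: "B' \<in> sets (sphere_space d)"
    by (auto simp: sphere_space_def sets_restrict_space_iff B'_def)
  let ?g = "\<lambda>\<omega>. indicat_real B' (action (n0 + s) \<omega>)"
  let ?r = "real_cond_exp M (past d (n0 + s)) ?g"
  have int: "integrable M (\<lambda>\<omega>. indicat_real C \<omega> * ?g \<omega>)"
    by (intro integrable_const_bound[where B=1]) (auto simp: indicator_def)
  have R: "integrable M (\<lambda>\<omega>. indicat_real C \<omega> * ?r \<omega>)"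
     "(\<integral>\<omega>. indicat_real C \<omega> * ?r \<omega> \<partial>M) = (\<integral>\<omega>. indicat_real C \<omega> * ?g \<omega> \<partial>M)"
    using C by (intro F.real_cond_exp_intg[OF int]; simp)+
  have AE: "AE \<omega> in M. ?r \<omega> = measure (action_law d (\<sigma> s) (iterate (n0 + s) \<omega>)) B"
    using action_distribution[OF s B's] action_law_usphere[OF s]
  proof eventually_elim
    case (elim \<omega>)
    interpret A: prob_space "action_law d (\<sigma> s) (iterate (n0 + s) \<omega>)" by (rule prob_space_action_law)
    have sA: "sets (action_law d (\<sigma> s) (iterate (n0 + s) \<omega>)) = sets borel" by (simp add: action_law_eq)
    have "AE a in action_law d (\<sigma> s) (iterate (n0 + s) \<omega>). a \<in> usphere d"
      using elim(2) by (rule A.AE_prob_1)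
    then have "A.prob B' = A.prob B"
      by (intro A.finite_measure_eq_AE) (auto simp: B'_def sA)
    then show ?case using elim by simp
  qed
  have "emeasure M {\<omega> \<in> C. action (n0 + s) \<omega> \<in> B} = ennreal (\<integral>\<omega>. indicat_real C \<omega> * ?g \<omega> \<partial>M)"
  proof -
    have "{\<omega> \<in> C. action (n0 + s) \<omega> \<in> B} = C \<inter> {\<omega> \<in> space M. action (n0 + s) \<omega> \<in> B}"
      using sets.sets_into_space[OF CM] by auto
    then have [measurable]: "{\<omega> \<in> C. action (n0 + s) \<omega> \<in> B} \<in> sets M" by simp
    have "(\<integral>\<omega>. indicat_real C \<omega> * ?g \<omega> \<partial>M) = (\<integral>\<omega>. indicat_real {\<omega> \<in> C. action (n0 + s) \<omega> \<in> B} \<omega> \<partial>M)"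
      by (intro Bochner_Integration.integral_cong) (auto simp: indicator_def B'_def action_in)
    also have "\<dots> = prob {\<omega> \<in> C. action (n0 + s) \<omega> \<in> B}" by simp
    finally show ?thesis by (simp add: emeasure_eq_measure)
  qed
  also have "\<dots> = ennreal (\<integral>\<omega>. indicat_real C \<omega> * ?r \<omega> \<partial>M)" by (simp add: R(2))
  also have "\<dots> = (\<integral>\<^sup>+\<omega>. ennreal (indicat_real C \<omega> * ?r \<omega>) \<partial>M)"
    using AE by (intro nn_integral_eq_integral[symmetric] R(1)) (auto elim!: eventually_mono)
  also have "\<dots> = (\<integral>\<^sup>+\<omega>. indicator C \<omega> * emeasure (action_law d (\<sigma> s) (iterate (n0 + s) \<omega>)) B \<partial>M)"
    using AE
  proof (intro nn_integral_cong_AE, eventually_elim)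
    case (elim \<omega>)
    interpret A: prob_space "action_law d (\<sigma> s) (iterate (n0 + s) \<omega>)" by (rule prob_space_action_law)
    show ?case unfolding elim by (auto simp: indicator_def A.emeasure_eq_measure)
  qed
  finally show ?thesis .
qed

text \<open>The conditional law is prescribed event by event, each with its own null set. To
  integrate functions of the pair, two finite measures on pairs are compared, the true one and the
  one built from an independent Gaussian sample; they agree on rectangles, an intersection-stable
  generator.\<close>

lemma joint_law:
  assumes s: "1 \<le> s" and E: "E \<in> sets (past d (n0 + s))"
    and psi [measurable]: "\<psi> \<in> borel_measurable (borel \<Otimes>\<^sub>M borel)"
  shows "(\<integral>\<^sup>+\<omega>. indicator E \<omega> * \<psi> (iterate (n0 + s) \<omega>, action (n0 + s) \<omega>) \<partial>M) =
    (\<integral>\<^sup>+\<omega>. indicator E \<omega> * (\<integral>\<^sup>+g. \<psi> (iterate (n0 + s) \<omega>, play d (\<sigma> s) (iterate (n0 + s) \<omega>) g)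
       \<partial>std_gaussian d) \<partial>M)"
proof -
  let ?t = "n0 + s"
  interpret G: prob_space "std_gaussian d" by (rule prob_space_std_gaussian)
  have EM [measurable]: "E \<in> sets M" using E subalgebra_past[of ?t] by (auto simp: subalgebra_def)
  \<comment> \<open>The past event is built into the base measure, so that one comparison of
    measures covers the restricted integrals.\<close>
  define N where "N = density M (indicator E)"
  have sN [simp, measurable_cong]: "sets N = sets M" by (simp add: N_def)
  have spN [simp]: "space N = space M" by (simp add: N_def)
  define act where "act = (\<lambda>\<omega>. (iterate ?t \<omega>, action ?t \<omega>))"
  define syn where "syn = (\<lambda>(\<omega>, g). (iterate ?t \<omega>, play d (\<sigma> s) (iterate ?t \<omega>) g))"
  have act [measurable]: "act \<in> N \<rightarrow>\<^sub>M borel \<Otimes>\<^sub>M borel" unfolding act_def by measurable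
  have syn [measurable]: "syn \<in> N \<Otimes>\<^sub>M std_gaussian d \<rightarrow>\<^sub>M borel \<Otimes>\<^sub>M borel" unfolding syn_def by measurable
  define m1 where "m1 = distr N (borel \<Otimes>\<^sub>M borel) act"
  define m2 where "m2 = distr (N \<Otimes>\<^sub>M std_gaussian d) (borel \<Otimes>\<^sub>M borel) syn"
  have int1: "integral\<^sup>N m1 h = (\<integral>\<^sup>+\<omega>. indicator E \<omega> * h (act \<omega>) \<partial>M)"
    if [measurable]: "h \<in> borel_measurable (borel \<Otimes>\<^sub>M borel)" for h
    unfolding m1_def by (subst nn_integral_distr) (auto simp: N_def nn_integral_density)
  have int2: "integral\<^sup>N m2 h = (\<integral>\<^sup>+\<omega>. indicator E \<omega> * (\<integral>\<^sup>+g. h (syn (\<omega>, g)) \<partial>std_gaussian d) \<partial>M)"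
    if [measurable]: "h \<in> borel_measurable (borel \<Otimes>\<^sub>M borel)" for h
  proof -
    have "integral\<^sup>N m2 h = (\<integral>\<^sup>+\<omega>. (\<integral>\<^sup>+g. h (syn (\<omega>, g)) \<partial>std_gaussian d) \<partial>N)"
    proof -
      have "integral\<^sup>N m2 h = (\<integral>\<^sup>+x. h (syn x) \<partial>(N \<Otimes>\<^sub>M std_gaussian d))"
        unfolding m2_def by (rule nn_integral_distr) simp_all
      also have "\<dots> = (\<integral>\<^sup>+\<omega>. (\<integral>\<^sup>+g. h (syn (\<omega>, g)) \<partial>std_gaussian d) \<partial>N)"
        by (rule G.nn_integral_fst[symmetric]) measurable
      finally show ?thesis .
    qed
    also have "\<dots> = (\<integral>\<^sup>+\<omega>. indicator E \<omega> * (\<integral>\<^sup>+g. h (syn (\<omega>, g)) \<partial>std_gaussian d) \<partial>M)"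
    proof -
      have "(\<lambda>x. h (syn x)) \<in> borel_measurable (M \<Otimes>\<^sub>M std_gaussian d)"
        unfolding syn_def by measurable
      then have "(\<lambda>\<omega>. \<integral>\<^sup>+g. h (syn (\<omega>, g)) \<partial>std_gaussian d) \<in> borel_measurable M"
        by (intro G.borel_measurable_nn_integral) auto
      then show ?thesis unfolding N_def by (subst nn_integral_density) auto
    qed
    finally show ?thesis .
  qed
  have "m1 = m2"
  proof (rule measure_eqI_generator_eq[OF Int_stable_pair_measure_generator pair_measure_closed])
    fix X assume "X \<in> {a \<times> b |a b. a \<in> sets (borel :: rvec measure) \<and> b \<in> sets (borel :: rvec measure)}"
    then obtain A B where X: "X = A \<times> B" and [measurable]: "A \<in> sets (borel :: rvec measure)" "B \<in> sets (borel :: rvec measure)"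
      by auto
    have XM [measurable]: "X \<in> sets (borel \<Otimes>\<^sub>M borel)" unfolding X by measurable
    \<comment> \<open>The side \<open>A\<close> constrains only the iterate, which belongs to the
      past, so it merges with \<open>E\<close> into one past event.\<close>
    define C where "C = E \<inter> {\<omega> \<in> space (past d ?t). iterate ?t \<omega> \<in> A}"
    have C: "C \<in> sets (past d ?t)" unfolding C_def using E by measurable
    have "emeasure m1 X = integral\<^sup>N m1 (indicator X)" by (simp add: m1_def)
    also have "\<dots> = (\<integral>\<^sup>+\<omega>. indicator {\<omega> \<in> C. action ?t \<omega> \<in> B} \<omega> \<partial>M)"
      by (subst int1, measurable, intro nn_integral_cong)
        (auto simp: X act_def C_def indicator_def space_past)
    also have "\<dots> = emeasure M {\<omega> \<in> C. action ?t \<omega> \<in> B}"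
    proof (rule nn_integral_indicator)
      have "C \<in> sets M" using C subalgebra_past[of ?t] by (auto simp: subalgebra_def)
      moreover have "{\<omega> \<in> C. action ?t \<omega> \<in> B} = C \<inter> {\<omega> \<in> space M. action ?t \<omega> \<in> B}"
        by (auto simp: C_def space_past)
      ultimately show "{\<omega> \<in> C. action ?t \<omega> \<in> B} \<in> sets M" by simp
    qed
    also have "\<dots> = (\<integral>\<^sup>+\<omega>. indicator C \<omega> * emeasure (action_law d (\<sigma> s) (iterate ?t \<omega>)) B \<partial>M)"
      by (rule joint_law_rect[OF s C]) simp
    also have "\<dots> = integral\<^sup>N m2 (indicator X)"
    proof (subst int2, measurable, intro nn_integral_cong)
      fix \<omega> assume w: "\<omega> \<in> space M"
      let ?K = "play d (\<sigma> s) (iterate ?t \<omega>)"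
      have [measurable]: "?K \<in> borel_measurable borel" by measurable
      have "emeasure (action_law d (\<sigma> s) (iterate ?t \<omega>)) B = (\<integral>\<^sup>+g. indicator B (?K g) \<partial>std_gaussian d)"
      proof -
        have "emeasure (action_law d (\<sigma> s) (iterate ?t \<omega>)) B = integral\<^sup>N (distr (std_gaussian d) borel ?K) (indicator B)"
          unfolding action_law_eq by (rule nn_integral_indicator[symmetric]) simp
        also have "\<dots> = (\<integral>\<^sup>+g. indicator B (?K g) \<partial>std_gaussian d)"
        proof (rule nn_integral_distr)
          show "?K \<in> std_gaussian d \<rightarrow>\<^sub>M borel" by measurable
        qed simp
        finally show ?thesis .
      qed
      moreover have "(\<integral>\<^sup>+g. indicator X (syn (\<omega>, g)) \<partial>std_gaussian d) =
          (\<integral>\<^sup>+g. indicator A (iterate ?t \<omega>) * indicator B (?K g) \<partial>std_gaussian d)"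
        by (intro nn_integral_cong) (auto simp: X syn_def indicator_def)
      moreover have "\<dots> = indicator A (iterate ?t \<omega>) * (\<integral>\<^sup>+g. indicator B (?K g) \<partial>std_gaussian d)"
        by (intro nn_integral_cmult) measurable
      ultimately show "indicator C \<omega> * emeasure (action_law d (\<sigma> s) (iterate ?t \<omega>)) B =
          indicator E \<omega> * (\<integral>\<^sup>+g. indicator X (syn (\<omega>, g)) \<partial>std_gaussian d)"
        using w by (auto simp: C_def indicator_def space_past)
    qed
    also have "\<dots> = emeasure m2 X" by (simp add: m2_def)
    finally show "emeasure m1 X = emeasure m2 X" .
  next
    show "sets m1 = sigma_sets (space (borel :: rvec measure) \<times> space (borel :: rvec measure)) {a \<times> b |a b. a \<in> sets (borel :: rvec measure) \<and> b \<in> sets (borel :: rvec measure)}"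
      "sets m2 = sigma_sets (space (borel :: rvec measure) \<times> space (borel :: rvec measure)) {a \<times> b |a b. a \<in> sets (borel :: rvec measure) \<and> b \<in> sets (borel :: rvec measure)}"
      by (simp_all add: m1_def m2_def sets_pair_measure)
    show "range (\<lambda>_::nat. UNIV) \<subseteq> {a \<times> b |a b. a \<in> sets (borel :: rvec measure) \<and> b \<in> sets (borel :: rvec measure)}"
      by (auto intro!: exI[of _ UNIV])
    show "(\<Union>i::nat. UNIV) = space (borel :: rvec measure) \<times> space (borel :: rvec measure)" by simp
    fix i :: nat
    have "emeasure m1 UNIV = integral\<^sup>N m1 (indicator UNIV)"
      by (subst nn_integral_indicator) (auto simp: m1_def space_pair_measure[symmetric] sets.top
          intro: sets.top[of "borel \<Otimes>\<^sub>M borel", simplified space_pair_measure space_borel UNIV_Times_UNIV])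
    also have "\<dots> = (\<integral>\<^sup>+\<omega>. indicator E \<omega> * indicator UNIV (act \<omega>) \<partial>M)" by (rule int1) simp
    also have "\<dots> \<le> (\<integral>\<^sup>+\<omega>. 1 \<partial>M)" by (intro nn_integral_mono) (simp add: indicator_def)
    also have "\<dots> < \<infinity>" by (simp add: emeasure_space_1)
    finally show "emeasure m1 UNIV \<noteq> \<infinity>" by simp
  qed
  then have "integral\<^sup>N m1 \<psi> = integral\<^sup>N m2 \<psi>" by simp
  then show ?thesis by (simp add: int1[OF psi] int2[OF psi] act_def syn_def)
qed

end

text \<open>Nothing is known about \<open>f\<close> outside \<open>{-1..1}\<close>, not even
  measurability. Clamping the argument gives a continuous function that agrees with \<open>f\<close>
  at all inner products of unit vectors.\<close>

lemma clamp_measurable: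
  fixes f :: "real \<Rightarrow> real"
  assumes "continuous_on {-1..1} f"
  shows "(\<lambda>y. f (max (-1) (min 1 y))) \<in> borel_measurable borel"
proof (rule borel_measurable_continuous_onI)
  show "continuous_on UNIV (\<lambda>y. f (max (-1) (min 1 y)))"
    by (rule continuous_on_compose2[OF assms]) (auto intro!: continuous_intros)
qed

lemma (in bandit_interaction) regret_le:
  assumes \<theta>s: "\<theta>s \<in> usphere d" and f: "\<And>y. y \<in> {-1..1} \<Longrightarrow> \<bar>f y\<bar> \<le> 1" and w: "\<omega> \<in> space M"
  shows "regret d f \<theta>s T \<omega> \<le> 2 * real T"
proof -
  have "f 1 - f (alignment d \<theta>s t \<omega>) \<le> 2" for t
  proof -
    have "alignment d \<theta>s t \<omega> \<in> {-1..1}"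
      using usphere_inner_le[OF \<theta>s iterate_in[OF w]] by (simp add: alignment_def abs_le_iff)
    then show ?thesis using f[of "alignment d \<theta>s t \<omega>"] f[of 1] by (simp add: abs_le_iff)
  qed
  then show ?thesis
    using sum_bounded_above[of "{1..T}" "\<lambda>t. f 1 - f (alignment d \<theta>s t \<omega>)" 2] by (simp add: regret_def)
qed

lemma (in bandit_interaction) regret_measurable:
  assumes \<theta>s: "\<theta>s \<in> usphere d" and f: "continuous_on {-1..1} f"
  shows "regret d f \<theta>s T \<in> borel_measurable M"
proof -
  have [measurable]: "(\<lambda>\<omega>. f (max (-1) (min 1 (alignment d \<theta>s t \<omega>)))) \<in> borel_measurable M" for t
    by (rule measurable_compose[OF _ clamp_measurable[OF f]]) simp
  have "alignment d \<theta>s t \<omega> \<in> {-1..1}" if "\<omega> \<in> space M" for t \<omega>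
    using usphere_inner_le[OF \<theta>s iterate_in[OF that]] by (simp add: alignment_def abs_le_iff)
  then have "regret d f \<theta>s T \<omega> = (\<Sum>t=1..T. f 1 - f (max (-1) (min 1 (alignment d \<theta>s t \<omega>))))"
    if "\<omega> \<in> space M" for \<omega>
    using that by (simp add: regret_def)
  moreover have "(\<lambda>\<omega>. \<Sum>t=1..T. f 1 - f (max (-1) (min 1 (alignment d \<theta>s t \<omega>)))) \<in> borel_measurable M"
    by measurable
  ultimately show ?thesis by (simp cong: measurable_cong)
qed

section \<open>One step of SGD: the alignment and its exponential moment\<close>

context interactive_sgd
begin

text \<open>\<open>joint_law\<close> is applied to the indicator of failure; in the Gaussian model
  the cosine is exact for every sample.\<close>

lemma action_cos:
  assumes s: "1 \<le> s"
  shows "AE \<omega> in M. inner_d d (iterate (n0 + s) \<omega>) (action (n0 + s) \<omega>) = sqrt (1 - (\<sigma> s)\<^sup>2)"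
proof -
  define \<psi> :: "rvec \<times> rvec \<Rightarrow> ennreal"
    where "\<psi> = (\<lambda>x. if inner_d d (fst x) (snd x) = sqrt (1 - (\<sigma> s)\<^sup>2) then 0 else 1)"
  have [measurable]: "\<psi> \<in> borel_measurable (borel \<Otimes>\<^sub>M borel)" unfolding \<psi>_def
    by measurable
  have "(\<integral>\<^sup>+\<omega>. \<psi> (iterate (n0 + s) \<omega>, action (n0 + s) \<omega>) \<partial>M) =
      (\<integral>\<^sup>+\<omega>. indicator (space M) \<omega> * \<psi> (iterate (n0 + s) \<omega>, action (n0 + s) \<omega>) \<partial>M)"
    by (intro nn_integral_cong) simp
  also have "\<dots> = (\<integral>\<^sup>+\<omega>. indicator (space M) \<omega> *
      (\<integral>\<^sup>+g. \<psi> (iterate (n0 + s) \<omega>, play d (\<sigma> s) (iterate (n0 + s) \<omega>) g) \<partial>std_gaussian d) \<partial>M)"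
    using sets.top[of "past d (n0 + s)"] by (intro joint_law s) (auto simp: space_past)
  also have "\<dots> = (\<integral>\<^sup>+\<omega>. 0 \<partial>M)"
    by (intro nn_integral_cong) (simp add: \<psi>_def inner_d_play_self iterate_in)
  finally have "(\<integral>\<^sup>+\<omega>. \<psi> (iterate (n0 + s) \<omega>, action (n0 + s) \<omega>) \<partial>M) = 0" by simp
  then have "AE \<omega> in M. \<psi> (iterate (n0 + s) \<omega>, action (n0 + s) \<omega>) = 0"
    by (subst (asm) nn_integral_0_iff_AE) auto
  then show ?thesis by eventually_elim (auto simp: \<psi>_def split: if_splits)
qed

lemma alignment_step:
  assumes s: "1 \<le> s" and \<sigma>: "0 \<le> \<sigma> s" "\<sigma> s \<le> 1"
  defines "c \<equiv> sqrt (1 - (\<sigma> s)\<^sup>2)"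
  shows "AE \<omega> in M. alignment d \<theta>s (Suc (n0 + s)) \<omega> =
    (alignment d \<theta>s (n0 + s) \<omega> + (\<eta> s * (reward d f \<theta>s (n0 + s) \<omega> - f c) * f' c) *
      inner_d d \<theta>s (proj_orth d (iterate (n0 + s) \<omega>) (action (n0 + s) \<omega>))) /
    sqrt (1 + (\<eta> s * (reward d f \<theta>s (n0 + s) \<omega> - f c) * f' c)\<^sup>2 * (\<sigma> s)\<^sup>2)"
  using action_cos[OF s] update[OF s] AE_space
proof eventually_elim
  case (elim \<omega>)
  have "1 - c\<^sup>2 = (\<sigma> s)\<^sup>2" using \<sigma> by (simp add: c_def power_le_one)
  then show ?case
    using inner_d_sgd_step[OF iterate_in action_in elim(1), OF elim(3) elim(3), of \<theta>s f f' "\<eta> s"] elim(2)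
    by (simp add: alignment_def c_def)
qed

lemma proj_orth_action_le:
  assumes w: "\<omega> \<in> space M" and c: "inner_d d (iterate t \<omega>) (action t \<omega>) = sqrt (1 - S\<^sup>2)"
    and S: "0 \<le> S" "S \<le> 1" and \<theta>s: "\<theta>s \<in> usphere d"
  shows "\<bar>inner_d d \<theta>s (proj_orth d (iterate t \<omega>) (action t \<omega>))\<bar> \<le> S"
proof -
  let ?v = "proj_orth d (iterate t \<omega>) (action t \<omega>)"
  have "inner_d d ?v ?v = S\<^sup>2"
    unfolding inner_d_proj_orth_self(1)[OF iterate_in[OF w]] c
    using usphereD(2)[OF action_in[OF w]] S by (simp add: power_le_one)
  then have "L2_set ?v {..<d} = S" using S by (simp add: L2_set_inner_d)
  then show ?thesis using inner_d_Cauchy_Schwarz[of d \<theta>s ?v] usphereD[OF \<theta>s] by simp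
qed

context
  fixes s :: nat and K x0 c :: real
  assumes s: "1 \<le> s" and \<sigma>: "0 \<le> \<sigma> s" "\<sigma> s \<le> 1" and c_def: "c = sqrt (1 - (\<sigma> s)\<^sup>2)"
    and \<eta>: "0 \<le> \<eta> s" and f'c: "0 \<le> f' c" and \<theta>s: "\<theta>s \<in> usphere d"
    and f: "\<And>y. y \<in> {-1..1} \<Longrightarrow> \<bar>f y\<bar> \<le> 1"
    and x0: "\<eta> s * f' c * \<sigma> s * (2 + K) \<le> x0" "x0 \<le> 1"
begin

lemma step_size_le:
  assumes w: "\<omega> \<in> space M" and K: "\<bar>noise (n0 + s) \<omega>\<bar> \<le> K"
  shows "\<bar>\<eta> s * (reward d f \<theta>s (n0 + s) \<omega> - f c) * f' c\<bar> * \<sigma> s \<le> x0"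
proof -
  have c1: "c \<in> {-1..1}" using \<sigma> by (auto simp: c_def power_le_one intro: order_trans[of _ 0])
  have y: "inner_d d \<theta>s (action (n0 + s) \<omega>) \<in> {-1..1}"
    using usphere_inner_le[OF \<theta>s action_in[OF w]] by (simp add: abs_le_iff)
  have r: "\<bar>reward d f \<theta>s (n0 + s) \<omega> - f c\<bar> \<le> 2 + K"
    using f[OF y] f[OF c1] K by (auto simp: reward_def)
  have "\<bar>\<eta> s * (reward d f \<theta>s (n0 + s) \<omega> - f c) * f' c\<bar> * \<sigma> s =
      (\<eta> s * f' c * \<sigma> s) * \<bar>reward d f \<theta>s (n0 + s) \<omega> - f c\<bar>"
    using \<eta> f'c by (simp add: abs_mult)
  also have "\<dots> \<le> (\<eta> s * f' c * \<sigma> s) * (2 + K)"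
    using \<eta> f'c \<sigma> r by (intro mult_left_mono) auto
  finally show ?thesis using x0 by simp
qed

text \<open>For rounds whose alignment lies above the window of the decay estimate: a single step
  with bounded noise cannot use up the margin.\<close>

lemma alignment_step_crude:
  "AE \<omega> in M. 0 \<le> alignment d \<theta>s (n0 + s) \<omega> \<longrightarrow> \<bar>noise (n0 + s) \<omega>\<bar> \<le> K \<longrightarrow>
    alignment d \<theta>s (n0 + s) \<omega> - 2 * x0 \<le> alignment d \<theta>s (Suc (n0 + s)) \<omega>"
  using alignment_step[OF s \<sigma>] action_cos[OF s] AE_space[of M]
proof eventually_elim
  case (elim \<omega>)
  have "alignment d \<theta>s (n0 + s) \<omega> \<le> 1"
    using usphere_inner_le[OF \<theta>s iterate_in[OF elim(3)]] by (simp add: alignment_def abs_le_iff)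
  then show ?case
    unfolding elim(1)[folded c_def]
    using step_size_le[OF elim(3)] proj_orth_action_le[OF elim(3,2) \<sigma> \<theta>s] x0
    by (auto intro!: sgd_alignment_lower(1))
qed

text \<open>The noise is integrated first, given past and action, which leaves
  \<open>exp ((k * U)\<^sup>2 / 2)\<close>; then the action, given the past, by
  \<open>exp_moment_orth_dir\<close>. The gain \<Delta> is the drift less the normalization loss
  \<open>h * x0\<^sup>2\<close>. The slope condition sits at \<open>c * m\<close> because the played
  action contracts the alignment by the cosine \<open>c\<close> before the exploration is
  added.\<close>

lemma exp_alignment_step:
  fixes E lam l h q \<Delta>
  assumes E: "E \<in> sets (past d (n0 + s))" and d: "0 < d" and lam: "0 < lam"
    and El: "\<And>\<omega>. \<omega> \<in> E \<Longrightarrow> alignment d \<theta>s (n0 + s) \<omega> \<in> {l..h}"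
    and lx: "x0 \<le> l" "0 < l" "0 \<le> x0" and q: "0 \<le> q"
    and f_cont: "continuous_on {-1..1} f" and f_mono: "mono_on {-1..1} f"
    and f_q: "\<And>m u. l \<le> m \<Longrightarrow> m \<le> h \<Longrightarrow> m \<le> 1 \<Longrightarrow> 0 \<le> u \<Longrightarrow> c * m + u \<le> 1 \<Longrightarrow> f (c * m) + q * u \<le> f (c * m + u)"
    and p: "lam * \<eta> s * f' c * \<sigma> s \<le> 1 / 4" "24 * (lam * \<eta> s * f' c) \<le> q"
    and gain: "\<Delta> + h * x0\<^sup>2 \<le> \<eta> s * f' c * (\<sigma> s)\<^sup>2 * q * (1 - h) / (12 * real d)"
  shows "(\<integral>\<^sup>+\<omega>. indicator E \<omega> * indicator {\<omega>. \<bar>noise (n0 + s) \<omega>\<bar> \<le> K} \<omega> *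
      ennreal (exp (- lam * alignment d \<theta>s (Suc (n0 + s)) \<omega>)) \<partial>M) \<le>
    (\<integral>\<^sup>+\<omega>. indicator E \<omega> * ennreal (exp (- lam * (alignment d \<theta>s (n0 + s) \<omega> + \<Delta>))) \<partial>M)"
proof -
  let ?t = "n0 + s"
  define F where "F y = f (max (-1) (min 1 y))" for y
  have F_eq: "F y = f y" if "y \<in> {-1..1}" for y using that by (simp add: F_def)
  have [measurable]: "F \<in> borel_measurable borel" unfolding F_def by (rule clamp_measurable[OF f_cont])
  define k where "k = lam * \<eta> s * f' c"
  have k0: "0 \<le> k" using lam \<eta> f'c by (simp add: k_def)
  define Uh where "Uh = (\<lambda>x::rvec \<times> rvec. inner_d d \<theta>s (snd x) - inner_d d (fst x) (snd x) * inner_d d \<theta>s (fst x))"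
  have Uh: "Uh (\<theta>, a) = inner_d d \<theta>s (proj_orth d \<theta> a)" for \<theta> a
    by (simp add: Uh_def inner_d_proj_orth)
  have [measurable]: "Uh \<in> borel_measurable (borel \<Otimes>\<^sub>M borel)" unfolding Uh_def by measurable
  define V where "V = (\<lambda>x::rvec \<times> rvec. exp (- lam * inner_d d \<theta>s (fst x) + lam * h * x0\<^sup>2) *
      exp (- (k * (F (inner_d d \<theta>s (snd x)) - f c) * Uh x)))"
  have [measurable]: "V \<in> borel_measurable (borel \<Otimes>\<^sub>M borel)" unfolding V_def by measurable
  define st where "st \<omega> = (iterate ?t \<omega>, action ?t \<omega>)" for \<omega>
  have st_pa [measurable]: "st \<in> past_and_action d ?t \<rightarrow>\<^sub>M borel \<Otimes>\<^sub>M borel" unfolding st_def by measurable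
  have E_pa [measurable]: "E \<in> sets (past_and_action d ?t)" using E past_sets_past_and_action by auto
  \<comment> \<open>A crude bound, valid on the whole space, that makes the random exponent bounded
    as \<open>noise_mgf\<close> requires.\<close>
  have Uh_le: "\<bar>inner_d d \<theta>s (proj_orth d (iterate ?t \<omega>) (action ?t \<omega>))\<bar> \<le> 2" if "\<omega> \<in> space M" for \<omega>
  proof -
    let ?a = "inner_d d (iterate ?t \<omega>) (action ?t \<omega>)" and ?b = "inner_d d \<theta>s (iterate ?t \<omega>)"
    have "\<bar>?a\<bar> * \<bar>?b\<bar> \<le> 1 * 1"
      by (intro mult_mono usphere_inner_le iterate_in action_in that \<theta>s) auto
    moreover have "\<bar>inner_d d \<theta>s (action ?t \<omega>)\<bar> \<le> 1"
      by (intro usphere_inner_le action_in that \<theta>s)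
    moreover have "inner_d d \<theta>s (proj_orth d (iterate ?t \<omega>) (action ?t \<omega>)) = inner_d d \<theta>s (action ?t \<omega>) - ?a * ?b"
      by (rule inner_d_proj_orth)
    ultimately show ?thesis by (simp add: abs_mult[symmetric])
  qed
  define Y where "Y \<omega> = indicator E \<omega> * ennreal (V (st \<omega>))" for \<omega>
  define L where "L \<omega> = - k * Uh (st \<omega>)" for \<omega>
  have "(\<integral>\<^sup>+\<omega>. indicator E \<omega> * indicator {\<omega>. \<bar>noise ?t \<omega>\<bar> \<le> K} \<omega> *
      ennreal (exp (- lam * alignment d \<theta>s (Suc ?t) \<omega>)) \<partial>M) \<le>
      (\<integral>\<^sup>+\<omega>. Y \<omega> * ennreal (exp (L \<omega> * noise ?t \<omega>)) \<partial>M)"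
  proof (rule nn_integral_mono_AE)
   show "AE \<omega> in M. indicator E \<omega> * indicator {\<omega>. \<bar>noise ?t \<omega>\<bar> \<le> K} \<omega> *
      ennreal (exp (- lam * alignment d \<theta>s (Suc ?t) \<omega>)) \<le> Y \<omega> * ennreal (exp (L \<omega> * noise ?t \<omega>))"
    using alignment_step[OF s \<sigma>] action_cos[OF s] AE_space[of M]
   proof eventually_elim
    case (elim \<omega>)
    show ?case
    proof (cases "\<omega> \<in> E \<and> \<bar>noise ?t \<omega>\<bar> \<le> K")
      case True
      let ?m = "alignment d \<theta>s ?t \<omega>" and ?m' = "alignment d \<theta>s (Suc ?t) \<omega>"
      let ?w = "\<eta> s * (reward d f \<theta>s ?t \<omega> - f c) * f' c"
      let ?U = "inner_d d \<theta>s (proj_orth d (iterate ?t \<omega>) (action ?t \<omega>))"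
      have m: "l \<le> ?m" "?m \<le> h" using El[of \<omega>] True by auto
      have m1: "?m \<le> 1"
        using usphere_inner_le[OF \<theta>s iterate_in[OF elim(3)]] by (simp add: alignment_def abs_le_iff)
      \<comment> \<open>The truncation of the noise is used here, to keep the step below
        \<open>x0\<close>; afterwards its indicator is bounded by 1 and the noise is integrated
        without truncation.\<close>
      have "?m + ?w * ?U - ?m * x0\<^sup>2 \<le> ?m'"
        unfolding elim(1)[folded c_def]
        using step_size_le[OF elim(3)] proj_orth_action_le[OF elim(3,2) \<sigma> \<theta>s] x0 True m m1 lx
        by (intro sgd_alignment_lower(2)) auto
      moreover have "?m * x0\<^sup>2 \<le> h * x0\<^sup>2" using m by (intro mult_right_mono) auto
      ultimately have "lam * (?m + ?w * ?U - h * x0\<^sup>2) \<le> lam * ?m'" using lam by (intro mult_left_mono) auto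
      moreover have "lam * (?w * ?U) = k * (F (inner_d d \<theta>s (action ?t \<omega>)) - f c) * ?U - L \<omega> * noise ?t \<omega>"
      proof -
        have "inner_d d \<theta>s (action ?t \<omega>) \<in> {-1..1}"
          using usphere_inner_le[OF \<theta>s action_in[OF elim(3)]] by (simp add: abs_le_iff)
        then show ?thesis by (simp add: F_eq k_def L_def st_def Uh reward_def algebra_simps)
      qed
      ultimately have "- lam * ?m' \<le> (- lam * ?m + lam * h * x0\<^sup>2) +
          - (k * (F (inner_d d \<theta>s (action ?t \<omega>)) - f c) * ?U) + L \<omega> * noise ?t \<omega>"
        by (simp add: algebra_simps)
      then have "exp (- lam * ?m') \<le> V (st \<omega>) * exp (L \<omega> * noise ?t \<omega>)"
        by (simp add: V_def exp_add[symmetric] st_def Uh alignment_def)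
      then show ?thesis
        using True by (simp add: Y_def ennreal_mult[symmetric] V_def ennreal_leI)
    qed (auto simp: indicator_def)
   qed
  qed
  also have "\<dots> \<le> (\<integral>\<^sup>+\<omega>. Y \<omega> * ennreal (exp ((L \<omega>)\<^sup>2 / 2)) \<partial>M)"
  proof (rule noise_mgf)
    show "Y \<in> borel_measurable (past_and_action d ?t)" unfolding Y_def by measurable
    show "L \<in> borel_measurable (past_and_action d ?t)" unfolding L_def by measurable
    show "\<bar>L \<omega>\<bar> \<le> k * 2" if "\<omega> \<in> space M" for \<omega>
      using Uh_le[OF that] k0 by (simp add: L_def st_def Uh abs_mult mult_left_mono)
  qed (use s in simp)
  also have "\<dots> = (\<integral>\<^sup>+\<omega>. indicator E \<omega> * ennreal (V (st \<omega>) * exp ((k * Uh (st \<omega>))\<^sup>2 / 2)) \<partial>M)"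
    by (intro nn_integral_cong) (simp add: Y_def L_def ennreal_mult V_def mult.assoc)
  also have "\<dots> = (\<integral>\<^sup>+\<omega>. indicator E \<omega> * (\<integral>\<^sup>+g. ennreal (V (iterate ?t \<omega>, play d (\<sigma> s) (iterate ?t \<omega>) g) *
      exp ((k * Uh (iterate ?t \<omega>, play d (\<sigma> s) (iterate ?t \<omega>) g))\<^sup>2 / 2)) \<partial>std_gaussian d) \<partial>M)"
    unfolding st_def by (rule joint_law[OF s E]) measurable
  also have "\<dots> \<le> (\<integral>\<^sup>+\<omega>. indicator E \<omega> * ennreal (exp (- lam * (alignment d \<theta>s ?t \<omega> + \<Delta>))) \<partial>M)"
  proof (intro nn_integral_mono)
    fix \<omega> assume w: "\<omega> \<in> space M"
    let ?th = "iterate ?t \<omega>" and ?m = "alignment d \<theta>s ?t \<omega>"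
    let ?C = "exp (- lam * ?m + lam * h * x0\<^sup>2)"
    let ?p = "k * \<sigma> s"
    have th: "?th \<in> usphere d" by (rule iterate_in[OF w])
    show "indicator E \<omega> * (\<integral>\<^sup>+g. ennreal (V (?th, play d (\<sigma> s) ?th g) *
          exp ((k * Uh (?th, play d (\<sigma> s) ?th g))\<^sup>2 / 2)) \<partial>std_gaussian d)
        \<le> indicator E \<omega> * ennreal (exp (- lam * (?m + \<Delta>)))"
    proof (cases "\<omega> \<in> E")
      case True
      then have m: "l \<le> ?m" "?m \<le> h" using El[of \<omega>] by auto
      have m1: "?m \<le> 1"
        using usphere_inner_le[OF \<theta>s th] by (simp add: alignment_def abs_le_iff)
      have c1: "c \<in> {-1..1}" using \<sigma> by (auto simp: c_def power_le_one intro: order_trans[of _ 0])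
      have c0: "0 \<le> c" "c \<le> 1" using \<sigma> by (auto simp: c_def power_le_one)
      have cm: "c * ?m \<in> {-1..1}" "0 \<le> c * ?m"
        using c0 m m1 lx mult_mono[of c 1 ?m 1] by (auto intro: order_trans[of _ 0])
      have fq: "F (c * ?m) + q * u \<le> F (c * ?m + u)" if "0 \<le> u" "c * ?m + u \<le> 1" for u
        using f_q[OF m m1 that] cm that by (simp add: F_eq)
      have "(\<integral>\<^sup>+g. ennreal (V (?th, play d (\<sigma> s) ?th g) *
          exp ((k * Uh (?th, play d (\<sigma> s) ?th g))\<^sup>2 / 2)) \<partial>std_gaussian d) =
        (\<integral>\<^sup>+g. ennreal ?C * ennreal (exp (- (?p * (F (inner_d d \<theta>s (play d (\<sigma> s) ?th g)) - f c) * inner_d d \<theta>s (orth_dir d ?th g))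
          + (?p * inner_d d \<theta>s (orth_dir d ?th g))\<^sup>2 / 2)) \<partial>std_gaussian d)"
        using th
        by (intro nn_integral_cong)
          (simp add: V_def Uh inner_d_proj_orth_play alignment_def ennreal_mult[symmetric]
            exp_add[symmetric] algebra_simps)
      also have "\<dots> = ennreal ?C * (\<integral>\<^sup>+g. ennreal (exp (- (?p * (F (inner_d d \<theta>s (play d (\<sigma> s) ?th g)) - f c) * inner_d d \<theta>s (orth_dir d ?th g))
          + (?p * inner_d d \<theta>s (orth_dir d ?th g))\<^sup>2 / 2)) \<partial>std_gaussian d)"
        by (intro nn_integral_cmult) measurable
      also have "\<dots> \<le> ennreal ?C * ennreal (exp (- (?p * \<sigma> s * q * (1 - (inner_d d \<theta>s ?th)\<^sup>2) / (12 * real d))))"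
      proof (intro mult_left_mono exp_moment_orth_dir \<theta>s th d \<sigma> q)
        show "mono_on {-1..1} F"
          unfolding F_def by (intro mono_onI mono_onD[OF f_mono]) auto
        show "\<bar>F y\<bar> \<le> 1" if "y \<in> {-1..1}" for y using f[OF that] that by (simp add: F_eq)
        show "\<bar>f c\<bar> \<le> 1" by (rule f[OF c1])
        show "0 \<le> ?p" using k0 \<sigma> by simp
        show "?p \<le> 1 / 4" using p(1) by (simp add: k_def)
        show "24 * ?p \<le> \<sigma> s * q"
          using mult_left_mono[OF p(2) \<sigma>(1)] by (simp add: k_def algebra_simps)
        fix u :: real assume "0 \<le> u" "sqrt (1 - (\<sigma> s)\<^sup>2) * inner_d d \<theta>s ?th + u \<le> 1"
        then show "F (sqrt (1 - (\<sigma> s)\<^sup>2) * inner_d d \<theta>s ?th) + q * u \<le> F (sqrt (1 - (\<sigma> s)\<^sup>2) * inner_d d \<theta>s ?th + u)"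
          using fq by (simp add: c_def alignment_def)
      qed simp_all
      also have "\<dots> \<le> ennreal (exp (- lam * (?m + \<Delta>)))"
      proof -
        \<comment> \<open>On the window \<open>1 - m\<^sup>2 \<ge> 1 - m \<ge> 1 - h\<close>, which
          makes the drift uniform.\<close>
        have "1 - h \<le> 1 - ?m\<^sup>2"
        proof -
          have "?m * ?m \<le> 1 * ?m" using m m1 lx by (intro mult_right_mono) auto
          then show ?thesis using m by (simp add: power2_eq_square)
        qed
        then have "\<eta> s * f' c * (\<sigma> s)\<^sup>2 * q * (1 - h) / (12 * real d) \<le>
            \<eta> s * f' c * (\<sigma> s)\<^sup>2 * q * (1 - ?m\<^sup>2) / (12 * real d)"
          using \<eta> f'c \<sigma> q by (intro divide_right_mono mult_left_mono) auto
        then have "lam * (\<Delta> + h * x0\<^sup>2) \<le> lam * (\<eta> s * f' c * (\<sigma> s)\<^sup>2 * q * (1 - ?m\<^sup>2) / (12 * real d))"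
          using gain lam by (intro mult_left_mono) auto
        then have "- lam * ?m + lam * h * x0\<^sup>2 + - (?p * \<sigma> s * q * (1 - ?m\<^sup>2) / (12 * real d)) \<le> - lam * (?m + \<Delta>)"
          by (simp add: k_def algebra_simps power2_eq_square)
        then have "exp (- lam * ?m + lam * h * x0\<^sup>2 + - (?p * \<sigma> s * q * (1 - ?m\<^sup>2) / (12 * real d))) \<le> exp (- lam * (?m + \<Delta>))"
          by simp
        then show ?thesis
          unfolding exp_add by (simp add: ennreal_mult[symmetric] alignment_def ennreal_leI)
      qed
      finally show ?thesis using True by simp
    qed simp
  qed
  finally show ?thesis .
qed

end

end

section \<open>Epochs\<close>

context interactive_sgd
begin

context
  fixes a g :: "nat \<Rightarrow> real" and N :: "nat \<Rightarrow> nat" and S :: "nat \<Rightarrow> nat" and L K :: real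
  assumes a_Suc: "\<And>k. a (Suc k) = a k + g k" and g_pos: "\<And>k. 0 < g k" and g_le: "\<And>k. g k \<le> a k"
    and N_pos: "\<And>k. 0 < N k" and S_0: "S 0 = 0" and S_Suc: "\<And>k. S (Suc k) = S k + N k"
    and a_0: "a 0 \<le> 1 / sqrt (real d)"
    and L: "0 \<le> L" "exp (- L) \<le> \<delta> / 4" and K: "0 \<le> K" "2 * exp (- K\<^sup>2 / 2) \<le> \<delta> / 2"
    and crude: "\<And>k i. i < N k \<Longrightarrow> AE \<omega> in M. 0 \<le> alignment d \<theta>s (n0 + Suc (S k + i)) \<omega> \<longrightarrow>
        \<bar>noise (n0 + Suc (S k + i)) \<omega>\<bar> \<le> K \<longrightarrow>
        alignment d \<theta>s (n0 + Suc (S k + i)) \<omega> - 2 * g k \<le> alignment d \<theta>s (Suc (n0 + Suc (S k + i))) \<omega>"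
    and decay: "\<And>k i E. i < N k \<Longrightarrow> E \<in> sets (past d (n0 + Suc (S k + i))) \<Longrightarrow>
        (\<And>\<omega>. \<omega> \<in> E \<Longrightarrow> alignment d \<theta>s (n0 + Suc (S k + i)) \<omega> \<in> {a k - g k..a k + 5 * g k}) \<Longrightarrow>
        (\<integral>\<^sup>+\<omega>. indicator E \<omega> * indicator {\<omega>. \<bar>noise (n0 + Suc (S k + i)) \<omega>\<bar> \<le> K} \<omega> *
          ennreal (exp (- (L / g k) * alignment d \<theta>s (Suc (n0 + Suc (S k + i))) \<omega>)) \<partial>M) \<le>
        (\<integral>\<^sup>+\<omega>. indicator E \<omega> *
          ennreal (exp (- (L / g k) * (alignment d \<theta>s (n0 + Suc (S k + i)) \<omega> + 2 * g k / real (N k)))) \<partial>M)"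
begin

text \<open>The barrier climbs from \<open>a k\<close> to \<open>a k + 2 * g k\<close>. A run that
  stays at most \<open>g k\<close> below it never falls under \<open>a k - g k\<close> and ends the
  epoch at or above \<open>a k + g k\<close>, the next level.\<close>

definition barrier :: "nat \<Rightarrow> nat \<Rightarrow> real" where
  "barrier k i = a k + real i * (2 * g k / real (N k))"

text \<open>The runs in \<open>A\<close> that respect barrier and noise bound during the first
  \<open>i\<close> steps. Position \<open>i\<close> in epoch \<open>k\<close>, counted from 0, is
  round \<open>n0 + Suc (S k + i)\<close>, so the event for \<open>Suc i\<close> involves the noise
  of that round and the next iterate.\<close>

primrec epoch_good :: "trajectory set \<Rightarrow> nat \<Rightarrow> nat \<Rightarrow> trajectory set" where
  "epoch_good A k 0 = A"
| "epoch_good A k (Suc i) = epoch_good A k i \<inter>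
    {\<omega> \<in> space M. \<bar>noise (n0 + Suc (S k + i)) \<omega>\<bar> \<le> K \<and>
      barrier k (Suc i) - g k \<le> alignment d \<theta>s (Suc (n0 + Suc (S k + i))) \<omega>}"

primrec start_good :: "nat \<Rightarrow> trajectory set" where
  "start_good 0 = {\<omega> \<in> space M. a 0 \<le> alignment d \<theta>s (n0 + 1) \<omega>}"
| "start_good (Suc k) = epoch_good (start_good k) k (N k)"

abbreviation "good k i \<equiv> epoch_good (start_good k) k i"

lemma barrier_mono: "i \<le> N k \<Longrightarrow> a k \<le> barrier k i \<and> barrier k i \<le> a k + 2 * g k"
proof -
  assume i: "i \<le> N k"
  have "real i * (2 * g k / real (N k)) \<le> real (N k) * (2 * g k / real (N k))"
    using i g_pos[of k] by (intro mult_right_mono) auto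
  also have "\<dots> = 2 * g k" using N_pos[of k] by simp
  finally show ?thesis using g_pos[of k] by (simp add: barrier_def)
qed

text \<open>The current iterate becomes the first component of round \<open>t\<close> when time
  advances. Entry 0 of a trajectory is never recorded, whence \<open>1 \<le> t\<close>.\<close>

lemma sets_past_mono: "1 \<le> t \<Longrightarrow> sets (past d t) \<subseteq> sets (past d (Suc t))"
proof -
  assume t: "1 \<le> t"
  have sp: "(\<lambda>\<omega>. restrict \<omega> {1..<t}) \<in> past d (Suc t) \<rightarrow>\<^sub>M Pi\<^sub>M {1..<t} (\<lambda>_. round_space d)"
  proof (rule measurable_restrict)
    fix j assume "j \<in> {1..<t}"
    then show "(\<lambda>\<omega>. \<omega> j) \<in> past d (Suc t) \<rightarrow>\<^sub>M round_space d" by (intro round_past) auto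
  qed
  have "(\<lambda>\<omega>. \<omega> t) \<in> past d (Suc t) \<rightarrow>\<^sub>M round_space d" using t by (intro round_past) auto
  then have "iterate t \<in> past d (Suc t) \<rightarrow>\<^sub>M sphere_space d"
    unfolding iterate_def round_space_def by simp
  with sp have "(\<lambda>\<omega>. (restrict \<omega> {1..<t}, iterate t \<omega>)) \<in> past d (Suc t) \<rightarrow>\<^sub>M
      Pi\<^sub>M {1..<t} (\<lambda>_. round_space d) \<Otimes>\<^sub>M sphere_space d" by (intro measurable_Pair)
  then have "sets (vimage_algebra (space M) (\<lambda>\<omega>. (restrict \<omega> {1..<t}, iterate t \<omega>))
      (Pi\<^sub>M {1..<t} (\<lambda>_. round_space d) \<Otimes>\<^sub>M sphere_space d)) \<subseteq> sets (past d (Suc t))"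
    by (intro sets_image_in_sets) (auto simp: space_past)
  then show ?thesis unfolding past_def[of d t] space_M .
qed

lemma epoch_good_sets:
  assumes "A \<in> sets (past d (n0 + Suc (S k)))"
  shows "epoch_good A k i \<in> sets (past d (n0 + Suc (S k + i)))"
proof (induction i)
  case 0
  then show ?case using assms by simp
next
  case (Suc i)
  let ?t = "n0 + Suc (S k + i)"
  have [measurable]: "noise ?t \<in> borel_measurable (past d (Suc ?t))" by (intro noise_past) auto
  have [measurable]: "alignment d \<theta>s (Suc ?t) \<in> borel_measurable (past d (Suc ?t))"
    by (intro alignment_past_le) auto
  have "epoch_good A k i \<in> sets (past d (Suc ?t))" using sets_past_mono[of ?t] Suc by auto
  moreover have "{\<omega> \<in> space (past d (Suc ?t)). \<bar>noise ?t \<omega>\<bar> \<le> K \<and>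
      barrier k (Suc i) - g k \<le> alignment d \<theta>s (Suc ?t) \<omega>} \<in> sets (past d (Suc ?t))" by measurable
  ultimately show ?case by (simp add: space_past)
qed

lemma start_good_sets: "start_good k \<in> sets (past d (n0 + Suc (S k)))"
proof (induction k)
  case 0
  have [measurable]: "alignment d \<theta>s (n0 + 1) \<in> borel_measurable (past d (n0 + 1))"
    by (intro alignment_past_le) auto
  have "{\<omega> \<in> space (past d (n0 + 1)). a 0 \<le> alignment d \<theta>s (n0 + 1) \<omega>} \<in> sets (past d (n0 + 1))"
    by measurable
  then show ?case by (simp add: S_0 space_past)
next
  case (Suc k)
  then show ?case using epoch_good_sets[OF Suc, of "N k"] by (simp add: S_Suc)
qed

lemma good_sets_past: "good k i \<in> sets (past d (n0 + Suc (S k + i)))"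
  by (rule epoch_good_sets[OF start_good_sets])

lemma good_sets [measurable]: "good k i \<in> sets M"
  using good_sets_past[of k i] subalgebra_past[of "n0 + Suc (S k + i)"] by (auto simp: subalgebra_def)

lemma epoch_good_antimono: "i \<le> j \<Longrightarrow> epoch_good A k j \<subseteq> epoch_good A k i"
  by (induction j rule: dec_induct) auto

lemma start_good_antimono: "j \<le> k \<Longrightarrow> start_good k \<subseteq> start_good j"
proof (induction k rule: dec_induct)
  case (step k)
  then show ?case using epoch_good_antimono[of 0 "N k" "start_good k" k] by auto
qed simp

lemma start_good_alignment: "\<omega> \<in> start_good k \<Longrightarrow> a k \<le> alignment d \<theta>s (n0 + Suc (S k)) \<omega>"
proof (cases k)
  case 0
  then show "\<omega> \<in> start_good k \<Longrightarrow> ?thesis" by (simp add: S_0)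
next
  case (Suc j)
  obtain n where n: "N j = Suc n" using N_pos[of j] gr0_implies_Suc by blast
  have "barrier j (Suc n) - g j = a k"
    using N_pos[of j] by (simp add: barrier_def Suc a_Suc n[symmetric])
  then show "\<omega> \<in> start_good k \<Longrightarrow> ?thesis" by (simp add: Suc n S_Suc)
qed

lemma good_alignment:
  assumes "\<omega> \<in> good k i"
  shows "barrier k i - g k \<le> alignment d \<theta>s (n0 + Suc (S k + i)) \<omega>"
proof (cases i)
  case 0
  then show ?thesis using start_good_alignment[of \<omega> k] assms g_pos[of k] by (simp add: barrier_def)
qed (use assms in simp)

lemma good_alignment_before:
  assumes w: "\<omega> \<in> good k i" and j: "j < k \<and> i' \<le> N j \<or> j = k \<and> i' \<le> i" and i: "i \<le> N k"
  shows "a j - g j \<le> alignment d \<theta>s (n0 + Suc (S j + i')) \<omega>"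
proof -
  have i': "i' \<le> N j" using j i by auto
  have "\<omega> \<in> good j i'"
  proof (cases "j = k")
    case True
    then show ?thesis using w j epoch_good_antimono[of i' i] by auto
  next
    case False
    then have "\<omega> \<in> start_good k" using w epoch_good_antimono[of 0 i] by auto
    then have "\<omega> \<in> start_good (Suc j)" using start_good_antimono[of "Suc j" k] False j by auto
    then show ?thesis using epoch_good_antimono[OF i'] by auto
  qed
  then show ?thesis using good_alignment barrier_mono[OF i'] by force
qed

text \<open>Up to \<open>a k + 5 * g k\<close> the decay estimate applies and matches the rise of
  the barrier exactly. Above, one step loses at most \<open>2 * g k\<close>, which leaves the
  alignment over \<open>a k + 3 * g k\<close> and thus \<open>g k\<close> over the barrier; such
  runs contribute at most \<open>exp (- L)\<close>.\<close>

lemma potential_step: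
  assumes i: "i < N k"
  shows "(\<integral>\<^sup>+\<omega>. indicator (good k i) \<omega> * indicator {\<omega>. \<bar>noise (n0 + Suc (S k + i)) \<omega>\<bar> \<le> K} \<omega> *
      ennreal (exp ((L / g k) * (barrier k (Suc i) - alignment d \<theta>s (Suc (n0 + Suc (S k + i))) \<omega>))) \<partial>M) \<le>
    (\<integral>\<^sup>+\<omega>. indicator (good k i) \<omega> *
      ennreal (exp ((L / g k) * (barrier k i - alignment d \<theta>s (n0 + Suc (S k + i)) \<omega>))) \<partial>M) + ennreal (exp (- L))"
  (is "?lhs \<le> ?rhs + _")
proof -
  let ?t = "n0 + Suc (S k + i)" and ?lam = "L / g k"
  let ?m = "alignment d \<theta>s ?t" and ?m' = "alignment d \<theta>s (Suc ?t)"
  let ?B = "indicator {\<omega>. \<bar>noise ?t \<omega>\<bar> \<le> K} :: trajectory \<Rightarrow> ennreal"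
  define E where "E = good k i \<inter> {\<omega> \<in> space (past d ?t). ?m \<omega> \<le> a k + 5 * g k}"
  have [measurable]: "?m \<in> borel_measurable (past d ?t)" by (intro alignment_past_le) auto
  have E: "E \<in> sets (past d ?t)" unfolding E_def using good_sets_past by measurable
  then have [measurable]: "E \<in> sets M" using subalgebra_past[of ?t] by (auto simp: subalgebra_def)
  have mE: "?m \<omega> \<in> {a k - g k..a k + 5 * g k}" if "\<omega> \<in> E" for \<omega>
    using that good_alignment[of \<omega> k i] barrier_mono[of i k] i by (auto simp: E_def)
  have [measurable]: "?B \<in> borel_measurable M"
  proof -
    have "(\<lambda>\<omega>. if \<bar>noise ?t \<omega>\<bar> \<le> K then 1 else 0 :: ennreal) \<in> borel_measurable M" by measurable
    then show ?thesis by (simp add: indicator_def [abs_def] of_bool_def)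
  qed
  have AE: "AE \<omega> in M. indicator (good k i) \<omega> * ?B \<omega> * ennreal (exp (?lam * (barrier k (Suc i) - ?m' \<omega>))) \<le>
      ennreal (exp (?lam * barrier k (Suc i))) * (indicator E \<omega> * ?B \<omega> * ennreal (exp (- ?lam * ?m' \<omega>))) +
      ennreal (exp (- L))"
    using crude[OF i] AE_space[of M]
  proof eventually_elim
    case (elim \<omega>)
    show ?case
    proof (cases "\<omega> \<in> good k i \<and> \<bar>noise ?t \<omega>\<bar> \<le> K")
      case True
      show ?thesis
      proof (cases "?m \<omega> \<le> a k + 5 * g k")
        case le: True
        then have "\<omega> \<in> E" using True elim by (simp add: E_def space_past)
        then have "indicator (good k i) \<omega> * ?B \<omega> * ennreal (exp (?lam * (barrier k (Suc i) - ?m' \<omega>))) =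
            ennreal (exp (?lam * barrier k (Suc i))) * (indicator E \<omega> * ?B \<omega> * ennreal (exp (- ?lam * ?m' \<omega>)))"
          using True by (simp add: ennreal_mult[symmetric] exp_add[symmetric] algebra_simps)
        then show ?thesis by simp
      next
        case False
        then have "0 \<le> ?m \<omega>" using g_pos[of k] g_le[of k] by linarith
        then have "?m \<omega> - 2 * g k \<le> ?m' \<omega>" using elim True by blast
        then have "barrier k (Suc i) - ?m' \<omega> \<le> - g k"
          using barrier_mono[of "Suc i" k] i False by auto
        then have "?lam * (barrier k (Suc i) - ?m' \<omega>) \<le> ?lam * (- g k)"
          using L(1) g_pos[of k] by (intro mult_left_mono) auto
        also have "\<dots> = - L" using g_pos[of k] by simp
        finally have "ennreal (exp (?lam * (barrier k (Suc i) - ?m' \<omega>))) \<le> ennreal (exp (- L))"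
          by (intro ennreal_leI) simp
        then show ?thesis using True by (simp add: add_increasing)
      qed
    qed (auto simp: indicator_def)
  qed
  have "?lhs \<le> (\<integral>\<^sup>+\<omega>. ennreal (exp (?lam * barrier k (Suc i))) * (indicator E \<omega> * ?B \<omega> * ennreal (exp (- ?lam * ?m' \<omega>))) +
      ennreal (exp (- L)) \<partial>M)"
    by (rule nn_integral_mono_AE[OF AE])
  also have "\<dots> = ennreal (exp (?lam * barrier k (Suc i))) *
      (\<integral>\<^sup>+\<omega>. indicator E \<omega> * ?B \<omega> * ennreal (exp (- ?lam * ?m' \<omega>)) \<partial>M) + ennreal (exp (- L))"
    by (subst nn_integral_add) (auto simp: nn_integral_cmult emeasure_space_1)
  also have "\<dots> \<le> ennreal (exp (?lam * barrier k (Suc i))) *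
      (\<integral>\<^sup>+\<omega>. indicator E \<omega> * ennreal (exp (- ?lam * (?m \<omega> + 2 * g k / real (N k)))) \<partial>M) + ennreal (exp (- L))"
    by (intro add_right_mono mult_left_mono decay[OF i E mE]) auto
  also have "\<dots> = (\<integral>\<^sup>+\<omega>. indicator E \<omega> * ennreal (exp (?lam * (barrier k i - ?m \<omega>))) \<partial>M) + ennreal (exp (- L))"
  proof -
    have "?lam * barrier k (Suc i) + - ?lam * (?m \<omega> + 2 * g k / real (N k)) = ?lam * (barrier k i - ?m \<omega>)" for \<omega>
      unfolding barrier_def of_nat_Suc by algebra
    then have "ennreal (exp (?lam * barrier k (Suc i))) * (indicator E \<omega> * ennreal (exp (- ?lam * (?m \<omega> + 2 * g k / real (N k))))) =
        indicator E \<omega> * ennreal (exp (?lam * (barrier k i - ?m \<omega>)))" for \<omega>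
      by (simp add: ennreal_mult[symmetric] exp_add[symmetric] mult.left_commute)
    then show ?thesis by (subst nn_integral_cmult[symmetric]) auto
  qed
  also have "\<dots> \<le> ?rhs + ennreal (exp (- L))"
    by (intro add_right_mono nn_integral_mono mult_right_mono) (auto simp: E_def indicator_def)
  finally show ?thesis .
qed

text \<open>A good epoch starts at or above its barrier, so the potential is at most 1 initially;
  each step adds at most \<open>exp (- L)\<close>, and runs that leave the good event drop out of
  the integral.\<close>

lemma potential_bound:
  assumes "i \<le> N k"
  shows "(\<integral>\<^sup>+\<omega>. indicator (good k i) \<omega> *
    ennreal (exp ((L / g k) * (barrier k i - alignment d \<theta>s (n0 + Suc (S k + i)) \<omega>))) \<partial>M)
    \<le> ennreal (1 + real i * exp (- L))"
  using assms
proof (induction i)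
  case 0
  have "(\<integral>\<^sup>+\<omega>. indicator (good k 0) \<omega> *
    ennreal (exp ((L / g k) * (barrier k 0 - alignment d \<theta>s (n0 + Suc (S k + 0)) \<omega>))) \<partial>M) \<le> (\<integral>\<^sup>+\<omega>. 1 \<partial>M)"
  proof (intro nn_integral_mono)
    fix \<omega>
    show "indicator (good k 0) \<omega> *
      ennreal (exp ((L / g k) * (barrier k 0 - alignment d \<theta>s (n0 + Suc (S k + 0)) \<omega>))) \<le> 1"
    proof (cases "\<omega> \<in> good k 0")
      case True
      then have "barrier k 0 \<le> alignment d \<theta>s (n0 + Suc (S k + 0)) \<omega>"
        using start_good_alignment[of \<omega> k] by (simp add: barrier_def)
      then have "(L / g k) * (barrier k 0 - alignment d \<theta>s (n0 + Suc (S k + 0)) \<omega>) \<le> 0"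
        using L(1) g_pos[of k] by (intro mult_nonneg_nonpos) auto
      then show ?thesis by (auto simp: indicator_def)
    qed simp
  qed
  then show ?case by (simp add: emeasure_space_1)
next
  case (Suc i)
  let ?t = "n0 + Suc (S k + i)"
  have "(\<integral>\<^sup>+\<omega>. indicator (good k (Suc i)) \<omega> *
      ennreal (exp ((L / g k) * (barrier k (Suc i) - alignment d \<theta>s (n0 + Suc (S k + Suc i)) \<omega>))) \<partial>M) \<le>
    (\<integral>\<^sup>+\<omega>. indicator (good k i) \<omega> * indicator {\<omega>. \<bar>noise ?t \<omega>\<bar> \<le> K} \<omega> *
      ennreal (exp ((L / g k) * (barrier k (Suc i) - alignment d \<theta>s (Suc ?t) \<omega>))) \<partial>M)"
    by (intro nn_integral_mono) (auto simp: indicator_def)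
  also have "\<dots> \<le> ennreal (1 + real i * exp (- L)) + ennreal (exp (- L))"
    using potential_step[of i k] Suc by (auto intro: order_trans add_right_mono)
  also have "\<dots> = ennreal (1 + real (Suc i) * exp (- L))"
    by (simp add: ennreal_plus[symmetric] algebra_simps del: ennreal_plus)
  finally show ?case .
qed

text \<open>A run fails by large noise, with probability at most \<open>\<delta> / 2\<close>, or by
  falling more than \<open>g k\<close> below the barrier, where the potential exceeds
  \<open>exp L\<close>. Markov's inequality bounds the latter by \<open>exp (- L)\<close> times a
  potential of at most 2, and \<open>exp (- L) \<le> \<delta> / 4\<close>.\<close>

lemma good_step_prob:
  assumes i: "i < N k" and small: "real (Suc i) * exp (- L) \<le> 1"
  shows "prob (good k i) - \<delta> \<le> prob (good k (Suc i))"
proof -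
  let ?t = "n0 + Suc (S k + i)"
  \<comment> \<open>The potential estimate holds for truncated noise, so the barrier is tested on
    runs with small noise.\<close>
  define G where "G = good k i \<inter> {\<omega> \<in> space M. \<bar>noise ?t \<omega>\<bar> \<le> K}"
  have [measurable]: "G \<in> sets M" unfolding G_def by measurable
  let ?F = "G \<inter> {\<omega> \<in> space M. alignment d \<theta>s (Suc ?t) \<omega> < barrier k (Suc i) - g k}"
  let ?e = "\<lambda>\<omega>. ennreal (exp ((L / g k) * (barrier k (Suc i) - alignment d \<theta>s (Suc ?t) \<omega>)))"
  have "(\<integral>\<^sup>+\<omega>. indicator G \<omega> * ?e \<omega> \<partial>M) = (\<integral>\<^sup>+\<omega>. indicator (good k i) \<omega> * indicator {\<omega>. \<bar>noise ?t \<omega>\<bar> \<le> K} \<omega> * ?e \<omega> \<partial>M)"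
    by (intro nn_integral_cong) (auto simp: G_def indicator_def)
  also have "\<dots> \<le> ennreal (1 + real i * exp (- L)) + ennreal (exp (- L))"
    using potential_step[OF i] potential_bound[of i k] i by (auto intro: order_trans add_right_mono)
  also have "\<dots> = ennreal (1 + real (Suc i) * exp (- L))"
    by (simp add: ennreal_plus[symmetric] algebra_simps del: ennreal_plus)
  finally have I: "(\<integral>\<^sup>+\<omega>. indicator G \<omega> * ?e \<omega> \<partial>M) \<le> ennreal (1 + real (Suc i) * exp (- L))" .
  have "emeasure M ?F = (\<integral>\<^sup>+\<omega>. indicator ?F \<omega> \<partial>M)"
    by (rule nn_integral_indicator[symmetric]) measurable
  also have "\<dots> \<le> (\<integral>\<^sup>+\<omega>. ennreal (exp (- L)) * (indicator G \<omega> * ?e \<omega>) \<partial>M)"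
  proof (intro nn_integral_mono)
    fix \<omega>
    show "indicator ?F \<omega> \<le> ennreal (exp (- L)) * (indicator G \<omega> * ?e \<omega>)"
    proof (cases "\<omega> \<in> ?F")
      case True
      then have "(L / g k) * g k \<le> (L / g k) * (barrier k (Suc i) - alignment d \<theta>s (Suc ?t) \<omega>)"
        using L(1) g_pos[of k] by (intro mult_left_mono) auto
      then have "0 \<le> - L + (L / g k) * (barrier k (Suc i) - alignment d \<theta>s (Suc ?t) \<omega>)"
        using g_pos[of k] by simp
      then have "1 \<le> exp (- L) * exp ((L / g k) * (barrier k (Suc i) - alignment d \<theta>s (Suc ?t) \<omega>))"
        unfolding exp_add[symmetric] by simp
      then show ?thesis using True by (simp add: ennreal_mult[symmetric])
    qed simp
  qed
  also have "\<dots> = ennreal (exp (- L)) * (\<integral>\<^sup>+\<omega>. indicator G \<omega> * ?e \<omega> \<partial>M)"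
    by (intro nn_integral_cmult) measurable
  also have "\<dots> \<le> ennreal (exp (- L)) * ennreal (1 + real (Suc i) * exp (- L))"
    by (intro mult_left_mono I) simp
  also have "\<dots> \<le> ennreal (\<delta> / 2)"
  proof -
    have "exp (- L) * (1 + real (Suc i) * exp (- L)) \<le> exp (- L) * 2"
      using small by (intro mult_left_mono) auto
    then have "exp (- L) * (1 + real (Suc i) * exp (- L)) \<le> \<delta> / 2" using L(2) by linarith
    moreover have "ennreal (exp (- L)) * ennreal (1 + real (Suc i) * exp (- L)) =
        ennreal (exp (- L) * (1 + real (Suc i) * exp (- L)))"
      by (rule ennreal_mult[symmetric]) auto
    ultimately show ?thesis by (metis ennreal_leI)
  qed
  finally have "ennreal (prob ?F) \<le> ennreal (\<delta> / 2)" by (simp only: emeasure_eq_measure)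
  moreover have "0 \<le> \<delta> / 2" using L(2) exp_ge_zero[of "- L"] by linarith
  ultimately have F: "prob ?F \<le> \<delta> / 2" by (simp only: ennreal_le_iff)
  have "prob {\<omega> \<in> space M. K < \<bar>noise ?t \<omega>\<bar>} \<le> \<delta> / 2"
    using noise_tail[of ?t K] K by simp
  moreover have "prob (good k i) \<le> prob (good k (Suc i) \<union> {\<omega> \<in> space M. K < \<bar>noise ?t \<omega>\<bar>} \<union> ?F)"
  proof (rule finite_measure_mono)
    show "good k i \<subseteq> good k (Suc i) \<union> {\<omega> \<in> space M. K < \<bar>noise ?t \<omega>\<bar>} \<union> ?F"
      using sets.sets_into_space[OF good_sets[of k i]] by (auto simp: G_def)
  qed (intro sets.Un good_sets; measurable)
  moreover have "\<dots> \<le> prob (good k (Suc i)) + prob {\<omega> \<in> space M. K < \<bar>noise ?t \<omega>\<bar>} + prob ?F"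
  proof -
    have [measurable]: "good k (Suc i) \<in> sets M" by (rule good_sets)
    have "prob (good k (Suc i) \<union> {\<omega> \<in> space M. K < \<bar>noise ?t \<omega>\<bar>} \<union> ?F) \<le>
        prob (good k (Suc i) \<union> {\<omega> \<in> space M. K < \<bar>noise ?t \<omega>\<bar>}) + prob ?F"
      by (intro measure_Un_le) measurable
    moreover have "prob (good k (Suc i) \<union> {\<omega> \<in> space M. K < \<bar>noise ?t \<omega>\<bar>}) \<le>
        prob (good k (Suc i)) + prob {\<omega> \<in> space M. K < \<bar>noise ?t \<omega>\<bar>}"
      by (intro measure_Un_le) measurable
    ultimately show ?thesis by linarith
  qed
  ultimately show ?thesis using F by linarith
qed

lemma epoch_prob:
  assumes "i \<le> N k" "real i * exp (- L) \<le> 1"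
  shows "prob (start_good k) - \<delta> * real i \<le> prob (good k i)"
  using assms
proof (induction i)
  case (Suc i)
  have "real i * exp (- L) \<le> 1"
    by (rule order_trans[OF mult_right_mono Suc(3)]) simp_all
  then have "prob (start_good k) - \<delta> * real i \<le> prob (good k i)" using Suc by linarith
  moreover have "prob (good k i) - \<delta> \<le> prob (good k (Suc i))" using Suc by (intro good_step_prob) auto
  ultimately show ?case by (simp add: algebra_simps)
qed simp

text \<open>Failure probabilities add up, one \<delta> per step; the leading 1 pays for the
  certificate of the starting point.\<close>

lemma start_prob:
  assumes "real (S k) * exp (- L) \<le> 1"
  shows "1 - \<delta> * real (1 + S k) \<le> prob (start_good k)"
  using assms
proof (induction k)
  case 0
  have "1 - \<delta> \<le> prob {\<omega> \<in> space M. 1 / sqrt (real d) \<le> alignment d \<theta>s (n0 + 1) \<omega>}"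
    by (rule init_certified)
  also have "\<dots> \<le> prob (start_good 0)"
    using a_0 by (intro finite_measure_mono) auto
  finally show ?case by (simp add: S_0)
next
  case (Suc k)
  have "real (S k) * exp (- L) \<le> 1" "real (N k) * exp (- L) \<le> 1"
    by (rule order_trans[OF mult_right_mono Suc(2)]; simp add: S_Suc)+
  then have "1 - \<delta> * real (1 + S k) \<le> prob (start_good k)"
    "prob (start_good k) - \<delta> * real (N k) \<le> prob (start_good (Suc k))"
    using Suc epoch_prob[of "N k" k] by auto
  then show ?case by (simp add: S_Suc algebra_simps)
qed

lemma good_prob:
  assumes "i \<le> N k" "real (S k + i) * exp (- L) \<le> 1"
  shows "1 - \<delta> * real (1 + S k + i) \<le> prob (good k i)"
proof -
  have "real (S k) * exp (- L) \<le> 1" "real i * exp (- L) \<le> 1"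
    by (rule order_trans[OF mult_right_mono assms(2)]; simp)+
  then have "1 - \<delta> * real (1 + S k) \<le> prob (start_good k)"
    "prob (start_good k) - \<delta> * real i \<le> prob (good k i)"
    using assms start_prob[of k] epoch_prob[of i k] by auto
  then show ?thesis by (simp add: algebra_simps)
qed

text \<open>The form in which the barrier argument is used outside: one event on which the lower
  bounds hold for all steps of completed epochs and for the first \<open>i\<close> steps of the
  current one.\<close>

lemma alignment_with_high_prob:
  assumes "i \<le> N k" "real (S k + i) * exp (- L) \<le> 1"
  obtains G where "G \<in> sets M" "1 - \<delta> * real (1 + S k + i) \<le> prob G"
    "\<And>\<omega> j i'. \<omega> \<in> G \<Longrightarrow> j < k \<and> i' \<le> N j \<or> j = k \<and> i' \<le> i \<Longrightarrow>
      a j - g j \<le> alignment d \<theta>s (n0 + Suc (S j + i')) \<omega>"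
    "\<And>\<omega>. \<omega> \<in> G \<Longrightarrow> a k \<le> alignment d \<theta>s (n0 + Suc (S k)) \<omega>"
proof
  show "good k i \<in> sets M" by (rule good_sets)
  show "1 - \<delta> * real (1 + S k + i) \<le> prob (good k i)" by (rule good_prob[OF assms])
  show "a j - g j \<le> alignment d \<theta>s (n0 + Suc (S j + i')) \<omega>"
    if "\<omega> \<in> good k i" "j < k \<and> i' \<le> N j \<or> j = k \<and> i' \<le> i" for \<omega> j i'
    using good_alignment_before[OF that assms(1)] .
  show "a k \<le> alignment d \<theta>s (n0 + Suc (S k)) \<omega>" if "\<omega> \<in> good k i" for \<omega>
    using that start_good_alignment[of \<omega> k] epoch_good_antimono[of 0 i "start_good k" k] by auto
qed

end

end

section \<open>The schedule\<close>

text \<open>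
  \<open>\<phi>\<close> is a lower bound for \<open>f'\<close> that drives the schedule: \<open>f'\<close> itself if \<open>f\<close> is convex, and a constant
  if \<open>f'\<close> is bounded from below.
\<close>

locale rate_profile =
  fixes \<gamma>0 \<gamma>1 \<gamma>2 q0 :: real and d :: nat and f \<phi> :: "real \<Rightarrow> real"
  assumes \<gamma>0: "0 < \<gamma>0" "\<gamma>0 \<le> 1 / 10" and \<gamma>1: "0 < \<gamma>1" and \<gamma>2: "0 < \<gamma>2" and q0: "0 < q0"
    and d: "2 \<le> d"
    and \<phi>_mono: "\<And>x y. 0 < x \<Longrightarrow> x \<le> y \<Longrightarrow> y < 1 \<Longrightarrow> \<phi> x \<le> \<phi> y"
    and \<phi>_pos: "\<And>x. 1 / (2 * sqrt (real d)) < x \<Longrightarrow> x < 1 \<Longrightarrow> 0 < \<phi> x"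
    and \<phi>_nonneg: "\<And>x. 0 < x \<Longrightarrow> x < 1 \<Longrightarrow> 0 \<le> \<phi> x"
    and \<phi>_le: "\<And>x. 0 < x \<Longrightarrow> x < 1 \<Longrightarrow> \<phi> x \<le> \<gamma>2"
    and \<phi>_tangent: "\<And>x u. 0 < x \<Longrightarrow> x < 1 \<Longrightarrow> 0 \<le> u \<Longrightarrow> x + u \<le> 1 \<Longrightarrow> f x + \<phi> x * u \<le> f (x + u)"
    and \<phi>_end: "\<And>x. 1 - \<gamma>0 \<le> x \<Longrightarrow> x < 1 \<Longrightarrow> q0 \<le> \<phi> x"
begin

text \<open>The cosine between iterate and action. It is so close to 1 that the derivative in the
  update, taken at this point, lies between \<gamma>1 and \<gamma>2, and that for levels above
  \<open>1 - \<gamma>0 / 2\<close> the contracted alignment stays in the linear zone.\<close>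

definition shrink :: real where "shrink = 1 - \<gamma>0 / 4"

definition explore :: real where "explore = sqrt (1 - shrink\<^sup>2)"

text \<open>A logistic recursion: the level grows by a constant factor while it is small, and its
  distance from 1 contracts by a constant factor afterwards.\<close>

primrec level :: "nat \<Rightarrow> real" where
  "level 0 = 1 / sqrt (real d)"
| "level (Suc k) = level k + level k * (1 - level k) / 16"

definition gap :: "nat \<Rightarrow> real" where "gap k = level k * (1 - level k) / 16"

text \<open>The argument is the leftmost point at which exploration is centred in the epoch: the
  alignment is at least \<open>level k - gap k\<close> and is contracted by \<open>shrink\<close>.
  As \<phi> is monotone, the value serves the whole window.\<close>

definition slope :: "nat \<Rightarrow> real" where "slope k = \<phi> (shrink * (level k - gap k))"

text \<open>The first entry controls the normalization loss and the fluctuation relative to the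
  drift; the second bounds a single step by the gap and the exponent of the tilt by
  \<open>1 / 4\<close>.\<close>

definition \<kappa> :: real where "\<kappa> = min (1 / (60 * \<gamma>2)) (1 / (12 * \<gamma>2\<^sup>2))"

definition step_size :: "real \<Rightarrow> nat \<Rightarrow> real" where
  "step_size L k = \<kappa> / L * slope k * gap k / (real d * (level k)\<^sup>2)"

text \<open>Half of the guaranteed drift per step; the other half pays for normalization. The factor
  \<open>11 * gap k / level k\<close> bounds the distance of the upper end of the window from 1, and
  \<gamma>1 stands in for the derivative of \<open>f\<close> at \<open>shrink\<close>.\<close>

definition progress :: "real \<Rightarrow> nat \<Rightarrow> real" where
  "progress L k = step_size L k * \<gamma>1 * explore\<^sup>2 * slope k * (11 * gap k) / (24 * real d * level k)"

text \<open>Long enough for the barrier, which has to rise by \<open>2 * gap k\<close>, to climb no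
  faster than \<open>progress\<close>.\<close>

definition duration :: "real \<Rightarrow> nat \<Rightarrow> nat" where
  "duration L k = nat \<lceil>2 * gap k / progress L k\<rceil>"

definition start :: "real \<Rightarrow> nat \<Rightarrow> nat" where
  "start L k = (\<Sum>j<k. duration L j)"

lemma shrink: "39 / 40 \<le> shrink" "shrink < 1" "shrink \<le> 1"
  using \<gamma>0 by (auto simp: shrink_def)

lemma explore: "0 < explore" "explore \<le> 1"
  and explore_sq: "sqrt (1 - explore\<^sup>2) = shrink"
proof -
  have "shrink\<^sup>2 < 1" using shrink by (simp add: power_less_one_iff)
  then show "0 < explore" "explore \<le> 1" by (auto simp: explore_def)
  have "explore\<^sup>2 = 1 - shrink\<^sup>2" using \<open>shrink\<^sup>2 < 1\<close> by (simp add: explore_def)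
  then show "sqrt (1 - explore\<^sup>2) = shrink" using shrink by simp
qed

lemma \<kappa>: "0 < \<kappa>" "60 * \<kappa> * \<gamma>2 \<le> 1" "12 * \<kappa> * \<gamma>2\<^sup>2 \<le> 1"
proof -
  show "0 < \<kappa>" using \<gamma>2 by (simp add: \<kappa>_def)
  have "\<kappa> \<le> 1 / (60 * \<gamma>2)" "\<kappa> \<le> 1 / (12 * \<gamma>2\<^sup>2)" by (auto simp: \<kappa>_def)
  then show "60 * \<kappa> * \<gamma>2 \<le> 1" "12 * \<kappa> * \<gamma>2\<^sup>2 \<le> 1" using \<gamma>2 by (simp_all add: field_simps)
qed

lemma level_0: "0 < level 0" "level 0 \<le> 71 / 100"
proof -
  show "0 < level 0" using d by simp
  have "sqrt 2 \<le> sqrt (real d)" using d by simp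
  moreover have "100 / 71 \<le> sqrt 2" by (rule real_le_rsqrt) (simp add: power2_eq_square)
  ultimately have "100 / 71 \<le> sqrt (real d)" by linarith
  then show "level 0 \<le> 71 / 100" using d by (simp add: field_simps)
qed

lemma level: "0 < level k" "level k < 1"
proof -
  have "0 < level k \<and> level k < 1"
  proof (induction k)
    case 0
    then show ?case using level_0 by linarith
  next
    case (Suc k)
    then have l: "0 < level k" "level k < 1" by auto
    define p where "p = level k * (1 - level k)"
    have "0 < p" using l by (simp add: p_def)
    moreover have "p \<le> 1 - level k" unfolding p_def using l by (intro mult_left_le_one_le) auto
    ultimately have "0 < level (Suc k)" "level (Suc k) < 1"
      unfolding level.simps p_def[symmetric] using l by linarith+
    then show ?case ..
  qed
  then show "0 < level k" "level k < 1" by auto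
qed

lemma level_Suc: "level (Suc k) = level k + gap k"
  by (simp add: gap_def)

lemma gap: "0 < gap k" "gap k \<le> level k / 16" "gap k < 1" "gap k \<le> (1 - level k) / 16"
proof -
  show "0 < gap k" using level[of k] by (simp add: gap_def)
  show *: "gap k \<le> level k / 16" unfolding gap_def using level[of k] by (simp add: mult_left_le)
  show "gap k < 1" using * level[of k] by linarith
  show "gap k \<le> (1 - level k) / 16" unfolding gap_def using level[of k] by (simp add: mult_le_cancel_right1)
qed

lemma level_mono: "j \<le> k \<Longrightarrow> level j \<le> level k"
proof (induction k rule: dec_induct)
  case (step n)
  then show ?case using gap(1)[of n] unfolding level_Suc by linarith
qed simp

lemma level_ge: "1 / sqrt (real d) \<le> level k" "1 \<le> real d * (level k)\<^sup>2"
proof -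
  show *: "1 / sqrt (real d) \<le> level k" using level_mono[of 0 k] by simp
  have "(1 / sqrt (real d))\<^sup>2 \<le> (level k)\<^sup>2" using * by (intro power_mono) auto
  then show "1 \<le> real d * (level k)\<^sup>2" using d by (simp add: power_divide field_simps)
qed

text \<open>The lower limit of the integral is half of the initial level. Contraction and slack cost
  less than this factor, so \<phi> is always evaluated inside the range where it is
  positive.\<close>

lemma slope_arg: "9 / 10 * level k \<le> shrink * (level k - gap k)" "shrink * (level k - gap k) < 1"
  "1 / (2 * sqrt (real d)) < shrink * (level k - gap k)"
proof -
  have "39 / 40 * (15 / 16 * level k) \<le> shrink * (level k - gap k)"
    using shrink gap[of k] level[of k] by (intro mult_mono) auto
  then show *: "9 / 10 * level k \<le> shrink * (level k - gap k)" using level[of k] by simp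
  have "shrink * (level k - gap k) \<le> level k - gap k"
    using shrink gap[of k] level[of k] by (intro mult_left_le_one_le) auto
  also have "\<dots> < 1" using gap(1)[of k] level(2)[of k] by linarith
  finally show "shrink * (level k - gap k) < 1" .
  have "1 / (2 * sqrt (real d)) \<le> level k / 2" using level_ge(1)[of k] by simp
  then show "1 / (2 * sqrt (real d)) < shrink * (level k - gap k)" using * level[of k] by linarith
qed

lemma slope: "0 < slope k" "slope k \<le> \<gamma>2"
proof -
  show "0 < slope k" unfolding slope_def by (intro \<phi>_pos slope_arg)
  have "0 < shrink * (level k - gap k)" using slope_arg(1)[of k] level[of k] by linarith
  then show "slope k \<le> \<gamma>2" unfolding slope_def by (intro \<phi>_le slope_arg)
qed

lemma step_size_pos: "0 < L \<Longrightarrow> 0 < step_size L k"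
  using \<kappa> slope[of k] gap[of k] level[of k] d by (simp add: step_size_def)

lemma progress_pos: "0 < L \<Longrightarrow> 0 < progress L k"
  using step_size_pos[of L k] slope[of k] gap[of k] level[of k] d \<gamma>1 explore by (simp add: progress_def)

lemma duration: "0 < L \<Longrightarrow> 0 < duration L k" "0 < L \<Longrightarrow> 2 * gap k / real (duration L k) \<le> progress L k"
proof -
  assume L: "0 < L"
  have pos: "0 < 2 * gap k / progress L k" using progress_pos[OF L, of k] gap[of k] by simp
  then show *: "0 < duration L k" by (simp add: duration_def)
  have "2 * gap k / progress L k \<le> real (duration L k)" unfolding duration_def by (rule real_nat_ceiling_ge)
  then show "2 * gap k / real (duration L k) \<le> progress L k"
    using * progress_pos[OF L, of k] by (simp add: field_simps)
qed

section \<open>Admissibility of the step size\<close>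

context
  fixes L K D1 :: real
  assumes L: "1 \<le> L" and K: "0 \<le> K" "K\<^sup>2 = 2 * L" and D1: "\<gamma>1 \<le> D1" "D1 \<le> \<gamma>2"
begin

text \<open>\<open>D1\<close> stands for the derivative of \<open>f\<close> at the point \<open>shrink\<close>.\<close>

lemma radius_bound: "2 + K \<le> 4 * L" "(2 + K)\<^sup>2 \<le> 12 * L"
proof -
  have "K \<le> 2 * L"
  proof (rule power2_le_imp_le)
    have "1 * (2 * L) \<le> (2 * L) * (2 * L)" using L by (intro mult_right_mono) auto
    then show "K\<^sup>2 \<le> (2 * L)\<^sup>2" using K by (simp add: power2_eq_square)
  qed (use L in simp)
  then show "2 + K \<le> 4 * L" using L by simp
  \<comment> \<open>This amounts to \<open>(2 + K)\<^sup>2 \<le> 2 * (4 + K\<^sup>2)\<close>;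
    \<open>2 + K\<close> bounds the prediction error of a round with noise at most
    \<open>K\<close>.\<close>
  have "0 \<le> (K - 2)\<^sup>2" by simp
  then show "(2 + K)\<^sup>2 \<le> 12 * L" using K L by (simp add: power2_eq_square algebra_simps)
qed

lemma step_size_le_gap: "step_size L k \<le> \<kappa> / L * slope k * gap k"
proof -
  have "step_size L k \<le> (\<kappa> / L * slope k * gap k) / 1"
    unfolding step_size_def
    using level_ge(2)[of k] \<kappa> slope[of k] gap[of k] L by (intro divide_left_mono) auto
  then show ?thesis by simp
qed

lemma jump_le_gap: "step_size L k * D1 * explore * (2 + K) \<le> gap k"
proof -
  have "step_size L k * D1 * explore * (2 + K) \<le> (\<kappa> / L * slope k * gap k) * \<gamma>2 * 1 * (4 * L)"
    using step_size_le_gap[of k] step_size_pos[of L k] radius_bound explore D1 \<gamma>1 \<kappa> slope[of k] gap[of k] L K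
    by (intro mult_mono mult_nonneg_nonneg) auto
  also have "\<dots> = 4 * \<kappa> * slope k * gap k * \<gamma>2" using L by simp
  also have "\<dots> \<le> 4 * \<kappa> * \<gamma>2 * gap k * \<gamma>2"
    using \<kappa> slope[of k] gap[of k] \<gamma>2 by (intro mult_right_mono mult_left_mono) auto
  also have "\<dots> = (4 * \<kappa> * \<gamma>2\<^sup>2) * gap k" by (simp add: power2_eq_square)
  also have "\<dots> \<le> 1 * gap k" using \<kappa> gap[of k] by (intro mult_right_mono) auto
  finally show ?thesis by simp
qed

text \<open>The potential has exponent \<open>L / gap k\<close>. The step size carries
  \<open>gap k / L\<close> to cancel it, which leaves at most
  \<open>\<kappa> * slope k\<close>.\<close>

lemma tilt_small: "L / gap k * step_size L k * D1 * explore \<le> 1 / 4" "24 * (L / gap k * step_size L k * D1) \<le> slope k"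
proof -
  have "L / gap k * step_size L k \<le> L / gap k * (\<kappa> / L * slope k * gap k)"
    using step_size_le_gap[of k] L gap[of k] by (intro mult_left_mono) auto
  also have "\<dots> = \<kappa> * slope k" using L gap[of k] by simp
  finally have *: "L / gap k * step_size L k \<le> \<kappa> * slope k" .
  then have t: "L / gap k * step_size L k * D1 \<le> (\<kappa> * slope k) * \<gamma>2"
    using D1 \<gamma>1 \<kappa>(1) slope(1)[of k] by (intro mult_mono[OF *]) auto
  have "24 * ((\<kappa> * slope k) * \<gamma>2) = (24 * \<kappa> * \<gamma>2) * slope k" by simp
  also have "\<dots> \<le> 1 * slope k" using \<kappa> slope[of k] by (intro mult_right_mono) auto
  finally show "24 * (L / gap k * step_size L k * D1) \<le> slope k" using t by simp
  have "L / gap k * step_size L k * D1 * explore \<le> (L / gap k * step_size L k * D1) * 1"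
    using explore D1 \<gamma>1 L gap[of k] step_size_pos[of L k] by (intro mult_left_mono) auto
  also have "\<dots> \<le> (\<kappa> * slope k) * \<gamma>2" using t by simp
  also have "\<dots> \<le> (\<kappa> * \<gamma>2) * \<gamma>2" using slope[of k] \<kappa> \<gamma>2 by (intro mult_right_mono mult_left_mono) auto
  also have "\<dots> \<le> 1 / 4" using \<kappa>(3) by (simp add: power2_eq_square)
  finally show "L / gap k * step_size L k * D1 * explore \<le> 1 / 4" .
qed

text \<open>The drift is cut in two halves, one for the barrier and one for normalization. With
  \<open>a * (1 - a) = 16 * g\<close> and \<open>g \<le> (1 - a) / 16\<close>, the distance
  \<open>1 - (a + 5 * g)\<close> is at least \<open>11 / 16 * (1 - a) = 11 * g / a\<close>, the
  source of the 11.\<close>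

lemma progress_gain:
  "progress L k + (level k + 5 * gap k) * (step_size L k * D1 * explore * (2 + K))\<^sup>2 \<le>
    step_size L k * D1 * explore\<^sup>2 * slope k * (1 - (level k + 5 * gap k)) / (12 * real d)"
proof -
  define H where "H = step_size L k"
  have H0: "0 < H" using step_size_pos[of L k] L by (simp add: H_def)
  have D0: "0 < D1" using D1 \<gamma>1 by simp
  let ?half = "H * D1 * explore\<^sup>2 * slope k * (11 * gap k) / (24 * real d * level k)"
  have pr: "progress L k \<le> ?half"
    unfolding progress_def H_def[symmetric]
    using H0 D1 \<gamma>1 explore slope[of k] gap[of k] level[of k]
    by (intro divide_right_mono mult_right_mono mult_left_mono) auto
  have "(level k + 5 * gap k) * (H * D1 * explore * (2 + K))\<^sup>2
      = (level k + 5 * gap k) * (H * D1 * explore)\<^sup>2 * (2 + K)\<^sup>2"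
    by (simp add: power_mult_distrib)
  also have "\<dots> \<le> (2 * level k) * (H * D1 * explore)\<^sup>2 * (12 * L)"
    using radius_bound gap[of k] level[of k] by (intro mult_mono) auto
  also have "\<dots> = (H * D1 * explore\<^sup>2) * (24 * level k * D1 * (H * L))"
    by (simp add: power2_eq_square)
  also have "\<dots> \<le> (H * D1 * explore\<^sup>2) * (slope k * (11 * gap k) / (24 * real d * level k))"
  proof (intro mult_left_mono)
    have "H * L = \<kappa> * slope k * gap k / (real d * (level k)\<^sup>2)"
      unfolding H_def step_size_def using L by simp
    then have "24 * level k * D1 * (H * L) = (24 * \<kappa> * D1) * (slope k * gap k / (real d * level k))"
      using level[of k] by (simp add: power2_eq_square)
    also have "\<dots> \<le> (11 / 24) * (slope k * gap k / (real d * level k))"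
    proof (intro mult_right_mono)
      have "24 * \<kappa> * D1 \<le> 24 * \<kappa> * \<gamma>2" using \<kappa> D1 by (intro mult_left_mono) auto
      then show "24 * \<kappa> * D1 \<le> 11 / 24" using \<kappa>(2) by linarith
    qed (use slope[of k] gap[of k] level[of k] in auto)
    also have "\<dots> = slope k * (11 * gap k) / (24 * real d * level k)" by simp
    finally show "24 * level k * D1 * (H * L) \<le> slope k * (11 * gap k) / (24 * real d * level k)" .
  qed (use H0 D0 in auto)
  also have "\<dots> = ?half" by simp
  finally have sh: "(level k + 5 * gap k) * (H * D1 * explore * (2 + K))\<^sup>2 \<le> ?half" .
  have "11 * gap k / level k \<le> 1 - (level k + 5 * gap k)"
  proof -
    have "11 * gap k / level k = 11 / 16 * (1 - level k)" using level[of k] by (simp add: gap_def)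
    moreover have "gap k \<le> (1 - level k) / 16" by (rule gap)
    ultimately show ?thesis by simp
  qed
  then have "H * D1 * explore\<^sup>2 * slope k * (11 * gap k / level k) / (12 * real d) \<le>
      H * D1 * explore\<^sup>2 * slope k * (1 - (level k + 5 * gap k)) / (12 * real d)"
    using H0 D0 slope[of k] by (intro divide_right_mono mult_left_mono) auto
  moreover have "H * D1 * explore\<^sup>2 * slope k * (11 * gap k / level k) / (12 * real d) = ?half + ?half"
    using d level[of k] by (simp add: field_simps)
  ultimately show ?thesis unfolding H_def[symmetric] using pr sh by linarith
qed

end

text \<open>The length of an epoch up to \<open>L * (real d)\<^sup>2\<close> and constants. As
  \<open>level k * (1 - level k)\<close> is 16 times the spacing of the levels, the sum resembles a
  Riemann sum of \<open>m / (\<phi>\<^sup>2 * (1 - m)\<^sup>2)\<close>: the burn-in integrand away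
  from 1, and \<open>1 / (1 - m)\<close> after integration near 1.\<close>

definition work :: "nat \<Rightarrow> real" where
  "work k = (level k)\<^sup>2 / ((slope k)\<^sup>2 * (1 - level k))"

text \<open>The unit added by rounding up is absorbed through
  \<open>1 \<le> \<gamma>2\<^sup>2 * W\<close>, which explains the second summand of the constant;
  70 is \<open>768 / 11\<close> rounded up.\<close>

lemma duration_le:
  assumes L: "1 \<le> L"
  shows "real (duration L k) \<le> (70 / (\<kappa> * \<gamma>1 * explore\<^sup>2) + \<gamma>2\<^sup>2) * (L * (real d)\<^sup>2 * work k)"
proof -
  define W where "W = L * (real d)\<^sup>2 * work k"
  have pos: "0 < 1 - level k" using level[of k] by simp
  have "1 * 1 * 1 \<le> L * (real d * (real d * (level k)\<^sup>2)) * (\<gamma>2\<^sup>2 / ((slope k)\<^sup>2 * (1 - level k)))"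
  proof (intro mult_mono)
    show "1 \<le> real d * (real d * (level k)\<^sup>2)"
      using mult_mono[of 1 "real d" 1 "real d * (level k)\<^sup>2"] level_ge(2)[of k] d by simp
    have "(slope k)\<^sup>2 * (1 - level k) \<le> \<gamma>2\<^sup>2 * 1"
      using slope[of k] level[of k] by (intro mult_mono power_mono) auto
    then show "1 \<le> \<gamma>2\<^sup>2 / ((slope k)\<^sup>2 * (1 - level k))" using slope[of k] pos by simp
  qed (use L slope[of k] pos in auto)
  also have "\<dots> = \<gamma>2\<^sup>2 * W" by (simp add: W_def work_def power2_eq_square)
  finally have one: "1 \<le> \<gamma>2\<^sup>2 * W" by simp
  have alg: "2 * g / (\<kappa> / L * q * g / (D * a\<^sup>2) * \<gamma>1 * e * q * (11 * g) / (24 * D * a)) =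
      (768 / 11) / (\<kappa> * \<gamma>1 * e) * (L * D\<^sup>2 * (a\<^sup>2 / (q\<^sup>2 * u)))"
    if "a * u = 16 * g" "0 < g" "0 < q" "0 < D" "0 < a" "0 < e" "0 < u" for g q D a e u
  proof -
    have "2 * g / (\<kappa> / L * q * g / (D * a\<^sup>2) * \<gamma>1 * e * q * (11 * g) / (24 * D * a)) =
        (48 / 11) / (\<kappa> * \<gamma>1 * e) * (L * D\<^sup>2 * (a\<^sup>2 / q\<^sup>2)) * (a / g)"
      using that \<kappa>(1) \<gamma>1 L by (simp add: field_simps power2_eq_square)
    also have "a / g = 16 / u" using that by (simp add: field_simps)
    finally show ?thesis by simp
  qed
  have "2 * gap k / progress L k = (768 / 11) / (\<kappa> * \<gamma>1 * explore\<^sup>2) * W"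
    unfolding progress_def step_size_def W_def work_def
    using gap(1)[of k] level[of k] slope[of k] d explore
    by (intro alg) (auto simp: gap_def)
  also have "\<dots> \<le> 70 / (\<kappa> * \<gamma>1 * explore\<^sup>2) * W"
    using \<kappa>(1) \<gamma>1 L pos by (intro mult_right_mono divide_right_mono) (auto simp: W_def work_def)
  finally have "2 * gap k / progress L k \<le> 70 / (\<kappa> * \<gamma>1 * explore\<^sup>2) * W" .
  moreover have "real (duration L k) \<le> 2 * gap k / progress L k + 1"
  proof -
    have "0 < 2 * gap k / progress L k" using progress_pos[of L k] gap[of k] L by simp
    then show ?thesis unfolding duration_def by linarith
  qed
  ultimately have "real (duration L k) \<le> 70 / (\<kappa> * \<gamma>1 * explore\<^sup>2) * W + \<gamma>2\<^sup>2 * W" using one by linarith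
  then show ?thesis unfolding W_def by (simp add: algebra_simps)
qed

end

section \<open>Total duration against the integral of the profile\<close>

context rate_profile
begin

definition profile_cost :: ennreal where
  "profile_cost = (\<integral>\<^sup>+m\<in>{1 / (2 * sqrt (real d))..1 - \<gamma>0 / 2}. ennreal m / ennreal ((\<phi> m)\<^sup>2) \<partial>lborel)"

text \<open>The levels are sampled at the points where \<open>\<phi>\<close> is evaluated; these cut the range of the integral.\<close>

primrec knot :: "nat \<Rightarrow> real" where
  "knot 0 = 1 / (2 * sqrt (real d))"
| "knot (Suc j) = shrink * (level j - gap j)"

lemma knot_pos: "0 < knot j"
proof (cases j)
  case 0
  then show ?thesis using d by simp
next
  case (Suc i)
  then show ?thesis using slope_arg(1)[of i] level[of i] by simp
qed

lemma knot_ge: "level j / 2 \<le> knot j"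
proof (cases j)
  case 0
  then show ?thesis by simp
next
  case (Suc i)
  have "level j \<le> 17 / 16 * level i" using gap(2)[of i] by (simp add: Suc level_Suc del: level.simps)
  then show ?thesis using slope_arg(1)[of i] level[of i] by (simp add: Suc del: level.simps)
qed

text \<open>Knots inherit the spacing of the levels, which is proportional to the level as long as
  the level keeps away from 1. The first knot lies at half of the initial level and is treated
  separately.\<close>

lemma knot_step:
  assumes "level j \<le> 1 - \<gamma>0 / 2"
  shows "\<gamma>0 / 40 * level j \<le> knot (Suc j) - knot j"
proof (cases j)
  case 0
  have "\<gamma>0 / 40 * level 0 \<le> 1 / 400 * level 0"
    using \<gamma>0 level_0 by (intro mult_right_mono) auto
  moreover have "knot 0 = level 0 / 2" by simp
  ultimately show ?thesis using slope_arg(1)[of 0] level_0 unfolding 0 knot.simps(2) by linarith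
next
  case (Suc i)
  have a: "level j = level i + gap i" by (simp add: Suc level_Suc del: level.simps)
  have g: "gap j \<le> gap i + gap i / 16"
  proof -
    have "level j * (1 - level j) \<le> level j * (1 - level i)"
      using gap(1)[of i] level[of j] a by (intro mult_left_mono) auto
    also have "\<dots> = level i * (1 - level i) + gap i * (1 - level i)" by (simp add: a algebra_simps)
    also have "\<dots> \<le> level i * (1 - level i) + gap i * 1"
      using gap(1)[of i] level[of i] by (intro add_left_mono mult_left_mono) auto
    finally show ?thesis by (simp add: gap_def)
  qed
  have "39 / 40 * (15 / 16 * gap i) \<le> shrink * (gap i - (gap j - gap i))"
    using g gap(1)[of i] shrink by (intro mult_mono) auto
  also have "\<dots> = knot (Suc j) - knot j" by (simp add: Suc a[unfolded Suc] algebra_simps del: level.simps)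
  finally have k: "9 / 10 * gap i \<le> knot (Suc j) - knot j" using gap(1)[of i] by simp
  have "16 / 17 * level j \<le> level i" using gap(2)[of i] a by simp
  moreover have "\<gamma>0 / 2 \<le> 1 - level i" using assms a gap(1)[of i] by simp
  ultimately have "16 / 17 * level j * (\<gamma>0 / 2) \<le> level i * (1 - level i)"
    using \<gamma>0 level[of i] by (intro mult_mono) auto
  then have "16 / 17 * level j * (\<gamma>0 / 2) / 16 \<le> gap i" by (simp add: gap_def)
  moreover have "0 < level j * \<gamma>0" using \<gamma>0 level[of j] by simp
  ultimately show ?thesis using k by (simp add: field_simps)
qed

text \<open>A zero of \<phi> is allowed: a positive number divided by zero is \<infinity> in
  \<open>ennreal\<close>, in line with the convention for the integrand.\<close>

lemma ennreal_divide_lower: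
  assumes "0 < x" "x \<le> m" "0 \<le> p" "p \<le> q" "0 < q"
  shows "ennreal (x / q\<^sup>2) \<le> ennreal m / ennreal (p\<^sup>2)"
proof (cases "p = 0")
  case True
  then show ?thesis using assms by simp
next
  case False
  then have p: "0 < p" using assms by simp
  have "p\<^sup>2 \<le> q\<^sup>2" using assms by (intro power_mono) auto
  then have "x / q\<^sup>2 \<le> m / p\<^sup>2" using assms p by (intro frac_le) auto
  then show ?thesis using assms p by (simp add: divide_ennreal ennreal_leI)
qed

lemma profile_cost_lower:
  assumes "1 / (2 * sqrt (real d)) \<le> u" "u \<le> v" "v \<le> 1 - \<gamma>0 / 2" "0 < x" "x \<le> u" "0 < q"
    "\<And>m. u \<le> m \<Longrightarrow> m \<le> v \<Longrightarrow> \<phi> m \<le> q"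
  shows "ennreal (x / q\<^sup>2 * (v - u)) \<le> profile_cost"
proof -
  have "ennreal (x / q\<^sup>2 * (v - u)) = ennreal (x / q\<^sup>2) * emeasure lborel {u..v}"
    using assms by (simp add: ennreal_mult[symmetric])
  also have "\<dots> = (\<integral>\<^sup>+m. ennreal (x / q\<^sup>2) * indicator {u..v} m \<partial>lborel)"
    by (rule nn_integral_cmult_indicator[symmetric]) simp
  also have "\<dots> \<le> profile_cost" unfolding profile_cost_def
  proof (rule nn_integral_mono)
    fix m
    show "ennreal (x / q\<^sup>2) * indicator {u..v} m \<le>
        ennreal m / ennreal ((\<phi> m)\<^sup>2) * indicator {1 / (2 * sqrt (real d))..1 - \<gamma>0 / 2} m"
    proof (cases "m \<in> {u..v}")
      case True
      have "ennreal (x / q\<^sup>2) \<le> ennreal m / ennreal ((\<phi> m)\<^sup>2)"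
        using True assms \<gamma>0 by (intro ennreal_divide_lower \<phi>_nonneg) auto
      then show ?thesis using True assms by (simp add: indicator_def)
    qed simp
  qed
  finally show ?thesis .
qed

text \<open>The stretch from \<open>1 - \<gamma>0\<close> to \<open>1 - \<gamma>0 / 2\<close>
  contributes a constant. Every bare \<open>(real d)\<^sup>2\<close> can therefore be charged to
  \<open>(real d)\<^sup>2 * B\<close>.\<close>

lemma profile_cost_ge_const: "ennreal (9 * \<gamma>0 / (20 * \<gamma>2\<^sup>2)) \<le> profile_cost"
proof -
  have "ennreal (9 / 10 / \<gamma>2\<^sup>2 * ((1 - \<gamma>0 / 2) - (1 - \<gamma>0))) \<le> profile_cost"
  proof (rule profile_cost_lower)
    have "1 / (2 * sqrt (real d)) = level 0 / 2" by simp
    then show "1 / (2 * sqrt (real d)) \<le> 1 - \<gamma>0" using level_0 \<gamma>0 by linarith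
  qed (use \<gamma>0 \<gamma>2 \<phi>_le in auto)
  then show ?thesis by (simp add: field_simps)
qed

text \<open>Initialization costs no more than the burn-in. With
  \<open>b = 1 / sqrt (real d)\<close>, tangents at points of \<open>{b / 2..3 * b / 4}\<close> show
  \<phi> to be at most \<open>4 * G / b\<close> there, so this interval alone contributes at least
  \<open>1 / (128 * (real d)\<^sup>2 * G\<^sup>2)\<close> to the integral.\<close>

lemma init_gap_bound:
  assumes f0: "mono_on {-1..1} f" and B: "profile_cost = ennreal B" "0 \<le> B"
  shows "f 0 < f (1 / sqrt (real d))" "1 / (f (1 / sqrt (real d)) - f 0)\<^sup>2 \<le> 128 * (real d)\<^sup>2 * B"
proof -
  define b where "b = 1 / sqrt (real d)"
  have b: "0 < b" "b < 3 / 4" "b\<^sup>2 = 1 / real d"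
    using level_0 d by (auto simp: b_def power_divide)
  have b2: "1 / (2 * sqrt (real d)) = b / 2" by (simp add: b_def)
  define G where "G = f b - f 0"
  have tan: "\<phi> x * (b / 4) \<le> G" if "b / 2 \<le> x" "x \<le> 3 * b / 4" for x
  proof -
    have "f x + \<phi> x * (b - x) \<le> f (x + (b - x))" using that b by (intro \<phi>_tangent) auto
    moreover have "f 0 \<le> f x" using that b by (intro mono_onD[OF f0]) auto
    moreover have "\<phi> x * (b / 4) \<le> \<phi> x * (b - x)" using that b by (intro mult_left_mono \<phi>_nonneg) auto
    ultimately show ?thesis by (simp add: G_def)
  qed
  have "0 < \<phi> (3 * b / 4)" using b by (intro \<phi>_pos) (auto simp: b2)
  then have "0 < \<phi> (3 * b / 4) * (b / 4)" using b by simp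
  also have "\<dots> \<le> G" using b by (intro tan) auto
  finally have G: "0 < G" .
  then show "f 0 < f (1 / sqrt (real d))" by (simp add: G_def b_def)
  have "ennreal ((b / 2) / (4 * G / b)\<^sup>2 * (3 * b / 4 - b / 2)) \<le> profile_cost"
  proof (rule profile_cost_lower)
    show "\<phi> m \<le> 4 * G / b" if "b / 2 \<le> m" "m \<le> 3 * b / 4" for m
      using tan[OF that] b by (simp add: field_simps)
  qed (use b b2 G \<gamma>0 in auto)
  then have "(b / 2) / (4 * G / b)\<^sup>2 * (3 * b / 4 - b / 2) \<le> B" using B by simp
  moreover have "(b / 2) / (4 * G / b)\<^sup>2 * (3 * b / 4 - b / 2) = (b\<^sup>2)\<^sup>2 / (128 * G\<^sup>2)"
    using b G by (simp add: field_simps power2_eq_square)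
  ultimately have "1 / (128 * (real d)\<^sup>2 * G\<^sup>2) \<le> B" using b by (simp add: power_divide)
  then show "1 / (f (1 / sqrt (real d)) - f 0)\<^sup>2 \<le> 128 * (real d)\<^sup>2 * B"
    using G d by (simp add: G_def[symmetric] b_def[symmetric] field_simps)
qed

text \<open>A Riemann sum from below: \<open>slope j\<close> is \<phi> at the right end
  \<open>knot (Suc j)\<close>, so by monotonicity the integrand between the knots is at least
  \<open>knot j / (slope j)\<^sup>2\<close>. Knots and spacings are both at least proportional to
  the level, which gives the square.\<close>

lemma sum_work_le_profile_cost:
  assumes n: "\<And>j. j < n \<Longrightarrow> level j \<le> 1 - \<gamma>0 / 2"
  shows "ennreal (\<gamma>0 / 80 * (\<Sum>j<n. (level j / slope j)\<^sup>2)) \<le> profile_cost"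
proof -
  define w where "w j = knot j / (slope j)\<^sup>2" for j
  have w0: "0 \<le> w j" for j using knot_pos[of j] by (simp add: w_def)
  define F where "F m = ennreal m / ennreal ((\<phi> m)\<^sup>2)" for m
  have knot_le: "knot j \<le> knot (Suc j)" "knot (Suc j) \<le> 1 - \<gamma>0 / 2" if "j < n" for j
  proof -
    have "0 \<le> \<gamma>0 / 40 * level j" using \<gamma>0 level[of j] by simp
    then show "knot j \<le> knot (Suc j)" using knot_step[OF n[OF that]] by linarith
    have "shrink * (level j - gap j) \<le> level j - gap j"
      using shrink gap[of j] level[of j] by (intro mult_left_le_one_le) auto
    then show "knot (Suc j) \<le> 1 - \<gamma>0 / 2" using n[OF that] gap(1)[of j] unfolding knot.simps by linarith
  qed
  \<comment> \<open>The half-open intervals are disjoint, so at most one summand survives at each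
    point.\<close>
  have step: "(\<Sum>j<i. ennreal (w j) * indicator {knot j<..knot (Suc j)} m) \<le> F m * indicator {knot 0..knot i} m"
    if "i \<le> n" for i m
    using that
  proof (induction i)
    case (Suc i)
    have le: "knot i \<le> knot (Suc i)" "knot (Suc i) \<le> 1 - \<gamma>0 / 2" using knot_le[of i] Suc by auto
    have k0: "knot 0 \<le> knot i" using Suc(2)
    proof (induction i)
      case (Suc i)
      then show ?case using knot_le(1)[of i] by auto
    qed simp
    show ?case
    proof (cases "m \<in> {knot i<..knot (Suc i)}")
      case True
      then have "(\<Sum>j<i. ennreal (w j) * indicator {knot j<..knot (Suc j)} m) = 0"
        using Suc by simp
      moreover have "ennreal (w i) \<le> F m"
      proof -
        have m: "0 < m" "m < 1" using True knot_pos[of i] le \<gamma>0 by auto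
        have "\<phi> m \<le> slope i" unfolding slope_def using True m slope_arg[of i] by (intro \<phi>_mono) auto
        then show ?thesis unfolding F_def w_def
          using True m knot_pos[of i] slope[of i] by (intro ennreal_divide_lower \<phi>_nonneg) auto
      qed
      ultimately show ?thesis using True k0 by (simp add: indicator_def)
    next
      case False
      then have "(\<Sum>j<Suc i. ennreal (w j) * indicator {knot j<..knot (Suc j)} m) \<le> F m * indicator {knot 0..knot i} m"
        using Suc by simp
      also have "\<dots> \<le> F m * indicator {knot 0..knot (Suc i)} m"
        using le by (intro mult_left_mono) (auto simp: indicator_def)
      finally show ?thesis .
    qed
  qed simp
  have "ennreal (\<gamma>0 / 80 * (\<Sum>j<n. (level j / slope j)\<^sup>2)) \<le> ennreal (\<Sum>j<n. w j * (knot (Suc j) - knot j))"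
    unfolding sum_distrib_left
  proof (intro ennreal_leI sum_mono)
    fix j assume "j \<in> {..<n}"
    then have "level j / 2 * (\<gamma>0 / 40 * level j) \<le> knot j * (knot (Suc j) - knot j)"
      using knot_ge[of j] knot_step[of j] n[of j] \<gamma>0 level[of j] knot_pos[of j] by (intro mult_mono) auto
    then have "level j / 2 * (\<gamma>0 / 40 * level j) / (slope j)\<^sup>2 \<le> knot j * (knot (Suc j) - knot j) / (slope j)\<^sup>2"
      by (intro divide_right_mono) auto
    then show "\<gamma>0 / 80 * (level j / slope j)\<^sup>2 \<le> w j * (knot (Suc j) - knot j)"
      by (simp add: w_def power_divide power2_eq_square field_simps del: knot.simps)
  qed
  also have "\<dots> = (\<Sum>j<n. ennreal (w j) * emeasure lborel {knot j<..knot (Suc j)})"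
    using w0 knot_le by (subst sum_ennreal[symmetric]) (auto simp: ennreal_mult intro!: sum.cong mult_nonneg_nonneg simp del: knot.simps)
  also have "\<dots> = (\<Sum>j<n. \<integral>\<^sup>+m. ennreal (w j) * indicator {knot j<..knot (Suc j)} m \<partial>lborel)"
    by (intro sum.cong refl nn_integral_cmult_indicator[symmetric]) simp
  also have "\<dots> = (\<integral>\<^sup>+m. (\<Sum>j<n. ennreal (w j) * indicator {knot j<..knot (Suc j)} m) \<partial>lborel)"
    by (intro nn_integral_sum[symmetric]) simp
  also have "\<dots> \<le> (\<integral>\<^sup>+m. F m * indicator {1 / (2 * sqrt (real d))..1 - \<gamma>0 / 2} m \<partial>lborel)"
  proof (rule nn_integral_mono)
    fix m
    have kn: "knot n \<le> 1 - \<gamma>0 / 2"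
    proof (cases n)
      case 0
      have "knot n = level 0 / 2" by (simp add: 0)
      then show ?thesis using level_0 \<gamma>0 by linarith
    next
      case (Suc i)
      then show ?thesis using knot_le(2)[of i] by (simp del: knot.simps)
    qed
    have "(\<Sum>j<n. ennreal (w j) * indicator {knot j<..knot (Suc j)} m) \<le> F m * indicator {knot 0..knot n} m"
      by (rule step) simp
    also have "\<dots> \<le> F m * indicator {1 / (2 * sqrt (real d))..1 - \<gamma>0 / 2} m"
      using kn by (intro mult_left_mono) (auto simp: indicator_def)
    finally show "(\<Sum>j<n. ennreal (w j) * indicator {knot j<..knot (Suc j)} m) \<le>
        F m * indicator {1 / (2 * sqrt (real d))..1 - \<gamma>0 / 2} m" .
  qed
  finally show ?thesis by (simp add: profile_cost_def F_def)
qed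

text \<open>Levels up to \<open>1 - \<gamma>0 / 2\<close> have
  \<open>1 / (1 - level j) \<le> 2 / \<gamma>0\<close> and are charged to the integral. Beyond, the
  slope is at least \<open>q0\<close> and the bounds \<open>1 / (q0\<^sup>2 * (1 - level j))\<close>
  grow geometrically, so the last one dominates.\<close>

lemma start_le:
  assumes L: "1 \<le> L" and B: "profile_cost = ennreal B" "0 \<le> B"
  shows "real (start L (Suc k)) \<le> (70 / (\<kappa> * \<gamma>1 * explore\<^sup>2) + \<gamma>2\<^sup>2) * (L * (real d)\<^sup>2) *
    (160 / \<gamma>0\<^sup>2 * B + 20 / q0\<^sup>2 / (1 - level k))"
proof -
  define D where "D = 70 / (\<kappa> * \<gamma>1 * explore\<^sup>2) + \<gamma>2\<^sup>2"
  have D: "0 < D" unfolding D_def using \<kappa>(1) \<gamma>1 explore \<gamma>2 by (intro add_pos_pos) auto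
  define early where "early n = (\<Sum>j<n. if level j \<le> 1 - \<gamma>0 / 2 then (level j / slope j)\<^sup>2 else 0)" for n
  have early: "early n \<le> 80 / \<gamma>0 * B" for n
  proof (induction n)
    case 0
    then show ?case using \<gamma>0 B by (simp add: early_def)
  next
    case (Suc n)
    show ?case
    proof (cases "level n \<le> 1 - \<gamma>0 / 2")
      case True
      then have le: "level j \<le> 1 - \<gamma>0 / 2" if "j < Suc n" for j
        using level_mono[of j n] that by auto
      then have "early (Suc n) = (\<Sum>j<Suc n. (level j / slope j)\<^sup>2)"
        unfolding early_def by (intro sum.cong) auto
      moreover have "ennreal (\<gamma>0 / 80 * (\<Sum>j<Suc n. (level j / slope j)\<^sup>2)) \<le> ennreal B"
        using sum_work_le_profile_cost[of "Suc n"] le unfolding B(1) by blast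
      ultimately show ?thesis using B(2) \<gamma>0 by (simp add: field_simps)
    next
      case False
      then show ?thesis using Suc by (simp add: early_def)
    qed
  qed
  have u: "0 < 1 - level k" for k using level[of k] by simp
  have "(\<Sum>j<Suc k. work j) \<le> 2 / \<gamma>0 * early (Suc k) + 20 / q0\<^sup>2 / (1 - level k)"
  proof (induction k)
    case 0
    have "level 0 \<le> 1 - \<gamma>0 / 2" using level_0 \<gamma>0 by linarith
    then have "early (Suc 0) = (level 0 / slope 0)\<^sup>2" by (simp add: early_def)
    moreover have "work 0 = (level 0 / slope 0)\<^sup>2 * (1 / (1 - level 0))"
      by (simp add: work_def power_divide del: level.simps)
    moreover have "1 / (1 - level 0) \<le> 2 / \<gamma>0" using \<open>level 0 \<le> 1 - \<gamma>0 / 2\<close> u[of 0] \<gamma>0 by (simp add: field_simps)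
    then have "(level 0 / slope 0)\<^sup>2 * (1 / (1 - level 0)) \<le> (level 0 / slope 0)\<^sup>2 * (2 / \<gamma>0)"
      by (intro mult_left_mono) auto
    ultimately have "work 0 \<le> 2 / \<gamma>0 * early (Suc 0)" by (simp only: mult.commute)
    moreover have "0 \<le> 20 / q0\<^sup>2 / (1 - level 0)" using u[of 0] by simp
    ultimately show ?case by (simp only: sum.lessThan_Suc lessThan_0 sum.empty)
  next
    case (Suc k)
    let ?a = "level (Suc k)"
    show ?case
    proof (cases "?a \<le> 1 - \<gamma>0 / 2")
      case True
      have "work (Suc k) = (?a / slope (Suc k))\<^sup>2 * (1 / (1 - ?a))"
        by (simp add: work_def power_divide del: level.simps)
      also have "\<dots> \<le> (?a / slope (Suc k))\<^sup>2 * (2 / \<gamma>0)"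
        using True u[of "Suc k"] \<gamma>0 by (intro mult_left_mono) (auto simp: field_simps simp del: level.simps)
      also have "\<dots> = 2 / \<gamma>0 * (early (Suc (Suc k)) - early (Suc k))" using True by (simp add: early_def del: level.simps)
      finally have 1: "work (Suc k) \<le> 2 / \<gamma>0 * (early (Suc (Suc k)) - early (Suc k))" .
      have "20 / q0\<^sup>2 / (1 - level k) \<le> 20 / q0\<^sup>2 / (1 - ?a)"
        using u[of k] u[of "Suc k"] gap(1)[of k] level_Suc[of k] by (intro divide_left_mono) (auto simp del: level.simps)
      then show ?thesis using Suc 1 by (simp add: algebra_simps del: level.simps)
    next
      case False
      have e: "early (Suc (Suc k)) = early (Suc k)" using False by (simp add: early_def del: level.simps)
      have q: "q0 \<le> slope (Suc k)" unfolding slope_def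
      proof (intro \<phi>_end slope_arg)
        \<comment> \<open>Here the gap is at most \<open>\<gamma>0 / 32\<close>, and contraction by
          \<open>shrink\<close> costs at most another \<open>\<gamma>0 / 4\<close>, so the argument
          of \<phi> stays in the linear zone.\<close>
        have "1 - \<gamma>0 / 2 - \<gamma>0 / 32 \<le> ?a - gap (Suc k)"
          using False gap(4)[of "Suc k"] by simp
        then have "(1 - \<gamma>0 / 4) * (1 - \<gamma>0 / 2 - \<gamma>0 / 32) \<le> shrink * (?a - gap (Suc k))"
          unfolding shrink_def using \<gamma>0 by (intro mult_left_mono) auto
        moreover have "1 - \<gamma>0 \<le> (1 - \<gamma>0 / 4) * (1 - \<gamma>0 / 2 - \<gamma>0 / 32)"
          using \<gamma>0 by (simp add: field_simps)
        ultimately show "1 - \<gamma>0 \<le> shrink * (?a - gap (Suc k))" by linarith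
      qed
      have "work (Suc k) \<le> 1 / (q0\<^sup>2 * (1 - ?a))" unfolding work_def
      proof (rule frac_le)
        show "?a\<^sup>2 \<le> 1" using level[of "Suc k"] by (simp add: power_le_one del: level.simps)
        show "q0\<^sup>2 * (1 - ?a) \<le> (slope (Suc k))\<^sup>2 * (1 - ?a)"
          using q q0 u[of "Suc k"] by (intro mult_right_mono power_mono) (auto simp del: level.simps)
      qed (use q0 u[of "Suc k"] in auto)
      \<comment> \<open>The 20 reproduces itself: once \<open>level k \<ge> 4 / 5\<close>, the
        distance from 1 contracts by at least the factor \<open>19 / 20\<close>, and
        \<open>20 * (19 / 20) + 1 = 20\<close>.\<close>
      moreover have "1 / q0\<^sup>2 / (1 - ?a) + 20 / q0\<^sup>2 / (1 - level k) \<le> 20 / q0\<^sup>2 / (1 - ?a)"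
      proof -
        have a: "1 - ?a = (1 - level k) * (1 - level k / 16)" by (simp add: algebra_simps)
        have "19 / 20 \<le> ?a" using False \<gamma>0 by simp
        then have l: "4 / 5 \<le> level k" using gap(2)[of k] level_Suc[of k] by linarith
        have "20 / (1 - level k) = 20 * (1 - level k / 16) / (1 - ?a)"
          unfolding a using level[of k] by (subst mult_divide_mult_cancel_right) auto
        also have "\<dots> \<le> 19 / (1 - ?a)" using l u[of "Suc k"] by (intro divide_right_mono) (auto simp del: level.simps)
        finally have "20 / (1 - level k) + 1 / (1 - ?a) \<le> 20 / (1 - ?a)"
          by (simp add: add_divide_distrib[symmetric] del: level.simps)
        then have "(20 / (1 - level k) + 1 / (1 - ?a)) / q0\<^sup>2 \<le> (20 / (1 - ?a)) / q0\<^sup>2"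
          by (intro divide_right_mono) auto
        then show ?thesis by (simp add: add_divide_distrib ac_simps del: level.simps)
      qed
      ultimately show ?thesis using Suc e by (simp del: level.simps)
    qed
  qed
  also have "\<dots> \<le> 160 / \<gamma>0\<^sup>2 * B + 20 / q0\<^sup>2 / (1 - level k)"
    using mult_left_mono[OF early[of "Suc k"], of "2 / \<gamma>0"] \<gamma>0 by (simp add: power2_eq_square)
  finally have w: "(\<Sum>j<Suc k. work j) \<le> 160 / \<gamma>0\<^sup>2 * B + 20 / q0\<^sup>2 / (1 - level k)" .
  have "real (start L (Suc k)) \<le> (\<Sum>j<Suc k. D * (L * (real d)\<^sup>2 * work j))"
    unfolding start_def of_nat_sum D_def by (intro sum_mono duration_le L)
  also have "\<dots> = D * (L * (real d)\<^sup>2) * (\<Sum>j<Suc k. work j)" by (simp only: sum_distrib_left mult.assoc)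
  also have "\<dots> \<le> D * (L * (real d)\<^sup>2) * (160 / \<gamma>0\<^sup>2 * B + 20 / q0\<^sup>2 / (1 - level k))"
    using w D L by (intro mult_left_mono) auto
  finally show ?thesis unfolding D_def .
qed

lemma level_tendsto:
  assumes "0 < \<epsilon>"
  shows "\<exists>k. 1 - \<epsilon> \<le> level k"
proof -
  define r where "r = 1 - level 0 / 16"
  have r: "0 < r" "r < 1" using level_0 by (auto simp: r_def simp del: level.simps)
  have "1 - level k \<le> r ^ k" for k
  proof (induction k)
    case 0
    then show ?case using level_0 by (simp del: level.simps)
  next
    case (Suc k)
    have "1 - level (Suc k) = (1 - level k / 16) * (1 - level k)" by (simp add: algebra_simps)
    also have "\<dots> \<le> r * r ^ k"
      using Suc level[of k] level_mono[of 0 k] r by (intro mult_mono) (auto simp: r_def simp del: level.simps)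
    finally show ?case by simp
  qed
  moreover obtain k where "r ^ k < \<epsilon>" using real_arch_pow_inv[OF assms r(2)] by blast
  ultimately show ?thesis by (intro exI[of _ k]) (smt (verit))
qed

end

section \<open>High-probability bounds\<close>

lemma lg_ge_1: "0 < x \<Longrightarrow> 1 \<le> lg x"
  unfolding lg_def by (subst ln_ge_iff) (auto intro: add_pos_pos)

text \<open>Turns a decay like \<open>Y / (s - X)\<close> into a logarithm: the terms up to about
  \<open>X\<close> are bounded by 2 each, the others by a harmonic sum.\<close>

lemma sum_le_harmonic:
  fixes r :: "nat \<Rightarrow> real"
  assumes X: "0 \<le> X" and Y: "0 \<le> Y" and r: "\<And>s. s \<le> n \<Longrightarrow> 0 \<le> r s" "\<And>s. s \<le> n \<Longrightarrow> r s \<le> 2"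
    and decay: "\<And>s. s \<le> n \<Longrightarrow> (real s - X) * r s \<le> Y"
  shows "(\<Sum>s\<le>n. r s) \<le> 2 * (X + 2) + Y * (1 + ln (real (Suc n)))"
proof -
  \<comment> \<open>One more than the ceiling, so that \<open>s - X \<ge> s - p + 1\<close> for
    \<open>s \<ge> p\<close> and the harmonic sum starts at 1.\<close>
  define p where "p = Suc (nat \<lceil>X\<rceil>)"
  have p: "X + 1 \<le> real p" "real p \<le> X + 2"
    using X by (auto simp: p_def) linarith+
  have "(\<Sum>s\<le>n. r s) \<le> (\<Sum>s\<le>n. (if s < p then 2 else 0) + (if p \<le> s then Y / real (Suc (s - p)) else 0))"
  proof (rule sum_mono)
    fix s assume "s \<in> {..n}"
    then have s: "s \<le> n" by simp
    show "r s \<le> (if s < p then 2 else 0) + (if p \<le> s then Y / real (Suc (s - p)) else 0)"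
    proof (cases "s < p")
      case False
      then have "real (Suc (s - p)) \<le> real s - X" using p by (simp add: of_nat_diff)
      then have "real (Suc (s - p)) * r s \<le> (real s - X) * r s" using r s by (intro mult_right_mono) auto
      then have "real (Suc (s - p)) * r s \<le> Y" using decay[OF s] by linarith
      then show ?thesis using False by (simp add: pos_le_divide_eq mult.commute)
    qed (use r s in auto)
  qed
  also have "\<dots> = (\<Sum>s\<le>n. if s < p then 2 else 0) + (\<Sum>s\<le>n. if p \<le> s then Y / real (Suc (s - p)) else 0)"
    by (rule sum.distrib)
  finally have "(\<Sum>s\<le>n. r s) \<le>
    (\<Sum>s\<le>n. if s < p then 2 else 0) + (\<Sum>s\<le>n. if p \<le> s then Y / real (Suc (s - p)) else 0)" .
  moreover have "(\<Sum>s\<le>n. if s < p then 2 else 0) \<le> 2 * real p"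
  proof -
    have "(\<Sum>s\<le>n. if s < p then 2 else (0::real)) = (\<Sum>s\<in>{s. s \<le> n \<and> s < p}. 2)"
      by (rule sum.mono_neutral_cong_right) auto
    also have "\<dots> \<le> 2 * real p"
      using card_mono[of "{..<p}" "{s. s \<le> n \<and> s < p}"] by auto
    finally show ?thesis .
  qed
  moreover have "(\<Sum>s\<le>n. if p \<le> s then Y / real (Suc (s - p)) else 0) \<le> Y * harm (Suc n)"
  proof -
    have "(\<Sum>s\<le>n. if p \<le> s then Y / real (Suc (s - p)) else 0) = (\<Sum>s\<in>{s. p \<le> s \<and> s \<le> n}. Y / real (Suc (s - p)))"
      by (rule sum.mono_neutral_cong_right) auto
    also have "\<dots> = (\<Sum>k\<in>(\<lambda>s. Suc (s - p)) ` {s. p \<le> s \<and> s \<le> n}. Y / real k)"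
      by (subst sum.reindex) (auto simp: inj_on_def)
    also have "\<dots> \<le> (\<Sum>k\<in>{1..Suc n}. Y / real k)"
      using Y by (intro sum_mono2) auto
    also have "\<dots> = Y * harm (Suc n)" by (simp only: harm_def sum_distrib_left divide_inverse)
    finally show ?thesis .
  qed
  moreover have "Y * harm (Suc n) \<le> Y * (1 + ln (real (Suc n)))"
    using euler_mascheroni_sequence_decreasing[of 1 "Suc n"] Y
    by (intro mult_left_mono) (auto simp: harm_def)
  ultimately have "(\<Sum>s\<le>n. r s) \<le> 2 * real p + Y * (1 + ln (real (Suc n)))"
    by (meson add_mono order_trans)
  also have "\<dots> \<le> 2 * (X + 2) + Y * (1 + ln (real (Suc n)))"
    using p by (intro add_right_mono) auto
  finally show ?thesis .
qed

section \<open>The schedule step by step and its high-probability guarantee\<close>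

context rate_profile
begin

lemma start_0 [simp]: "start L 0 = 0"
  by (simp add: start_def)

lemma start_Suc: "start L (Suc k) = start L k + duration L k"
  by (simp add: start_def)

lemma start_mono: "j \<le> k \<Longrightarrow> start L j \<le> start L k"
  by (induction k rule: dec_induct) (auto simp: start_Suc)

definition epoch_of :: "real \<Rightarrow> nat \<Rightarrow> nat" where
  "epoch_of L n = (LEAST k. n < start L (Suc k))"

text \<open>SGD steps are numbered from 1 and positions in epochs from 0, whence the shift. Neither
  horizon nor target accuracy enters.\<close>

definition step_sizes :: "real \<Rightarrow> nat \<Rightarrow> real" where
  "step_sizes L s = step_size L (epoch_of L (s - 1))"

lemma epoch_of: "i < duration L k \<Longrightarrow> epoch_of L (start L k + i) = k"
  unfolding epoch_of_def
proof (rule Least_equality)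
  fix j assume i: "i < duration L k" and j: "start L k + i < start L (Suc j)"
  show "k \<le> j"
  proof (rule ccontr)
    assume "\<not> k \<le> j"
    then have "start L (Suc j) \<le> start L k" by (intro start_mono) auto
    then show False using j by simp
  qed
qed (simp add: start_Suc)

lemma epoch_decomposition:
  assumes L: "0 < L"
  shows "\<exists>k i. i < duration L k \<and> n = start L k + i"
proof -
  have ge: "k \<le> start L k" for k
  proof (induction k)
    case (Suc k)
    then show ?case using duration(1)[OF L, of k] by (simp add: start_Suc)
  qed simp
  define k where "k = (LEAST k. n < start L (Suc k))"
  have "n < start L (Suc n)" using ge[of "Suc n"] by simp
  then have k: "n < start L (Suc k)" unfolding k_def by (rule LeastI)
  have "start L k \<le> n"
  proof (cases k)
    case (Suc j)
    then have "\<not> n < start L (Suc j)" using not_less_Least[of j "\<lambda>k. n < start L (Suc k)"] by (simp add: k_def)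
    then show ?thesis by (simp add: Suc)
  qed simp
  then show ?thesis using k by (intro exI[of _ k] exI[of _ "n - start L k"]) (auto simp: start_Suc)
qed

lemma schedules_step_sizes: "0 < L \<Longrightarrow> schedules (step_sizes L) (\<lambda>_. explore)"
  using step_size_pos explore by (auto simp: schedules_def step_sizes_def intro: less_imp_le)

text \<open>The barrier argument for the actual schedule. The exponent is \<open>L / gap k\<close>,
  and \<open>K = sqrt (2 * L)\<close> makes the noise tail \<open>2 * exp (- L)\<close>.\<close>

lemma sgd_with_high_prob:
  assumes "interactive_sgd M d f f' \<theta>s n0 \<delta> (step_sizes L) (\<lambda>_. explore)"
    and \<theta>s: "\<theta>s \<in> usphere d" and L: "1 \<le> L" "exp (- L) \<le> \<delta> / 4"
    and f: "continuous_on {-1..1} f" "mono_on {-1..1} f" "\<And>y. y \<in> {-1..1} \<Longrightarrow> \<bar>f y\<bar> \<le> 1"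
    and f': "\<gamma>1 \<le> f' shrink" "f' shrink \<le> \<gamma>2"
    and i: "i \<le> duration L k" "real (start L k + i) * exp (- L) \<le> 1"
  obtains G where "G \<in> sets M" "1 - \<delta> * real (1 + start L k + i) \<le> measure M G"
    "\<And>\<omega> j i'. \<omega> \<in> G \<Longrightarrow> j < k \<and> i' \<le> duration L j \<or> j = k \<and> i' \<le> i \<Longrightarrow>
      level j - gap j \<le> alignment d \<theta>s (n0 + Suc (start L j + i')) \<omega>"
    "\<And>\<omega>. \<omega> \<in> G \<Longrightarrow> level k \<le> alignment d \<theta>s (n0 + Suc (start L k)) \<omega>"
proof -
  interpret I: interactive_sgd M d f f' \<theta>s n0 \<delta> "step_sizes L" "\<lambda>_. explore" by fact
  have L0: "0 < L" using L by simp
  define K where "K = sqrt (2 * L)"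
  have K: "0 \<le> K" "K\<^sup>2 = 2 * L" using L by (auto simp: K_def)
  have eta: "step_sizes L (Suc (start L k + i)) = step_size L k" if "i < duration L k" for k i
    using epoch_of[OF that] by (simp add: step_sizes_def)
  define x0 where "x0 k = step_size L k * f' shrink * explore * (2 + K)" for k
  have f'0: "0 \<le> f' shrink" using f' \<gamma>1 by simp
  have x0: "0 \<le> x0 k" "x0 k \<le> gap k" for k
    using jump_le_gap[OF L(1) K f', of k] step_size_pos[OF L0, of k] f'0 explore K by (auto simp: x0_def)
  have x01: "x0 k \<le> 1" for k using x0(2)[of k] gap(3)[of k] by linarith
  note common = explore(1)[THEN less_imp_le] explore(2) explore_sq[symmetric]
  have crude: "AE \<omega> in M. 0 \<le> alignment d \<theta>s (n0 + Suc (start L k + i)) \<omega> \<longrightarrow>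
        \<bar>noise (n0 + Suc (start L k + i)) \<omega>\<bar> \<le> K \<longrightarrow>
        alignment d \<theta>s (n0 + Suc (start L k + i)) \<omega> - 2 * gap k \<le> alignment d \<theta>s (Suc (n0 + Suc (start L k + i))) \<omega>"
    if i: "i < duration L k" for k i
  proof -
    have "AE \<omega> in M. 0 \<le> alignment d \<theta>s (n0 + Suc (start L k + i)) \<omega> \<longrightarrow>
        \<bar>noise (n0 + Suc (start L k + i)) \<omega>\<bar> \<le> K \<longrightarrow>
        alignment d \<theta>s (n0 + Suc (start L k + i)) \<omega> - 2 * x0 k \<le> alignment d \<theta>s (Suc (n0 + Suc (start L k + i))) \<omega>"
      by (rule I.alignment_step_crude[where c = shrink])
        (use common eta[OF i] step_size_pos[OF L0, of k] f'0 \<theta>s f x01 in \<open>auto simp: x0_def\<close>)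
    then show ?thesis using x0(2)[of k] by (auto elim!: eventually_mono)
  qed
  have decay: "(\<integral>\<^sup>+\<omega>. indicator E \<omega> * indicator {\<omega>. \<bar>noise (n0 + Suc (start L k + i)) \<omega>\<bar> \<le> K} \<omega> *
          ennreal (exp (- (L / gap k) * alignment d \<theta>s (Suc (n0 + Suc (start L k + i))) \<omega>)) \<partial>M) \<le>
        (\<integral>\<^sup>+\<omega>. indicator E \<omega> *
          ennreal (exp (- (L / gap k) * (alignment d \<theta>s (n0 + Suc (start L k + i)) \<omega> + 2 * gap k / real (duration L k)))) \<partial>M)"
    if i: "i < duration L k" and E: "E \<in> sets (past d (n0 + Suc (start L k + i)))"
      and El: "\<And>\<omega>. \<omega> \<in> E \<Longrightarrow> alignment d \<theta>s (n0 + Suc (start L k + i)) \<omega> \<in> {level k - gap k..level k + 5 * gap k}"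
    for k i E
  proof (rule I.exp_alignment_step[where c = shrink and ?x0.0 = "x0 k" and l = "level k - gap k" and
        h = "level k + 5 * gap k" and q = "slope k", OF _ _ _ _ _ _ \<theta>s f(3) _ _ E _ _ El])
    show "x0 k \<le> level k - gap k" "0 < level k - gap k"
      using x0(2)[of k] gap(1,2)[of k] level[of k] by linarith+
    show "f (shrink * m) + slope k * u \<le> f (shrink * m + u)"
      if m: "level k - gap k \<le> m" "m \<le> level k + 5 * gap k" "m \<le> 1" and u: "0 \<le> u" "shrink * m + u \<le> 1" for m u
    proof -
      have "shrink * (level k - gap k) \<le> shrink * m" using m shrink by (intro mult_left_mono) auto
      moreover have "0 < shrink * (level k - gap k)"
        using shrink gap(1,2)[of k] level[of k] by (intro mult_pos_pos; linarith)
      moreover have "shrink * m \<le> shrink * 1" using m shrink by (intro mult_left_mono) auto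
      ultimately have x: "0 < shrink * m" "shrink * m < 1" using shrink(2) by linarith+
      have le: "slope k \<le> \<phi> (shrink * m)"
        unfolding slope_def
        using \<open>0 < shrink * (level k - gap k)\<close> \<open>shrink * (level k - gap k) \<le> shrink * m\<close> x(2)
        by (rule \<phi>_mono)
      have "slope k * u \<le> \<phi> (shrink * m) * u" using le u by (intro mult_right_mono) auto
      then show ?thesis using \<phi>_tangent[OF x u] by linarith
    qed
    show "L / gap k * step_sizes L (Suc (start L k + i)) * f' shrink * explore \<le> 1 / 4"
      "24 * (L / gap k * step_sizes L (Suc (start L k + i)) * f' shrink) \<le> slope k"
      unfolding eta[OF i] by (rule tilt_small[OF L(1) K f'])+
    show "2 * gap k / real (duration L k) + (level k + 5 * gap k) * (x0 k)\<^sup>2 \<le>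
      step_sizes L (Suc (start L k + i)) * f' shrink * explore\<^sup>2 * slope k * (1 - (level k + 5 * gap k)) / (12 * real d)"
      unfolding eta[OF i] x0_def using progress_gain[OF L(1) K f', of k] duration(2)[OF L0, of k] by linarith
  qed (use common eta[OF i] step_size_pos[OF L0, of k] f'0 f x0[of k] x01[of k] d L0 gap(1)[of k] slope(1)[of k] in
      \<open>auto simp: x0_def\<close>)
  have tail: "2 * exp (- K\<^sup>2 / 2) \<le> \<delta> / 2" using L K by simp
  have gl: "gap k \<le> level k" for k using gap(2)[of k] level[of k] by linarith
  show thesis
  proof (rule I.alignment_with_high_prob[of level gap "duration L" "start L" L K i k])
    show "level 0 \<le> 1 / sqrt (real d)" by simp
    fix G assume "G \<in> sets M" "1 - \<delta> * real (1 + start L k + i) \<le> I.prob G"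
    "\<And>\<omega> j i'. \<omega> \<in> G \<Longrightarrow> j < k \<and> i' \<le> duration L j \<or> j = k \<and> i' \<le> i \<Longrightarrow>
      level j - gap j \<le> alignment d \<theta>s (n0 + Suc (start L j + i')) \<omega>"
    "\<And>\<omega>. \<omega> \<in> G \<Longrightarrow> level k \<le> alignment d \<theta>s (n0 + Suc (start L k)) \<omega>"
    then show thesis by (rule that)
  qed (use level_Suc gap gl duration(1)[OF L0] start_Suc L K tail i crude decay in auto)
qed

end

text \<open>The 4 in the logarithm is the budget of a step: half of \<delta> for the noise and half
  for the barrier, the latter spent on a potential of up to 2.\<close>

lemma log_budget:
  fixes \<delta> :: real
  assumes "0 < \<delta>"
  defines "L \<equiv> max 1 (ln (4 / \<delta>))"
  shows "1 \<le> L" "exp (- L) \<le> \<delta> / 4" "L \<le> 4 * lg (1 / \<delta>)"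
proof -
  show "1 \<le> L" by (simp add: L_def)
  have "exp (- L) \<le> exp (- ln (4 / \<delta>))" by (simp add: L_def)
  also have "\<dots> = \<delta> / 4" using assms(1) by (simp add: exp_minus)
  finally show "exp (- L) \<le> \<delta> / 4" .
  have lg1: "1 \<le> lg (1 / \<delta>)" using assms(1) by (intro lg_ge_1) simp
  have "ln (4 / \<delta>) = ln 4 + ln (1 / \<delta>)" using assms(1) by (simp add: ln_div)
  also have "ln (4::real) \<le> 3" using ln_le_minus_one[of 4] by simp
  also have "ln (1 / \<delta>) \<le> lg (1 / \<delta>)" unfolding lg_def using assms(1) by (subst ln_le_cancel_iff) (auto intro: add_pos_pos)
  finally show "L \<le> 4 * lg (1 / \<delta>)" using lg1 by (simp add: L_def)
qed

section \<open>Exploration and regret for a given profile\<close>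

context rate_profile
begin

definition work_const :: real where
  "work_const = 70 / (\<kappa> * \<gamma>1 * explore\<^sup>2) + \<gamma>2\<^sup>2"

definition cost_floor :: real where
  "cost_floor = 9 * \<gamma>0 / (20 * \<gamma>2\<^sup>2)"

text \<open>The summands pay for the initialization, for the round of the final iterate and for the
  epochs; the factor 4 stems from \<open>L \<le> 4 * lg (1 / \<delta>)\<close>.\<close>

definition explore_const :: "real \<Rightarrow> real" where
  "explore_const C0 = 128 * C0 + 1 / cost_floor + 4 * work_const * (160 / \<gamma>0\<^sup>2 + 20 / q0\<^sup>2)"

text \<open>The same account at regret at most 2 per round, plus the harmonic tail, whose
  \<open>(real d)\<^sup>2\<close> is charged to the integral through
  \<open>cost_floor\<close>.\<close>

definition regret_const :: "real \<Rightarrow> real" where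
  "regret_const C0 = 256 * C0 + 4 / cost_floor + 8 * work_const * (160 / \<gamma>0\<^sup>2) +
    8 * (4 / \<gamma>0 + 2 * \<gamma>2) * work_const * (20 / q0\<^sup>2) / cost_floor"

lemma const_pos: "0 < work_const" "0 < cost_floor"
proof -
  show "0 < work_const" unfolding work_const_def using \<kappa>(1) \<gamma>1 explore \<gamma>2 by (intro add_pos_pos) auto
  show "0 < cost_floor" unfolding cost_floor_def using \<gamma>0 \<gamma>2 by simp
qed

context
  fixes f' :: "real \<Rightarrow> real" and C0 \<delta> B L :: real and k0 n0 :: nat
  assumes f: "continuous_on {-1..1} f" "mono_on {-1..1} f" "\<And>y. y \<in> {-1..1} \<Longrightarrow> \<bar>f y\<bar> \<le> 1"
    and f': "\<gamma>1 \<le> f' shrink" "f' shrink \<le> \<gamma>2"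
    and f_end: "\<And>m. 1 - \<gamma>0 \<le> m \<Longrightarrow> m \<le> 1 \<Longrightarrow> f 1 - f m \<le> \<gamma>2 * (1 - m)"
    and \<delta>: "0 < \<delta>" and C0: "0 < C0" and budget: "init_budget C0 k0 d f \<delta> n0"
    and B: "profile_cost = ennreal B" "0 \<le> B"
    and L_def: "L = max 1 (ln (4 / \<delta>))"
begin

lemma L: "1 \<le> L" "exp (- L) \<le> \<delta> / 4" "L \<le> 4 * lg (1 / \<delta>)"
  using log_budget[OF \<delta>] unfolding L_def by auto

lemma cost_floor_le: "cost_floor \<le> B"
  using profile_cost_ge_const B by (simp add: cost_floor_def)

lemma d2_le: "1 \<le> (real d)\<^sup>2" "(real d)\<^sup>2 \<le> (real d)\<^sup>2 * B / cost_floor"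
proof -
  show "1 \<le> (real d)\<^sup>2" using d by simp
  have "1 \<le> B / cost_floor" using cost_floor_le const_pos by simp
  then have "(real d)\<^sup>2 * 1 \<le> (real d)\<^sup>2 * (B / cost_floor)" by (intro mult_left_mono) auto
  then show "(real d)\<^sup>2 \<le> (real d)\<^sup>2 * B / cost_floor" by simp
qed

lemma lg_d: "1 \<le> lg (real d)" and lg_\<delta>: "1 \<le> lg (1 / \<delta>)"
  using d \<delta> by (auto intro!: lg_ge_1)

text \<open>\<open>l\<close> stands for the third logarithm of the intended bound,
  \<open>lg (1 / \<epsilon>)\<close> or \<open>lg (real T)\<close>.\<close>

lemma init_rounds_le:
  assumes "1 \<le> l"
  shows "real n0 \<le> 128 * C0 * (lg (real d) * l * lg (1 / \<delta>)) ^ k0 * ((real d)\<^sup>2 * B)"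
proof -
  let ?P = "lg (real d) * lg (1 / \<delta>)"
  have P: "0 \<le> ?P" using lg_d lg_\<delta> by simp
  have "real n0 \<le> C0 * ?P ^ k0 * (1 / (f (1 / sqrt (real d)) - f 0)\<^sup>2)"
    using budget init_gap_bound(1)[OF f(2) B] by (simp add: init_budget_def)
  also have "\<dots> \<le> C0 * ?P ^ k0 * (128 * (real d)\<^sup>2 * B)"
    using init_gap_bound(2)[OF f(2) B] C0 P by (intro mult_left_mono) auto
  also have "\<dots> = 128 * C0 * ?P ^ k0 * ((real d)\<^sup>2 * B)" by simp
  also have "\<dots> \<le> 128 * C0 * (lg (real d) * l * lg (1 / \<delta>)) ^ k0 * ((real d)\<^sup>2 * B)"
  proof -
    have "?P * 1 \<le> ?P * l" using P assms by (intro mult_left_mono) auto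
    then have "?P ^ k0 \<le> (lg (real d) * l * lg (1 / \<delta>)) ^ k0"
      using P by (intro power_mono) (auto simp: ac_simps)
    then show ?thesis using C0 B by (intro mult_right_mono mult_left_mono) auto
  qed
  finally show ?thesis .
qed

lemma start_Suc_le:
  "real (start L (Suc k)) \<le> work_const * L * (real d)\<^sup>2 * (160 / \<gamma>0\<^sup>2) * B +
    work_const * L * (real d)\<^sup>2 * (20 / q0\<^sup>2) / (1 - level k)"
proof -
  have "real (start L (Suc k)) \<le> work_const * (L * (real d)\<^sup>2) * (160 / \<gamma>0\<^sup>2 * B + 20 / q0\<^sup>2 / (1 - level k))"
    unfolding work_const_def by (rule start_le[OF L(1) B])
  also have "\<dots> = work_const * L * (real d)\<^sup>2 * (160 / \<gamma>0\<^sup>2) * B +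
    work_const * L * (real d)\<^sup>2 * (20 / q0\<^sup>2) / (1 - level k)" by (simp add: distrib_left)
  finally show ?thesis .
qed

text \<open>The epoch used is the first whose level reaches \<open>1 - \<epsilon>\<close>. The
  preceding level is still at distance at least \<epsilon> from 1, which turns the geometric term of
  \<open>start_Suc_le\<close> into \<open>(real d)\<^sup>2 / \<epsilon>\<close>.\<close>

lemma exploration:
  assumes \<epsilon>: "0 < \<epsilon>"
  shows "\<exists>T>n0. real T \<le> explore_const C0 * (lg (real d) * lg (1 / \<epsilon>) * lg (1 / \<delta>)) ^ (k0 + 1) *
      ((real d)\<^sup>2 * B + (real d)\<^sup>2 / \<epsilon>) \<and>
    (\<forall>\<theta>s\<in>usphere d. \<forall>M. interactive_sgd M d f f' \<theta>s n0 \<delta> (step_sizes L) (\<lambda>_. explore) \<longrightarrow>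
      1 - \<delta> * real T \<le> measure M {\<omega> \<in> space M. 1 - \<epsilon> \<le> alignment d \<theta>s T \<omega>})"
proof -
  define k where "k = (LEAST k. 1 - \<epsilon> \<le> level k)"
  have k: "1 - \<epsilon> \<le> level k" unfolding k_def using level_tendsto[OF \<epsilon>] by (rule LeastI_ex)
  define T where "T = n0 + Suc (start L k)"
  define Q where "Q = lg (real d) * lg (1 / \<epsilon>) * lg (1 / \<delta>)"
  define R where "R = (real d)\<^sup>2 * B + (real d)\<^sup>2 / \<epsilon>"
  have lge: "1 \<le> lg (1 / \<epsilon>)" using \<epsilon> by (intro lg_ge_1) simp
  have "1 * 1 \<le> lg (real d) * lg (1 / \<epsilon>)" using lg_d lge by (intro mult_mono) auto
  then have "1 * lg (1 / \<delta>) \<le> Q" unfolding Q_def using lg_\<delta> by (intro mult_right_mono) auto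
  then have Q: "lg (1 / \<delta>) \<le> Q" "1 \<le> Q" using lg_\<delta> by auto
  have Qk: "Q ^ k0 \<le> Q ^ (k0 + 1)" "Q \<le> Q ^ (k0 + 1)" "1 \<le> Q ^ (k0 + 1)"
    using Q power_increasing[of k0 "k0 + 1" Q] power_increasing[of 1 "k0 + 1" Q] one_le_power[of Q "k0 + 1"] by auto
  have R: "(real d)\<^sup>2 * B \<le> R" "(real d)\<^sup>2 / \<epsilon> \<le> R" "0 \<le> R"
    using B \<epsilon> by (auto simp: R_def)
  have W: "0 < work_const" by (rule const_pos)
  have n0: "real n0 \<le> 128 * C0 * (Q ^ (k0 + 1) * R)"
  proof -
    have "real n0 \<le> 128 * C0 * (Q ^ k0 * ((real d)\<^sup>2 * B))"
      using init_rounds_le[OF lge] by (simp add: Q_def mult.assoc)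
    also have "\<dots> \<le> 128 * C0 * (Q ^ (k0 + 1) * R)"
      using C0 Qk(1) Q R B by (intro mult_left_mono mult_mono) auto
    finally show ?thesis .
  qed
  have one: "1 \<le> 1 / cost_floor * (Q ^ (k0 + 1) * R)"
  proof -
    have "1 \<le> (real d)\<^sup>2 * B / cost_floor" using d2_le by linarith
    also have "\<dots> = 1 / cost_floor * (1 * ((real d)\<^sup>2 * B))" by simp
    also have "\<dots> \<le> 1 / cost_floor * (Q ^ (k0 + 1) * R)"
      using const_pos Qk R B by (intro mult_left_mono mult_mono) auto
    finally show ?thesis .
  qed
  have st: "real (start L k) \<le> 4 * work_const * (160 / \<gamma>0\<^sup>2 + 20 / q0\<^sup>2) * (Q ^ (k0 + 1) * R)"
  proof (cases k)
    case 0
    then show ?thesis using W Q R by simp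
  next
    case (Suc j)
    have "\<not> 1 - \<epsilon> \<le> level j" unfolding k_def[symmetric]
      using not_less_Least[of j "\<lambda>k. 1 - \<epsilon> \<le> level k"] Suc by (simp add: k_def)
    then have \<epsilon>j: "\<epsilon> \<le> 1 - level j" by simp
    have "real (start L k) \<le> work_const * L * (real d)\<^sup>2 * (160 / \<gamma>0\<^sup>2) * B +
        work_const * L * (real d)\<^sup>2 * (20 / q0\<^sup>2) / (1 - level j)"
      unfolding Suc by (rule start_Suc_le)
    also have "\<dots> \<le> work_const * L * (real d)\<^sup>2 * (160 / \<gamma>0\<^sup>2) * B +
        work_const * L * (real d)\<^sup>2 * (20 / q0\<^sup>2) / \<epsilon>"
      using \<epsilon>j \<epsilon> W L(1) by (intro add_left_mono divide_left_mono) auto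
    also have "\<dots> = work_const * (160 / \<gamma>0\<^sup>2) * (L * ((real d)\<^sup>2 * B)) + work_const * (20 / q0\<^sup>2) * (L * ((real d)\<^sup>2 / \<epsilon>))"
      by (simp add: ac_simps)
    also have "\<dots> \<le> work_const * (160 / \<gamma>0\<^sup>2) * ((4 * Q ^ (k0 + 1)) * R) + work_const * (20 / q0\<^sup>2) * ((4 * Q ^ (k0 + 1)) * R)"
    proof -
      have "L \<le> 4 * Q ^ (k0 + 1)" using L(3) Q Qk by linarith
      then show ?thesis using W R Q L(1) B \<epsilon> by (intro add_mono mult_left_mono mult_mono) auto
    qed
    also have "\<dots> = 4 * work_const * (160 / \<gamma>0\<^sup>2 + 20 / q0\<^sup>2) * (Q ^ (k0 + 1) * R)"
      by (simp only: distrib_left distrib_right mult.assoc mult.left_commute)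
    finally show ?thesis .
  qed
  have "real T = real n0 + 1 + real (start L k)" by (simp add: T_def)
  also have "\<dots> \<le> 128 * C0 * (Q ^ (k0 + 1) * R) + 1 / cost_floor * (Q ^ (k0 + 1) * R) +
      4 * work_const * (160 / \<gamma>0\<^sup>2 + 20 / q0\<^sup>2) * (Q ^ (k0 + 1) * R)"
    using n0 one st by (intro add_mono)
  also have "\<dots> = explore_const C0 * Q ^ (k0 + 1) * R"
    unfolding explore_const_def by (simp only: distrib_right mult.assoc)
  finally have T: "real T \<le> explore_const C0 * Q ^ (k0 + 1) * R" .
  have prob: "1 - \<delta> * real T \<le> measure M {\<omega> \<in> space M. 1 - \<epsilon> \<le> alignment d \<theta>s T \<omega>}"
    if \<theta>s: "\<theta>s \<in> usphere d" and I: "interactive_sgd M d f f' \<theta>s n0 \<delta> (step_sizes L) (\<lambda>_. explore)" for \<theta>s M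
  proof (cases "1 \<le> \<delta> * real T")
    case True
    then have "1 - \<delta> * real T \<le> 0" by simp
    then show ?thesis by (rule order_trans[OF _ measure_nonneg])
  next
    case False
    interpret I: interactive_sgd M d f f' \<theta>s n0 \<delta> "step_sizes L" "\<lambda>_. explore" by (rule I)
    \<comment> \<open>With \<open>\<delta> * real T < 1\<close>, the accumulated error of the
      potential stays below 1.\<close>
    have "real (start L k + 0) * exp (- L) \<le> real T * (\<delta> / 4)"
      using L(2) by (intro mult_mono) (auto simp: T_def)
    then have small: "real (start L k + 0) * exp (- L) \<le> 1" using False by (simp add: mult.commute)
    obtain G where G: "G \<in> sets M" "1 - \<delta> * real (1 + start L k + 0) \<le> measure M G"
      "\<And>\<omega>. \<omega> \<in> G \<Longrightarrow> level k \<le> alignment d \<theta>s (n0 + Suc (start L k)) \<omega>"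
    proof (rule sgd_with_high_prob[OF I \<theta>s L(1,2) f f' le0 small])
      fix G assume "G \<in> sets M" "1 - \<delta> * real (1 + start L k + 0) \<le> measure M G"
        "\<And>\<omega>. \<omega> \<in> G \<Longrightarrow> level k \<le> alignment d \<theta>s (n0 + Suc (start L k)) \<omega>"
      then show thesis by (rule that)
    qed
    have "1 - \<delta> * real T \<le> 1 - \<delta> * real (1 + start L k + 0)"
      using \<delta> by (auto simp: T_def)
    also have "\<dots> \<le> measure M G" by (rule G)
    also have "\<dots> \<le> measure M {\<omega> \<in> space M. 1 - \<epsilon> \<le> alignment d \<theta>s T \<omega>}"
    proof (rule I.finite_measure_mono)
      show "G \<subseteq> {\<omega> \<in> space M. 1 - \<epsilon> \<le> alignment d \<theta>s T \<omega>}"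
        using sets.sets_into_space[OF G(1)] order_trans[OF k G(3)] by (auto simp only: T_def)
      have [measurable]: "alignment d \<theta>s T \<in> borel_measurable M" by (rule I.alignment_measurable)
      show "{\<omega> \<in> space M. 1 - \<epsilon> \<le> alignment d \<theta>s T \<omega>} \<in> sets M" by measurable
    qed
    finally show ?thesis .
  qed
  show ?thesis
  proof (intro exI[of _ T] conjI ballI allI impI)
    show "n0 < T" by (simp add: T_def)
  qed (use T prob in \<open>simp_all only: Q_def R_def\<close>)
qed

text \<open>Near the top, an iterate of epoch \<open>j\<close> has regret of order at most
  \<open>1 - level j\<close>, while its step number satisfies
  \<open>s - X \<le> Y0 / (1 - level j)\<close>. The product is bounded, so the regret decays like
  \<open>1 / (s - X)\<close>, and one schedule serves all horizons.\<close>

lemma regret_bound: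
  assumes T: "1 \<le> T" and \<theta>s: "\<theta>s \<in> usphere d"
    and I: "interactive_sgd M d f f' \<theta>s n0 \<delta> (step_sizes L) (\<lambda>_. explore)"
  defines "R \<equiv> regret_const C0 * (lg (real d) * lg (real T) * lg (1 / \<delta>)) ^ (k0 + 2) * ((real d)\<^sup>2 * B)"
  shows "1 - \<delta> * real T \<le> measure M {\<omega> \<in> space M. regret d f \<theta>s T \<omega> \<le> min (2 * real T) R}"
proof (cases "1 \<le> \<delta> * real T")
  case True
  then have "1 - \<delta> * real T \<le> 0" by simp
  then show ?thesis by (rule order_trans[OF _ measure_nonneg])
next
  case False
  interpret I: interactive_sgd M d f f' \<theta>s n0 \<delta> "step_sizes L" "\<lambda>_. explore" by (rule I)
  define Q where "Q = lg (real d) * lg (real T) * lg (1 / \<delta>)"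
  \<comment> \<open>\<open>X\<close> and \<open>Y0\<close> are the two parts of
    \<open>start_Suc_le\<close>: the burn-in, independent of the level, and the coefficient of
    \<open>1 / (1 - level k)\<close>.\<close>
  define X where "X = work_const * L * (real d)\<^sup>2 * (160 / \<gamma>0\<^sup>2) * B"
  define Y0 where "Y0 = work_const * L * (real d)\<^sup>2 * (20 / q0\<^sup>2)"
  \<comment> \<open>One summand per regime: far levels use regret at most 2 and
    \<open>1 / (1 - level j) \<le> 2 / \<gamma>0\<close>; near levels use the Lipschitz constant
    \<gamma>2, with a factor 2 for the slack below the level.\<close>
  define Y where "Y = (4 / \<gamma>0 + 2 * \<gamma>2) * Y0"
  define r where "r \<omega> t = f 1 - f (alignment d \<theta>s t \<omega>)" for \<omega> t
  have W: "0 < work_const" by (rule const_pos)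
  have X0: "0 \<le> X" using W L(1) B by (simp add: X_def)
  have Y00: "0 \<le> Y0" using W L(1) by (simp add: Y0_def)
  then have Y_ge: "0 \<le> Y" using \<gamma>0 \<gamma>2 by (simp add: Y_def)
  have align: "alignment d \<theta>s t \<omega> \<in> {-1..1}" if "\<omega> \<in> space M" for \<omega> t
    using usphere_inner_le[OF \<theta>s I.iterate_in[OF that]] by (simp add: alignment_def abs_le_iff)
  have r: "0 \<le> r \<omega> t" "r \<omega> t \<le> 2" if "\<omega> \<in> space M" for \<omega> t
  proof -
    show "0 \<le> r \<omega> t" using mono_onD[OF f(2) align[OF that, of t], of 1] align[OF that, of t] by (simp add: r_def)
    show "r \<omega> t \<le> 2" using f(3)[OF align[OF that, of t]] f(3)[of 1] by (simp add: r_def abs_le_iff)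
  qed
  have reg: "regret d f \<theta>s T \<omega> = (\<Sum>t=1..T. r \<omega> t)" for \<omega> by (simp add: regret_def r_def)
  have reg_T: "regret d f \<theta>s T \<omega> \<le> 2 * real T" if "\<omega> \<in> space M" for \<omega>
    by (rule I.regret_le[OF \<theta>s _ that]) (rule f(3))
  have meas: "{\<omega> \<in> space M. regret d f \<theta>s T \<omega> \<le> c} \<in> sets M" for c
  proof -
    have [measurable]: "regret d f \<theta>s T \<in> borel_measurable M" by (rule I.regret_measurable[OF \<theta>s f(1)])
    show ?thesis by measurable
  qed
  have lgT: "1 \<le> lg (real T)" using T by (intro lg_ge_1) simp
  have Q: "lg (1 / \<delta>) * lg (real T) \<le> Q" "1 \<le> Q" "lg (1 / \<delta>) \<le> Q"
  proof -
    have "1 \<le> lg (1 / \<delta>) * lg (real T)" "lg (1 / \<delta>) * 1 \<le> lg (1 / \<delta>) * lg (real T)"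
      using mult_mono[OF lg_\<delta> lgT] lgT lg_\<delta> by auto
    moreover have "1 * (lg (1 / \<delta>) * lg (real T)) \<le> lg (real d) * (lg (1 / \<delta>) * lg (real T))"
      using lg_d lgT lg_\<delta> by (intro mult_right_mono) auto
    then show "lg (1 / \<delta>) * lg (real T) \<le> Q" by (simp add: Q_def ac_simps)
    ultimately show "1 \<le> Q" "lg (1 / \<delta>) \<le> Q" by linarith+
  qed
  have Qk: "Q ^ k0 \<le> Q ^ (k0 + 2)" "Q \<le> Q ^ (k0 + 2)" "1 \<le> Q ^ (k0 + 2)"
    using Q power_increasing[of k0 "k0 + 2" Q] power_increasing[of 1 "k0 + 2" Q] one_le_power[of Q "k0 + 2"] by auto
  define V where "V = Q ^ (k0 + 2) * ((real d)\<^sup>2 * B)"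
  have V: "Q * ((real d)\<^sup>2 * B) \<le> V" unfolding V_def using Qk B by (intro mult_right_mono) auto
  have n0_le: "2 * real n0 \<le> 256 * C0 * V"
  proof -
    have "real n0 \<le> 128 * C0 * (Q ^ k0 * ((real d)\<^sup>2 * B))"
      using init_rounds_le[OF lgT] by (simp add: Q_def mult.assoc)
    also have "\<dots> \<le> 128 * C0 * V"
      unfolding V_def using C0 Qk(1) B by (intro mult_left_mono mult_right_mono) auto
    finally show ?thesis by simp
  qed
  have four: "4 \<le> 4 / cost_floor * V"
  proof -
    have "4 * 1 \<le> 4 * ((real d)\<^sup>2 * B / cost_floor)" using d2_le by linarith
    also have "\<dots> = 4 / cost_floor * (1 * ((real d)\<^sup>2 * B))" by simp
    also have "\<dots> \<le> 4 / cost_floor * V"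
      unfolding V_def using const_pos Qk(3) B by (intro mult_left_mono mult_right_mono) auto
    finally show ?thesis by simp
  qed
  have X_le: "2 * X \<le> 8 * work_const * (160 / \<gamma>0\<^sup>2) * V"
  proof -
    have "2 * X = 2 * work_const * (160 / \<gamma>0\<^sup>2) * (L * ((real d)\<^sup>2 * B))" by (simp add: X_def)
    also have "\<dots> \<le> 2 * work_const * (160 / \<gamma>0\<^sup>2) * ((4 * Q) * ((real d)\<^sup>2 * B))"
      using L(3) Q W B by (intro mult_left_mono mult_right_mono) auto
    also have "\<dots> = 8 * work_const * (160 / \<gamma>0\<^sup>2) * (Q * ((real d)\<^sup>2 * B))" by simp
    also have "\<dots> \<le> 8 * work_const * (160 / \<gamma>0\<^sup>2) * V" using V W by (intro mult_left_mono) auto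
    finally show ?thesis .
  qed
  have Y_le: "Y * (2 * lg (real T)) \<le> 8 * (4 / \<gamma>0 + 2 * \<gamma>2) * work_const * (20 / q0\<^sup>2) / cost_floor * V"
  proof -
    let ?c = "(4 / \<gamma>0 + 2 * \<gamma>2) * work_const * (20 / q0\<^sup>2)"
    have c: "0 \<le> ?c" using \<gamma>0 \<gamma>2 W by (intro mult_nonneg_nonneg add_nonneg_nonneg) auto
    have "Y * (2 * lg (real T)) = 2 * ?c * (L * lg (real T) * (real d)\<^sup>2)" by (simp add: Y_def Y0_def)
    also have "\<dots> \<le> 2 * ?c * ((4 * Q) * ((real d)\<^sup>2 * B / cost_floor))"
    proof (rule mult_left_mono[OF mult_mono])
      have "L * lg (real T) \<le> 4 * lg (1 / \<delta>) * lg (real T)" using L(3) lgT by (intro mult_right_mono) auto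
      then show "L * lg (real T) \<le> 4 * Q" using Q by simp
    qed (use d2_le c Q in auto)
    also have "\<dots> = 8 * ?c / cost_floor * (Q * ((real d)\<^sup>2 * B))" by simp
    also have "\<dots> \<le> 8 * ?c / cost_floor * V"
    proof (rule mult_left_mono[OF V])
      show "0 \<le> 8 * ?c / cost_floor" using c const_pos(2) by (intro divide_nonneg_pos) linarith+
    qed
    also have "8 * ?c / cost_floor * V = 8 * (4 / \<gamma>0 + 2 * \<gamma>2) * work_const * (20 / q0\<^sup>2) / cost_floor * V"
      by (simp only: mult.assoc)
    finally show ?thesis .
  qed
  have R: "R = 256 * C0 * V + 4 / cost_floor * V + 8 * work_const * (160 / \<gamma>0\<^sup>2) * V +
      8 * (4 / \<gamma>0 + 2 * \<gamma>2) * work_const * (20 / q0\<^sup>2) / cost_floor * V"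
    unfolding R_def Q_def[symmetric] regret_const_def V_def by (simp only: distrib_right mult.assoc)
  have init_part: "(\<Sum>t=1..m. r \<omega> t) \<le> 2 * real n0" if "\<omega> \<in> space M" "m \<le> n0" for \<omega> m
  proof -
    have "(\<Sum>t=1..m. r \<omega> t) \<le> 2 * real m"
      using sum_bounded_above[of "{1..m}" "r \<omega>" 2] r[OF that(1)] by simp
    then show ?thesis using that(2) by linarith
  qed
  have nonneg: "0 \<le> 2 * X" "0 \<le> Y * (2 * lg (real T))" using X0 Y_ge lgT by auto
  show ?thesis
  \<comment> \<open>A horizon that ends within the initialization is settled on every trajectory by
    the bound 2 per round.\<close>
  proof (cases "T \<le> n0")
    case True
    have "regret d f \<theta>s T \<omega> \<le> min (2 * real T) R" if w: "\<omega> \<in> space M" for \<omega>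
    proof -
      have "regret d f \<theta>s T \<omega> \<le> R"
        using init_part[OF w True] n0_le four X_le Y_le nonneg unfolding reg R by linarith
      then show ?thesis using reg_T[OF w] by simp
    qed
    then have "{\<omega> \<in> space M. regret d f \<theta>s T \<omega> \<le> min (2 * real T) R} = space M" by auto
    then show ?thesis using \<delta> I.prob_space by simp
  next
    case T_gt: False
    define n where "n = T - Suc n0"
    have Tn: "T = n0 + Suc n" using T_gt by (simp add: n_def)
    obtain k i where ki: "i < duration L k" "n = start L k + i"
      using epoch_decomposition[of L n] L(1) by auto
    have "real (start L k + i) * exp (- L) \<le> real T * (\<delta> / 4)"
      using L(2) ki by (intro mult_mono) (auto simp: Tn)
    then have small: "real (start L k + i) * exp (- L) \<le> 1" using False by (simp add: mult.commute)
    obtain G where G: "G \<in> sets M" "1 - \<delta> * real (1 + start L k + i) \<le> measure M G"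
      "\<And>\<omega> j i'. \<omega> \<in> G \<Longrightarrow> j < k \<and> i' \<le> duration L j \<or> j = k \<and> i' \<le> i \<Longrightarrow>
        level j - gap j \<le> alignment d \<theta>s (n0 + Suc (start L j + i')) \<omega>"
    proof (rule sgd_with_high_prob[OF I \<theta>s L(1,2) f f' less_imp_le[OF ki(1)] small])
      fix G assume "G \<in> sets M" "1 - \<delta> * real (1 + start L k + i) \<le> measure M G"
        "\<And>\<omega> j i'. \<omega> \<in> G \<Longrightarrow> j < k \<and> i' \<le> duration L j \<or> j = k \<and> i' \<le> i \<Longrightarrow>
          level j - gap j \<le> alignment d \<theta>s (n0 + Suc (start L j + i')) \<omega>"
      then show thesis by (rule that)
    qed
    have decay: "(real s - X) * r \<omega> (n0 + Suc s) \<le> Y" if w: "\<omega> \<in> G" and s: "s \<le> n" for \<omega> s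
    proof (cases "real s \<le> X")
      case True
      have "\<omega> \<in> space M" using w sets.sets_into_space[OF G(1)] by auto
      then have "(real s - X) * r \<omega> (n0 + Suc s) \<le> 0" using True r by (intro mult_nonpos_nonneg) auto
      then show ?thesis using Y_ge by linarith
    next
      case False
      have wM: "\<omega> \<in> space M" using w sets.sets_into_space[OF G(1)] by auto
      obtain j i' where ji: "i' < duration L j" "s = start L j + i'"
        using epoch_decomposition[of L s] L(1) by auto
      let ?m = "alignment d \<theta>s (n0 + Suc s) \<omega>"
      have jk: "j < k \<and> i' \<le> duration L j \<or> j = k \<and> i' \<le> i"
      proof (cases j k rule: linorder_cases)
        case greater
        then have "start L (Suc k) \<le> start L j" by (intro start_mono) auto
        then show ?thesis using s ki ji by (simp add: start_Suc)
      qed (use ji ki s in auto)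
      have m: "level j - gap j \<le> ?m" unfolding ji(2) by (rule G(3)[OF w jk])
      have u: "0 < 1 - level j" using level[of j] by simp
      have "real s \<le> real (start L (Suc j))" using ji by (simp add: start_Suc)
      also have "\<dots> \<le> X + Y0 / (1 - level j)" unfolding X_def Y0_def by (rule start_Suc_le)
      finally have sX: "real s - X \<le> Y0 / (1 - level j)" by simp
      have split: "4 / \<gamma>0 * Y0 \<le> Y" "2 * \<gamma>2 * Y0 \<le> Y" using Y00 \<gamma>0 \<gamma>2 by (auto simp: Y_def distrib_right)
      show ?thesis
      proof (cases "level j \<le> 1 - \<gamma>0 / 2")
        case True
        have "Y0 / (1 - level j) \<le> Y0 / (\<gamma>0 / 2)" using True Y00 \<gamma>0 u by (intro divide_left_mono) auto
        then have "real s - X \<le> Y0 / (\<gamma>0 / 2)" using sX by linarith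
        then have "(real s - X) * r \<omega> (n0 + Suc s) \<le> Y0 / (\<gamma>0 / 2) * 2"
          using False r[OF wM] Y00 \<gamma>0 by (intro mult_mono) auto
        also have "\<dots> = 4 / \<gamma>0 * Y0" by simp
        finally show ?thesis using split by linarith
      next
        case close: False
        have "1 - \<gamma>0 \<le> ?m" using m close gap(4)[of j] \<gamma>0 by (simp add: field_simps)
        moreover have "?m \<le> 1" using align[OF wM] by auto
        ultimately have "r \<omega> (n0 + Suc s) \<le> \<gamma>2 * (1 - ?m)" unfolding r_def by (rule f_end)
        also have "\<dots> \<le> \<gamma>2 * (2 * (1 - level j))"
          using m gap(4)[of j] u \<gamma>2 by (intro mult_left_mono) auto
        finally have "(real s - X) * r \<omega> (n0 + Suc s) \<le> Y0 / (1 - level j) * (\<gamma>2 * (2 * (1 - level j)))"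
          using sX False r[OF wM] Y00 u by (intro mult_mono) auto
        also have "\<dots> = 2 * \<gamma>2 * Y0"
        proof -
          have alg: "Y0 / x * (\<gamma>2 * (2 * x)) = 2 * \<gamma>2 * Y0" if "x \<noteq> 0" for x using that by simp
          show ?thesis by (rule alg) (use u in simp)
        qed
        finally show ?thesis using split by linarith
      qed
    qed
    have "1 - \<delta> * real T \<le> 1 - \<delta> * real (1 + start L k + i)"
      using \<delta> ki by (auto simp: Tn)
    also have "\<dots> \<le> measure M G" by (rule G)
    also have "\<dots> \<le> measure M {\<omega> \<in> space M. regret d f \<theta>s T \<omega> \<le> min (2 * real T) R}"
    proof (rule I.finite_measure_mono[OF _ meas], rule subsetI)
      fix \<omega> assume w: "\<omega> \<in> G"
      then have wM: "\<omega> \<in> space M" using sets.sets_into_space[OF G(1)] by auto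
      have "{1..T} = {1..n0} \<union> (\<lambda>s. n0 + Suc s) ` {..n}"
      proof (intro equalityI subsetI)
        fix t assume t: "t \<in> {1..T}"
        show "t \<in> {1..n0} \<union> (\<lambda>s. n0 + Suc s) ` {..n}"
        proof (cases "t \<le> n0")
          case False
          then show ?thesis using t by (intro UnI2 image_eqI[of _ _ "t - Suc n0"]) (auto simp: Tn)
        qed (use t in auto)
      qed (auto simp: Tn)
      then have "regret d f \<theta>s T \<omega> = (\<Sum>t=1..n0. r \<omega> t) + (\<Sum>t\<in>(\<lambda>s. n0 + Suc s) ` {..n}. r \<omega> t)"
        unfolding reg by (simp only:) (rule sum.union_disjoint, auto)
      also have "(\<Sum>t\<in>(\<lambda>s. n0 + Suc s) ` {..n}. r \<omega> t) = (\<Sum>s\<le>n. r \<omega> (n0 + Suc s))"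
        by (subst sum.reindex) (auto simp: inj_on_def)
      finally have split: "regret d f \<theta>s T \<omega> = (\<Sum>t=1..n0. r \<omega> t) + (\<Sum>s\<le>n. r \<omega> (n0 + Suc s))" .
      have sum: "(\<Sum>s\<le>n. r \<omega> (n0 + Suc s)) \<le> 2 * (X + 2) + Y * (1 + ln (real (Suc n)))"
        by (rule sum_le_harmonic[OF X0 Y_ge]) (use r[OF wM] decay[OF w] in auto)
      have "Y * (1 + ln (real (Suc n))) \<le> Y * (2 * lg (real T))"
      proof (intro mult_left_mono Y_ge)
        have "ln (real (Suc n)) \<le> lg (real T)"
          unfolding lg_def by (subst ln_le_cancel_iff) (auto simp: Tn add_pos_pos intro: add_nonneg_nonneg)
        then show "1 + ln (real (Suc n)) \<le> 2 * lg (real T)" using lgT by linarith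
      qed
      note log = order_trans[OF this Y_le]
      have "x + y \<le> a + b + c + e"
        if "x \<le> u" "y \<le> 2 * (v + 2) + z" "z \<le> e" "u \<le> a" "4 \<le> b" "2 * v \<le> c" for x y a b c e u v z :: real
        using that by argo
      from this[OF init_part[OF wM order_refl] sum log n0_le four X_le]
      have "regret d f \<theta>s T \<omega> \<le> R" unfolding R split .
      then show "\<omega> \<in> {\<omega> \<in> space M. regret d f \<theta>s T \<omega> \<le> min (2 * real T) R}"
        using wM reg_T[OF wM] by simp
    qed
    finally show ?thesis .
  qed
qed

end

end

section \<open>Link functions\<close>

context
  fixes \<gamma>0 \<gamma>1 \<gamma>2 :: real and f f' :: "real \<Rightarrow> real"
  assumes \<gamma>0: "0 < \<gamma>0" "\<gamma>0 \<le> 1 / 10" and \<gamma>1: "0 < \<gamma>1" and \<gamma>2: "0 < \<gamma>2"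
    and link: "link_function \<gamma>0 \<gamma>1 \<gamma>2 f f'"
begin

lemma link_mono: "mono_on {-1..1} f"
  and link_bounded: "y \<in> {-1..1} \<Longrightarrow> \<bar>f y\<bar> \<le> 1"
  and link_deriv: "y \<in> {-1..1} \<Longrightarrow> (f has_real_derivative f' y) (at y within {-1..1})"
  and link_deriv_end: "1 - \<gamma>0 \<le> y \<Longrightarrow> y \<le> 1 \<Longrightarrow> \<gamma>1 \<le> f' y \<and> f' y \<le> \<gamma>2"
  using link by (auto simp: link_function_def abs_le_iff image_subset_iff)

lemma link_continuous: "continuous_on {-1..1} f"
  using link_deriv by (intro DERIV_continuous_on)

lemma link_mvt:
  assumes "-1 \<le> a" "a < b" "b \<le> 1"
  shows "\<exists>x\<in>{a<..<b}. f b - f a = f' x * (b - a)"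
proof -
  have "(f has_derivative (\<lambda>h. f' x * h)) (at x within {a..b})" if "a \<le> x" "x \<le> b" for x
    using has_field_derivative_subset[OF link_deriv[of x], of "{a..b}"] that assms
    by (auto simp: has_field_derivative_def)
  then show ?thesis using mvt_simple[OF assms(2), of f "\<lambda>x h. f' x * h"] by blast
qed

lemma link_end:
  assumes "1 - \<gamma>0 \<le> m" "m \<le> 1"
  shows "f 1 - f m \<le> \<gamma>2 * (1 - m)"
proof (cases "m = 1")
  case False
  then obtain x where x: "x \<in> {m<..<1}" "f 1 - f m = f' x * (1 - m)"
    using link_mvt[of m 1] assms \<gamma>0 by auto
  then show ?thesis using link_deriv_end[of x] assms by (auto intro: mult_right_mono)
qed simp

lemma half_inverse_sqrt:
  assumes "2 \<le> d"
  shows "0 < 1 / (2 * sqrt (real d))" "1 / (2 * sqrt (real d)) \<le> 1 / 2"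
proof -
  have "1 \<le> sqrt (real d)" using assms by simp
  then show "0 < 1 / (2 * sqrt (real d))" "1 / (2 * sqrt (real d)) \<le> 1 / 2" by (auto simp: field_simps)
qed

text \<open>Capping the constant by \<gamma>1 keeps it below \<gamma>2; the tangent bound is the
  mean value theorem.\<close>

lemma rate_profile_const:
  assumes d: "2 \<le> d" and c0: "0 < c0" "\<forall>x\<in>{0..1}. c0 \<le> f' x"
  shows "rate_profile \<gamma>0 \<gamma>1 \<gamma>2 (min c0 \<gamma>1) d f (\<lambda>_. min c0 \<gamma>1)"
proof
  have "\<gamma>1 \<le> \<gamma>2" using link_deriv_end[of 1] \<gamma>0 by auto
  then show "min c0 \<gamma>1 \<le> \<gamma>2" by simp
  show "f x + min c0 \<gamma>1 * u \<le> f (x + u)" if xu: "0 < x" "0 \<le> u" "x + u \<le> 1" for x u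
  proof (cases "u = 0")
    case False
    then have "0 < u" using xu by simp
    then obtain y where y: "y \<in> {x<..<x + u}" "f (x + u) - f x = f' y * u"
      using link_mvt[of x "x + u"] xu by auto
    moreover have "min c0 \<gamma>1 * u \<le> f' y * u"
      using c0 y that by (intro mult_right_mono) (auto intro: min.coboundedI1)
    ultimately show ?thesis by linarith
  qed simp
qed (use \<gamma>0 \<gamma>1 \<gamma>2 c0 d in auto)

text \<open>The tangent theorem concerns interior points; accordingly the conditions of
  \<open>rate_profile\<close> are placed on \<open>0 < x < 1\<close>.\<close>

lemma link_tangent:
  assumes convex: "convex_on {0..1} f" and x: "0 < x" "x < 1" and y: "0 \<le> y" "y \<le> 1"
  shows "f' x * (y - x) \<le> f y - f x"
proof (rule convex_on_imp_above_tangent[OF convex])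
  show "(f has_real_derivative f' x) (at x within {0..1})"
    using link_deriv[of x] x by - (rule has_field_derivative_subset[of f "f' x" x "{-1..1}"], auto)
  show "x \<in> interior {0..1}" using x by (simp add: interior_atLeastAtMost_real)
qed (use y in auto)

text \<open>Convexity makes \<open>f'\<close> monotone, so it is its own profile. Positivity is
  where finiteness of the integral enters: a zero of \<open>f'\<close> would spread to the left and
  make the integrand infinite on an interval of positive length.\<close>

lemma rate_profile_convex:
  assumes d: "2 \<le> d" and convex: "convex_on {0..1} f" and c0: "0 < c0"
    and fin: "burn_in d f' (1 - \<gamma>0 / 2) \<noteq> \<infinity>"
  shows "rate_profile \<gamma>0 \<gamma>1 \<gamma>2 (min c0 \<gamma>1) d f f'"
proof
  note tan = link_tangent[OF convex]
  show mono: "f' x \<le> f' y" if "0 < x" "x \<le> y" "y < 1" for x y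
  proof (cases "x = y")
    case False
    have "f' x * (y - x) + f' y * (x - y) \<le> 0" using tan[of x y] tan[of y x] that by simp
    then have "(f' x - f' y) * (y - x) \<le> 0" by (simp add: algebra_simps)
    then show ?thesis using that False by (simp add: mult_le_0_iff)
  qed simp
  show nonneg: "0 \<le> f' x" if "0 < x" "x < 1" for x
  proof -
    have "f' x * (0 - x) \<le> f 0 - f x" using that by (intro tan) auto
    also have "\<dots> \<le> 0" using mono_onD[OF link_mono, of 0 x] that by simp
    finally show ?thesis using that by (simp add: mult_le_0_iff zero_le_mult_iff)
  qed
  show "0 < f' x" if x: "1 / (2 * sqrt (real d)) < x" "x < 1" for x
  proof (rule ccontr)
    assume n: "\<not> 0 < f' x"
    let ?l = "1 / (2 * sqrt (real d))"
    have l: "0 < ?l" by (rule half_inverse_sqrt[OF d])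
    have x_le: "x < 1 - \<gamma>0" using n link_deriv_end[of x] x \<gamma>1 by force
    have zero: "f' m = 0" if "m \<in> {?l..x}" for m
    proof -
      have "0 < m" by (rule order_less_le_trans[OF l]) (use that in simp)
      moreover have "m \<le> x" using that by simp
      ultimately show ?thesis using mono[of m x] nonneg[of m] n x by auto
    qed
    have "\<infinity> * emeasure lborel {?l..x} = (\<integral>\<^sup>+m. \<infinity> * indicator {?l..x} m \<partial>lborel)"
      by (rule nn_integral_cmult_indicator[symmetric]) simp
    also have "\<dots> \<le> burn_in d f' (1 - \<gamma>0 / 2)"
      unfolding burn_in_def
    proof (rule nn_integral_mono)
      fix m
      show "\<infinity> * indicator {?l..x} m \<le> ennreal m / ennreal ((f' m)\<^sup>2) * indicator {?l..1 - \<gamma>0 / 2} m"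
      proof (cases "m \<in> {?l..x}")
        case True
        then have "0 < m" by - (rule order_less_le_trans[OF l], auto)
        then show ?thesis using zero[OF True] True x_le \<gamma>0 by (simp add: indicator_def)
      qed simp
    qed
    finally show False using fin x by (simp add: ennreal_top_mult top_unique)
  qed
  show "f' x \<le> \<gamma>2" if "0 < x" "x < 1" for x
  proof (cases "1 - \<gamma>0 \<le> x")
    case False
    then have "f' x \<le> f' (1 - \<gamma>0)" using that \<gamma>0 by (intro mono) auto
    then show ?thesis using link_deriv_end[of "1 - \<gamma>0"] \<gamma>0 by auto
  qed (use link_deriv_end[of x] that in auto)
  show "f x + f' x * u \<le> f (x + u)" if "0 < x" "x < 1" "0 \<le> u" "x + u \<le> 1" for x u
    using tan[of x "x + u"] that by simp
  show "min c0 \<gamma>1 \<le> f' x" if "1 - \<gamma>0 \<le> x" "x < 1" for x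
    using link_deriv_end[of x] that by (simp add: min.coboundedI2)
qed (use \<gamma>0 \<gamma>1 \<gamma>2 c0 d in auto)

lemma burn_in_ge:
  assumes d: "2 \<le> d"
  shows "ennreal (9 * \<gamma>0 / (20 * \<gamma>2\<^sup>2)) \<le> burn_in d f' (1 - \<gamma>0 / 2)"
proof -
  let ?I = "{1 - \<gamma>0..1 - \<gamma>0 / 2}"
  have "ennreal (9 * \<gamma>0 / (20 * \<gamma>2\<^sup>2)) = ennreal (9 / 10 / \<gamma>2\<^sup>2) * emeasure lborel ?I"
    using \<gamma>0 by (simp add: ennreal_mult[symmetric])
  also have "\<dots> = (\<integral>\<^sup>+m. ennreal (9 / 10 / \<gamma>2\<^sup>2) * indicator ?I m \<partial>lborel)"
    by (rule nn_integral_cmult_indicator[symmetric]) simp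
  also have "\<dots> \<le> burn_in d f' (1 - \<gamma>0 / 2)"
    unfolding burn_in_def
  proof (rule nn_integral_mono)
    fix m
    show "ennreal (9 / 10 / \<gamma>2\<^sup>2) * indicator ?I m \<le>
        ennreal m / ennreal ((f' m)\<^sup>2) * indicator {1 / (2 * sqrt (real d))..1 - \<gamma>0 / 2} m"
    proof (cases "m \<in> ?I")
      case True
      have "\<gamma>1 \<le> f' m" "f' m \<le> \<gamma>2" using link_deriv_end[of m] True \<gamma>0 by auto
      then have "9 / 10 / \<gamma>2\<^sup>2 \<le> m / (f' m)\<^sup>2"
        using True \<gamma>0 \<gamma>1 by (intro frac_le power_mono) auto
      then have "ennreal (9 / 10 / \<gamma>2\<^sup>2) \<le> ennreal m / ennreal ((f' m)\<^sup>2)"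
        using True \<gamma>0 \<gamma>1 \<open>\<gamma>1 \<le> f' m\<close> by (subst divide_ennreal) (auto intro: ennreal_leI)
      moreover have "1 / (2 * sqrt (real d)) \<le> m" using half_inverse_sqrt[OF d] True \<gamma>0
        unfolding atLeastAtMost_iff by linarith
      ultimately show ?thesis using True by (simp add: indicator_def)
    qed simp
  qed
  finally show ?thesis .
qed

text \<open>For convex \<open>f\<close> the two integrals coincide. A constant profile
  \<open>q\<close> costs at most \<open>1 / q\<^sup>2\<close>, which is compared with the floor in
  \<open>burn_in_ge\<close>; the factor in the statement is the quotient of the two.\<close>

lemma rate_profile_exists:
  assumes d: "2 \<le> d" and c0: "0 < c0" and shape: "(\<forall>x\<in>{0..1}. c0 \<le> f' x) \<or> convex_on {0..1} f"
    and fin: "burn_in d f' (1 - \<gamma>0 / 2) \<noteq> \<infinity>"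
  shows "\<exists>\<phi>. rate_profile \<gamma>0 \<gamma>1 \<gamma>2 (min c0 \<gamma>1) d f \<phi> \<and>
    rate_profile.profile_cost \<gamma>0 d \<phi> \<le>
      ennreal (max 1 (20 * \<gamma>2\<^sup>2 / (9 * \<gamma>0 * (min c0 \<gamma>1)\<^sup>2))) * burn_in d f' (1 - \<gamma>0 / 2)"
  using shape
proof
  assume convex: "convex_on {0..1} f"
  interpret rate_profile \<gamma>0 \<gamma>1 \<gamma>2 "min c0 \<gamma>1" d f f' by (rule rate_profile_convex[OF d convex c0 fin])
  have "profile_cost = 1 * burn_in d f' (1 - \<gamma>0 / 2)" by (simp add: profile_cost_def burn_in_def)
  also have "\<dots> \<le> ennreal (max 1 (20 * \<gamma>2\<^sup>2 / (9 * \<gamma>0 * (min c0 \<gamma>1)\<^sup>2))) * burn_in d f' (1 - \<gamma>0 / 2)"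
    by (intro mult_right_mono) (auto simp: ennreal_1[symmetric] simp del: ennreal_1 intro!: ennreal_leI)
  finally show ?thesis using rate_profile_axioms by blast
next
  assume c: "\<forall>x\<in>{0..1}. c0 \<le> f' x"
  let ?q = "min c0 \<gamma>1"
  interpret rate_profile \<gamma>0 \<gamma>1 \<gamma>2 ?q d f "\<lambda>_. ?q" by (rule rate_profile_const[OF d c0 c])
  let ?l = "1 / (2 * sqrt (real d))"
  have q: "0 < ?q" using c0 \<gamma>1 by simp
  have "profile_cost \<le> (\<integral>\<^sup>+m. ennreal (1 / ?q\<^sup>2) * indicator {?l..1 - \<gamma>0 / 2} m \<partial>lborel)"
    unfolding profile_cost_def
  proof (rule nn_integral_mono)
    fix m :: real
    show "ennreal m / ennreal (?q\<^sup>2) * indicator {?l..1 - \<gamma>0 / 2} m \<le> ennreal (1 / ?q\<^sup>2) * indicator {?l..1 - \<gamma>0 / 2} m"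
    proof (cases "m \<in> {?l..1 - \<gamma>0 / 2}")
      case True
      then have "0 \<le> m" "m \<le> 1" using half_inverse_sqrt[OF d] \<gamma>0
        unfolding atLeastAtMost_iff by linarith+
      then have "ennreal m / ennreal (?q\<^sup>2) \<le> ennreal (1 / ?q\<^sup>2)"
        using q by (subst divide_ennreal) (auto intro!: ennreal_leI divide_right_mono)
      then show ?thesis by (intro mult_right_mono) auto
    qed simp
  qed
  also have "\<dots> = ennreal (1 / ?q\<^sup>2) * emeasure lborel {?l..1 - \<gamma>0 / 2}"
    by (rule nn_integral_cmult_indicator) simp
  also have "\<dots> \<le> ennreal (1 / ?q\<^sup>2) * ennreal 1"
  proof (rule mult_left_mono)
    have l: "0 < ?l" "?l \<le> 1 - \<gamma>0 / 2" using half_inverse_sqrt[OF d] \<gamma>0 by linarith+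
    have "emeasure lborel {?l..1 - \<gamma>0 / 2} = ennreal (1 - \<gamma>0 / 2 - ?l)"
      by (rule emeasure_lborel_Icc[OF l(2)])
    also have "\<dots> \<le> ennreal 1" using l(1) \<gamma>0 by (intro ennreal_leI) linarith
    finally show "emeasure lborel {?l..1 - \<gamma>0 / 2} \<le> ennreal 1" .
  qed simp
  also have "\<dots> = ennreal (20 * \<gamma>2\<^sup>2 / (9 * \<gamma>0 * ?q\<^sup>2)) * ennreal (9 * \<gamma>0 / (20 * \<gamma>2\<^sup>2))"
    using \<gamma>0 \<gamma>2 q by (simp add: ennreal_mult[symmetric])
  also have "\<dots> \<le> ennreal (max 1 (20 * \<gamma>2\<^sup>2 / (9 * \<gamma>0 * ?q\<^sup>2))) * burn_in d f' (1 - \<gamma>0 / 2)"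
    by (intro mult_mono burn_in_ge d ennreal_leI) auto
  finally show ?thesis using rate_profile_axioms by blast
qed

end

text \<open>Transfers a bound in the real number \<open>B\<close> to the burn-in integral as an
  \<open>ennreal\<close>; the factor \<open>c'\<close> is at least 1 and spreads over both summands.
  Regret uses it with \<open>e = 0\<close>.\<close>

lemma exploration_ennreal:
  fixes t c c' Q D e B :: real and b b' :: ennreal
  assumes t: "t \<le> c * Q * (D * B + e)" and B: "ennreal B \<le> ennreal c' * b" "0 \<le> B" and b: "b \<le> b'"
    and nonneg: "0 \<le> c" "1 \<le> c'" "0 \<le> Q" "0 \<le> D" "0 \<le> e"
  shows "ennreal t \<le> ennreal (c * c' * Q) * (ennreal D * b' + ennreal e)"
proof -
  have "ennreal t \<le> ennreal (c * Q * (D * B + e))" by (rule ennreal_leI[OF t])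
  also have "\<dots> = ennreal (c * Q) * (ennreal D * ennreal B + ennreal e)"
    using nonneg B by (simp add: ennreal_mult ennreal_plus)
  also have "\<dots> \<le> ennreal (c * Q) * (ennreal D * (ennreal c' * b') + ennreal c' * ennreal e)"
  proof (intro mult_left_mono add_mono)
    show "ennreal B \<le> ennreal c' * b'" using B(1) mult_left_mono[OF b, of "ennreal c'"] by (simp add: order_trans)
    have "1 * ennreal e \<le> ennreal c' * ennreal e"
      using nonneg by (intro mult_right_mono) (auto simp: ennreal_1[symmetric] simp del: ennreal_1 intro!: ennreal_leI)
    then show "ennreal e \<le> ennreal c' * ennreal e" by simp
  qed auto
  also have "\<dots> = ennreal (c * Q) * ennreal c' * (ennreal D * b' + ennreal e)"
    by (simp only: distrib_left ac_simps)
  also have "ennreal (c * Q) * ennreal c' = ennreal (c * c' * Q)"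
    using nonneg by (simp add: ennreal_mult[symmetric] ac_simps)
  finally show ?thesis .
qed

theorem corollary1p7:
  fixes \<gamma>0 \<gamma>1 \<gamma>2 c0 C0 :: real and k0 :: nat
  assumes "0 < \<gamma>0" "\<gamma>0 \<le> 1 / 10" "0 < \<gamma>1" "0 < \<gamma>2" "0 < c0" "0 < C0"
  shows "\<exists>(C::real) (k::nat). 0 < C \<and>
    (\<forall>(d::nat) (f::real \<Rightarrow> real) (f'::real \<Rightarrow> real) (\<delta>::real) (n0::nat).
      2 \<le> d \<longrightarrow> link_function \<gamma>0 \<gamma>1 \<gamma>2 f f' \<longrightarrow>
      (\<forall>x\<in>{0..1}. c0 \<le> f' x) \<or> convex_on {0..1} f \<longrightarrow>
      0 < \<delta> \<longrightarrow> init_budget C0 k0 d f \<delta> n0 \<longrightarrow>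
      (\<forall>\<epsilon>::real. 0 < \<epsilon> \<longrightarrow>
        (\<exists>\<eta> \<sigma>. schedules \<eta> \<sigma> \<and>
          (\<exists>T>n0.
            ennreal (real T) \<le>
              ennreal (C * (lg (real d) * lg (1 / \<epsilon>) * lg (1 / \<delta>)) ^ k) *
                (ennreal ((real d)\<^sup>2) * burn_in d f' (1 - \<gamma>0 / 4) + ennreal ((real d)\<^sup>2 / \<epsilon>)) \<and>
            (\<forall>\<theta>s\<in>usphere d. \<forall>M. interactive_sgd M d f f' \<theta>s n0 \<delta> \<eta> \<sigma> \<longrightarrow>
              1 - \<delta> * real T \<le> measure M {\<omega> \<in> space M. 1 - \<epsilon> \<le> alignment d \<theta>s T \<omega>})))) \<and>
      (\<exists>\<eta> \<sigma>. schedules \<eta> \<sigma> \<and>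
        (\<forall>T\<ge>1. \<forall>\<theta>s\<in>usphere d. \<forall>M. interactive_sgd M d f f' \<theta>s n0 \<delta> \<eta> \<sigma> \<longrightarrow>
          1 - \<delta> * real T \<le> measure M {\<omega> \<in> space M.
            ennreal (regret d f \<theta>s T \<omega>) \<le>
              ennreal (C * (lg (real d) * lg (real T) * lg (1 / \<delta>)) ^ k) *
                min (ennreal (real T))
                  (ennreal ((real d)\<^sup>2) * burn_in d f' (1 - \<gamma>0 / 2)
                    + ennreal (real d * sqrt (real T)))})))"
proof -
  define q0 where "q0 = min c0 \<gamma>1"
  \<comment> \<open>The constants are taken outside the locale, where no profile is at hand to prove
    them nonnegative; the absolute value makes them so.\<close>
  define E where "E = \<bar>rate_profile.explore_const \<gamma>0 \<gamma>1 \<gamma>2 q0 C0\<bar>"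
  define R where "R = \<bar>rate_profile.regret_const \<gamma>0 \<gamma>1 \<gamma>2 q0 C0\<bar>"
  define c where "c = max 1 (20 * \<gamma>2\<^sup>2 / (9 * \<gamma>0 * q0\<^sup>2))"
  \<comment> \<open>The 2 covers the trivial regret of at most 2 per round.\<close>
  define C where "C = (E + R) * c + 2"
  define k where "k = k0 + 2"
  have ER: "0 \<le> E" "0 \<le> R" "1 \<le> c" by (auto simp: E_def R_def c_def)
  have C: "2 \<le> C" "E * c \<le> C" "R * c \<le> C" using ER by (auto simp: C_def algebra_simps)
  show ?thesis
  proof (rule exI[of _ C], rule exI[of _ k], intro conjI allI impI)
    show "0 < C" using C by simp
  next
    fix d :: nat and f f' :: "real \<Rightarrow> real" and \<delta> \<epsilon> :: real and n0 :: nat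
    assume d: "2 \<le> d" and link: "link_function \<gamma>0 \<gamma>1 \<gamma>2 f f'"
      and shape: "(\<forall>x\<in>{0..1}. c0 \<le> f' x) \<or> convex_on {0..1} f"
      and \<delta>: "0 < \<delta>" and budget: "init_budget C0 k0 d f \<delta> n0" and \<epsilon>: "0 < \<epsilon>"
    let ?Q = "lg (real d) * lg (1 / \<epsilon>) * lg (1 / \<delta>)"
    have burn: "burn_in d f' (1 - \<gamma>0 / 2) \<le> burn_in d f' (1 - \<gamma>0 / 4)"
      unfolding burn_in_def using assms(1) by (intro nn_integral_mono mult_left_mono) (auto simp: indicator_def)
    have "1 \<le> lg (real d)" "1 \<le> lg (1 / \<epsilon>)" "1 \<le> lg (1 / \<delta>)" using d \<epsilon> \<delta> by (auto intro!: lg_ge_1)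
    then have Q: "1 \<le> ?Q" by (simp add: mult_ge1_I)
    have "1 \<le> ?Q ^ k" using Q by (rule one_le_power)
    show "\<exists>\<eta> \<sigma>. schedules \<eta> \<sigma> \<and>
          (\<exists>T>n0.
            ennreal (real T) \<le>
              ennreal (C * ?Q ^ k) *
                (ennreal ((real d)\<^sup>2) * burn_in d f' (1 - \<gamma>0 / 4) + ennreal ((real d)\<^sup>2 / \<epsilon>)) \<and>
            (\<forall>\<theta>s\<in>usphere d. \<forall>M. interactive_sgd M d f f' \<theta>s n0 \<delta> \<eta> \<sigma> \<longrightarrow>
              1 - \<delta> * real T \<le> measure M {\<omega> \<in> space M. 1 - \<epsilon> \<le> alignment d \<theta>s T \<omega>}))"
    proof (cases "burn_in d f' (1 - \<gamma>0 / 2) = \<infinity>")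
      case True
      \<comment> \<open>The claimed bound on \<open>T\<close> is infinite, and a horizon beyond
        \<open>1 / \<delta>\<close> makes the probability claim trivial.\<close>
      define T where "T = n0 + Suc (nat \<lceil>1 / \<delta>\<rceil>)"
      have "1 / \<delta> \<le> real T" unfolding T_def using real_nat_ceiling_ge[of "1 / \<delta>"] by simp
      then have "1 - \<delta> * real T \<le> 0" using \<delta> by (simp add: field_simps)
      moreover have "ennreal (C * ?Q ^ k) *
          (ennreal ((real d)\<^sup>2) * burn_in d f' (1 - \<gamma>0 / 4) + ennreal ((real d)\<^sup>2 / \<epsilon>)) = \<infinity>"
      proof -
        have inf: "burn_in d f' (1 - \<gamma>0 / 4) = \<infinity>" using burn True by (simp add: top_unique)
        have top: "ennreal a * (ennreal D * \<infinity> + e) = \<infinity>" if "0 < a" "0 < D" for a D e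
          using that by (simp add: ennreal_mult_top)
        show ?thesis unfolding inf
          using C \<open>1 \<le> ?Q ^ k\<close> d by (intro top mult_pos_pos) auto
      qed
      ultimately show ?thesis
        by (intro exI[of _ "\<lambda>_. 1"] conjI exI[of _ T] ballI allI impI order_trans[OF _ measure_nonneg])
          (auto simp: schedules_def T_def)
    next
      case False
      obtain \<phi> where \<phi>: "rate_profile \<gamma>0 \<gamma>1 \<gamma>2 q0 d f \<phi>"
        and cost: "rate_profile.profile_cost \<gamma>0 d \<phi> \<le> ennreal c * burn_in d f' (1 - \<gamma>0 / 2)"
        using rate_profile_exists[OF assms(1-4) link d assms(5) shape False] unfolding q0_def c_def by blast
      interpret rate_profile \<gamma>0 \<gamma>1 \<gamma>2 q0 d f \<phi> by (rule \<phi>)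
      have "profile_cost \<noteq> \<infinity>" using cost False by (auto simp: top_unique ennreal_mult_eq_top_iff)
      then obtain B where B: "profile_cost = ennreal B" "0 \<le> B" by (cases profile_cost) auto
      have sh: "\<gamma>1 \<le> f' shrink" "f' shrink \<le> \<gamma>2"
        using link_deriv_end[OF assms(1-4) link, of shrink] assms(1) by (auto simp: shrink_def)
      let ?L = "max 1 (ln (4 / \<delta>))"
      have "\<exists>T>n0. real T \<le> explore_const C0 * ?Q ^ (k0 + 1) * ((real d)\<^sup>2 * B + (real d)\<^sup>2 / \<epsilon>) \<and>
        (\<forall>\<theta>s\<in>usphere d. \<forall>M. interactive_sgd M d f f' \<theta>s n0 \<delta> (step_sizes ?L) (\<lambda>_. explore) \<longrightarrow>
          1 - \<delta> * real T \<le> measure M {\<omega> \<in> space M. 1 - \<epsilon> \<le> alignment d \<theta>s T \<omega>})"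
        by (rule exploration[where f' = f', OF link_continuous[OF assms(1-4) link] link_mono[OF assms(1-4) link]
              _ sh _ \<delta> assms(6) budget B refl \<epsilon>])
          (erule link_bounded[OF assms(1-4) link], erule (1) link_end[OF assms(1-4) link])
      then obtain T where T: "n0 < T" "real T \<le> explore_const C0 * ?Q ^ (k0 + 1) * ((real d)\<^sup>2 * B + (real d)\<^sup>2 / \<epsilon>)"
        and prob: "\<forall>\<theta>s\<in>usphere d. \<forall>M. interactive_sgd M d f f' \<theta>s n0 \<delta> (step_sizes ?L) (\<lambda>_. explore) \<longrightarrow>
          1 - \<delta> * real T \<le> measure M {\<omega> \<in> space M. 1 - \<epsilon> \<le> alignment d \<theta>s T \<omega>}"
        by (elim exE conjE) (rule that)
      have "ennreal (real T) \<le> ennreal (E * c * ?Q ^ k) *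
          (ennreal ((real d)\<^sup>2) * burn_in d f' (1 - \<gamma>0 / 4) + ennreal ((real d)\<^sup>2 / \<epsilon>))"
      proof (rule exploration_ennreal)
        have "explore_const C0 * ?Q ^ (k0 + 1) \<le> E * ?Q ^ k"
          using Q by (intro mult_mono power_increasing) (auto simp: E_def k_def)
        then have "explore_const C0 * ?Q ^ (k0 + 1) * ((real d)\<^sup>2 * B + (real d)\<^sup>2 / \<epsilon>) \<le>
            E * ?Q ^ k * ((real d)\<^sup>2 * B + (real d)\<^sup>2 / \<epsilon>)"
          using B \<epsilon> by (intro mult_right_mono) auto
        then show "real T \<le> E * ?Q ^ k * ((real d)\<^sup>2 * B + (real d)\<^sup>2 / \<epsilon>)" using T(2) by linarith
      qed (use cost B burn ER Q \<epsilon> in auto)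
      also have "\<dots> \<le> ennreal (C * ?Q ^ k) *
          (ennreal ((real d)\<^sup>2) * burn_in d f' (1 - \<gamma>0 / 4) + ennreal ((real d)\<^sup>2 / \<epsilon>))"
        using C \<open>1 \<le> ?Q ^ k\<close> by (intro mult_right_mono ennreal_leI) auto
      finally have "ennreal (real T) \<le> \<dots>" .
      then show ?thesis
        using T(1) prob schedules_step_sizes[of ?L]
        by (intro exI[of _ "step_sizes ?L"] exI[of _ "\<lambda>_. explore"] conjI exI[of _ T]) auto
    qed
  next
    fix d :: nat and f f' :: "real \<Rightarrow> real" and \<delta> :: real and n0 :: nat
    assume d: "2 \<le> d" and link: "link_function \<gamma>0 \<gamma>1 \<gamma>2 f f'"
      and shape: "(\<forall>x\<in>{0..1}. c0 \<le> f' x) \<or> convex_on {0..1} f"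
      and \<delta>: "0 < \<delta>" and budget: "init_budget C0 k0 d f \<delta> n0"
    let ?Q = "\<lambda>T. lg (real d) * lg (real T) * lg (1 / \<delta>)"
    let ?b = "burn_in d f' (1 - \<gamma>0 / 2)"
    let ?rhs = "\<lambda>T. ennreal (C * ?Q T ^ k) *
      min (ennreal (real T)) (ennreal ((real d)\<^sup>2) * ?b + ennreal (real d * sqrt (real T)))"
    have Q: "1 \<le> ?Q T" if "1 \<le> T" for T
    proof -
      have "1 \<le> lg (real d)" "1 \<le> lg (real T)" "1 \<le> lg (1 / \<delta>)" using d that \<delta> by (auto intro!: lg_ge_1)
      then show ?thesis by (simp add: mult_ge1_I)
    qed
    have trivial: "ennreal x \<le> ennreal (C * ?Q T ^ k) * ennreal (real T)" if "1 \<le> T" "x \<le> 2 * real T" for x T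
    proof -
      have "2 * 1 \<le> C * ?Q T ^ k" using C Q[OF that(1)] by (intro mult_mono one_le_power) auto
      then have "2 * real T \<le> C * ?Q T ^ k * real T" by (intro mult_right_mono) auto
      then have "x \<le> C * ?Q T ^ k * real T" using that by linarith
      then show ?thesis
        using C Q[OF that(1)] by (subst ennreal_mult[symmetric]) (auto intro!: ennreal_leI mult_nonneg_nonneg)
    qed
    show "\<exists>\<eta> \<sigma>. schedules \<eta> \<sigma> \<and>
        (\<forall>T\<ge>1. \<forall>\<theta>s\<in>usphere d. \<forall>M. interactive_sgd M d f f' \<theta>s n0 \<delta> \<eta> \<sigma> \<longrightarrow>
          1 - \<delta> * real T \<le> measure M {\<omega> \<in> space M. ennreal (regret d f \<theta>s T \<omega>) \<le> ?rhs T})"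
    proof (cases "?b = \<infinity>")
      \<comment> \<open>The minimum is \<open>T\<close>, and the bound of 2 per round holds surely
        under any schedule.\<close>
      case True
      have "1 - \<delta> * real T \<le> measure M {\<omega> \<in> space M. ennreal (regret d f \<theta>s T \<omega>) \<le> ?rhs T}"
        if T: "1 \<le> T" and \<theta>s: "\<theta>s \<in> usphere d" and I: "interactive_sgd M d f f' \<theta>s n0 \<delta> (\<lambda>_. 1) (\<lambda>_. 1)"
        for T \<theta>s M
      proof -
        interpret I: interactive_sgd M d f f' \<theta>s n0 \<delta> "\<lambda>_. 1" "\<lambda>_. 1" by (rule I)
        have "ennreal (regret d f \<theta>s T \<omega>) \<le> ?rhs T" if "\<omega> \<in> space M" for \<omega>
          using trivial[OF T I.regret_le[OF \<theta>s link_bounded[OF assms(1-4) link] that]] d True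
          by (simp add: ennreal_mult_top min_def)
        then have "{\<omega> \<in> space M. ennreal (regret d f \<theta>s T \<omega>) \<le> ?rhs T} = space M" by auto
        then show ?thesis using \<delta> I.prob_space by simp
      qed
      then show ?thesis
        by (intro exI[of _ "\<lambda>_. 1"] conjI allI ballI impI) (auto simp: schedules_def)
    next
      case False
      obtain \<phi> where \<phi>: "rate_profile \<gamma>0 \<gamma>1 \<gamma>2 q0 d f \<phi>"
        and cost: "rate_profile.profile_cost \<gamma>0 d \<phi> \<le> ennreal c * ?b"
        using rate_profile_exists[OF assms(1-4) link d assms(5) shape False] unfolding q0_def c_def by blast
      interpret rate_profile \<gamma>0 \<gamma>1 \<gamma>2 q0 d f \<phi> by (rule \<phi>)
      have "profile_cost \<noteq> \<infinity>" using cost False by (auto simp: top_unique ennreal_mult_eq_top_iff)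
      then obtain B where B: "profile_cost = ennreal B" "0 \<le> B" by (cases profile_cost) auto
      have sh: "\<gamma>1 \<le> f' shrink" "f' shrink \<le> \<gamma>2"
        using link_deriv_end[OF assms(1-4) link, of shrink] assms(1) by (auto simp: shrink_def)
      let ?L = "max 1 (ln (4 / \<delta>))"
      have "1 - \<delta> * real T \<le> measure M {\<omega> \<in> space M. ennreal (regret d f \<theta>s T \<omega>) \<le> ?rhs T}"
        if T: "1 \<le> T" and \<theta>s: "\<theta>s \<in> usphere d"
          and I: "interactive_sgd M d f f' \<theta>s n0 \<delta> (step_sizes ?L) (\<lambda>_. explore)" for T \<theta>s M
      proof -
        interpret I: interactive_sgd M d f f' \<theta>s n0 \<delta> "step_sizes ?L" "\<lambda>_. explore" by (rule I)
        let ?S = "min (2 * real T) (regret_const C0 * ?Q T ^ (k0 + 2) * ((real d)\<^sup>2 * B))"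
        have "1 - \<delta> * real T \<le> measure M {\<omega> \<in> space M. regret d f \<theta>s T \<omega> \<le> ?S}"
          by (rule regret_bound[where f' = f', OF link_continuous[OF assms(1-4) link] link_mono[OF assms(1-4) link]
                _ sh _ \<delta> assms(6) budget B refl T \<theta>s I])
            (erule link_bounded[OF assms(1-4) link], erule (1) link_end[OF assms(1-4) link])
        also have "\<dots> \<le> measure M {\<omega> \<in> space M. ennreal (regret d f \<theta>s T \<omega>) \<le> ?rhs T}"
        proof (rule I.finite_measure_mono)
          have "ennreal x \<le> ?rhs T" if "x \<le> ?S" for x
          proof -
            have pow: "0 \<le> ?Q T ^ (k0 + 2)" using Q[OF T] by (intro zero_le_power) linarith
            have "regret_const C0 * ?Q T ^ (k0 + 2) * ((real d)\<^sup>2 * B) \<le> R * ?Q T ^ k * ((real d)\<^sup>2 * B)"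
              unfolding R_def k_def by (rule mult_right_mono[OF mult_right_mono[OF abs_ge_self pow]]) (use B in auto)
            then have "ennreal x \<le> ennreal (R * c * ?Q T ^ k) * (ennreal ((real d)\<^sup>2) * ?b + ennreal 0)"
              using that cost B ER Q[OF T] by (intro exploration_ennreal[where B = B and b = ?b]) auto
            \<comment> \<open>The bound so far consists of the integral term; the term with the
              square root of \<open>T\<close> joins here by monotonicity.\<close>
            also have "\<dots> \<le> ennreal (C * ?Q T ^ k) * (ennreal ((real d)\<^sup>2) * ?b + ennreal (real d * sqrt (real T)))"
              using C Q[OF T] by (intro mult_mono add_left_mono ennreal_leI mult_right_mono) auto
            finally have "ennreal x \<le> \<dots>" .
            moreover have "ennreal x \<le> ennreal (C * ?Q T ^ k) * ennreal (real T)"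
              by (rule trivial[OF T]) (rule min.boundedE[OF that])
            ultimately show ?thesis by (auto simp only: min_def split: if_split)
          qed
          then show "{\<omega> \<in> space M. regret d f \<theta>s T \<omega> \<le> ?S} \<subseteq>
              {\<omega> \<in> space M. ennreal (regret d f \<theta>s T \<omega>) \<le> ?rhs T}" by auto
          have [measurable]: "regret d f \<theta>s T \<in> borel_measurable M"
            by (rule I.regret_measurable[OF \<theta>s link_continuous[OF assms(1-4) link]])
          show "{\<omega> \<in> space M. ennreal (regret d f \<theta>s T \<omega>) \<le> ?rhs T} \<in> sets M" by measurable
        qed
        finally show ?thesis .
      qed
      then show ?thesis
        using schedules_step_sizes[of ?L]
        by (intro exI[of _ "step_sizes ?L"] exI[of _ "\<lambda>_. explore"] conjI allI ballI impI) auto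
    qed
  qed
qed

end
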